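(* Let $\varepsilon\in(0,2)$. Every planar graph $G$ with average degree at least $4+\varepsilon$ contains a $K_4$-model with at most $\lceil 8/\varepsilon\rceil+\lceil 2/\varepsilon\rceil$ vertices. Moreover, this bound is within a constant factor of being optimal: there is an absolute constant $c>0$ such that for every $\varepsilon\in(0,2)$ there exists a planar graph with average degree at least $4+\varepsilon$ in which every $K_4$-model has at least $c/\varepsilon$ vertices.
   Context: Graphs are finite, simple and undirected; the average degree is $2|E(G)|/|V(G)|$. A $K_t$-model in $G$ consists of $t$ pairwise vertex-disjoint connected subgraphs $B_1,\dots,B_t$ (branch sets) such that for all distinct $i,j$ some vertex of $B_i$ is adjacent to some vertex of $B_j$; its number of vertices is $\sum_i|B_i|$. *)

theory Defs
  imports "HOL-Analysis.Analysis"
begin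

record 'a ugraph =
  verts :: "'a set"
  edges :: "'a set set"

definition simple_graph :: "'a ugraph \<Rightarrow> bool" where
  "simple_graph G \<longleftrightarrow> finite (verts G) \<and> (\<forall>e\<in>edges G. e \<subseteq> verts G \<and> card e = 2)"

definition average_degree :: "'a ugraph \<Rightarrow> real" where
  "average_degree G = 2 * real (card (edges G)) / real (card (verts G))"

definition subgraph :: "'a ugraph \<Rightarrow> 'a ugraph \<Rightarrow> bool" where
  "subgraph H G \<longleftrightarrow> simple_graph H \<and> verts H \<subseteq> verts G \<and> edges H \<subseteq> edges G"

definition connected_graph :: "'a ugraph \<Rightarrow> bool" where
  "connected_graph G \<longleftrightarrow> verts G \<noteq> {} \<and>
     (\<forall>u\<in>verts G. \<forall>v\<in>verts G. (u, v) \<in> {(x, y). {x, y} \<in> edges G}\<^sup>*)"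

text \<open>
  A drawing in the Euclidean plane, represented by the type \<open>complex\<close>: vertices are distinct
  points and every edge is a (not necessarily rectilinear or rectifiable) simple arc between its
  ends, whose interior contains no vertex and no point of any other edge.
\<close>

definition plane_drawing ::
    "'a ugraph \<Rightarrow> ('a \<Rightarrow> complex) \<Rightarrow> ('a set \<Rightarrow> real \<Rightarrow> complex) \<Rightarrow> bool" where
  "plane_drawing G p \<gamma> \<longleftrightarrow>
     inj_on p (verts G) \<and>
     (\<forall>e\<in>edges G. arc (\<gamma> e) \<and> {pathstart (\<gamma> e), pathfinish (\<gamma> e)} = p ` e) \<and>
     (\<forall>e\<in>edges G. (path_image (\<gamma> e) - p ` e) \<inter> p ` verts G = {}) \<and>
     (\<forall>e\<in>edges G. \<forall>f\<in>edges G. e \<noteq> f \<longrightarrow> (path_image (\<gamma> e) - p ` e) \<inter> path_image (\<gamma> f) = {})"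

definition planar :: "'a ugraph \<Rightarrow> bool" where
  "planar G \<longleftrightarrow> (\<exists>p \<gamma>. plane_drawing G p \<gamma>)"

text \<open>The branch sets of a \<open>K\<^sub>t\<close>-model are \<open>B 0, \<dots>, B (t - 1)\<close>; other values of \<open>B\<close> are irrelevant.\<close>

definition complete_model :: "nat \<Rightarrow> 'a ugraph \<Rightarrow> (nat \<Rightarrow> 'a ugraph) \<Rightarrow> bool" where
  "complete_model t G B \<longleftrightarrow>
     (\<forall>i<t. subgraph (B i) G \<and> connected_graph (B i)) \<and>
     (\<forall>i<t. \<forall>j<t. i \<noteq> j \<longrightarrow>
        verts (B i) \<inter> verts (B j) = {} \<and>
        (\<exists>x\<in>verts (B i). \<exists>y\<in>verts (B j). {x, y} \<in> edges G))"

definition model_order :: "nat \<Rightarrow> (nat \<Rightarrow> 'a ugraph) \<Rightarrow> nat" where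
  "model_order t B = (\<Sum>i<t. card (verts (B i)))"

end

theory Submission
  imports Defs "HOL-Complex_Analysis.Winding_Numbers"
begin

text \<open>
  Among the vertex sets spanning at least \<open>(2 + \<epsilon> / 2) (n - 2) + 1\<close> edges on their \<open>n \<ge> 3\<close> vertices
  take a smallest one. It induces a 2-connected graph of minimum degree at least 3 in which no two
  adjacent vertices form a cut. Call \<open>\<Sum> (1 - 3 / |F|)\<close>, summed over the faces \<open>F\<close> at a vertex, its
  excess. If the excess is less than 1, then the faces at the vertex contain a \<open>K\<^sub>4\<close>-model. By
  Euler's formula some vertex of degree \<open>d\<close> has excess less than \<open>1 - d / (8 / \<epsilon> + 2)\<close>, and then the
  faces around it have at most \<open>\<lceil>8 / \<epsilon>\<rceil> + 2\<close> vertices in total.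

  Faces are handled combinatorially. An ear decomposition and the theta curve theorem yield a family
  of cycles that covers every edge twice, satisfies Euler's formula and generates all cycles.

  For the lower bound, the square of a path has average degree almost 4 and no \<open>K\<^sub>4\<close>-model. Four
  chords raise the average degree above 4, and if their ends are far apart, then a \<open>K\<^sub>4\<close>-model
  must contain a long piece of the path.
\<close>

section \<open>Paths, cycles and connected sets\<close>

text \<open>The constants come from one computation. With \<open>n\<close> vertices,
  \<open>m\<close> edges and \<open>f\<close> faces, Euler's formula turns the sum of the excesses,
  \<open>2 m - 3 f\<close>, into \<open>3 n - m - 6\<close>, while the degrees add up to
  \<open>2 m\<close>. If every vertex of degree \<open>d\<close> had excess at least
  \<open>1 - d / L\<close>, then \<open>m (1 - 2 / L) \<le> 2 (n - 3)\<close> would follow, and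
  \<open>1 - 2 / L = 4 / (4 + \<epsilon>)\<close> holds exactly for
  \<open>L = 8 / \<epsilon> + 2\<close>. The second summand of the stated bound only has to absorb
  this 2, which it does for \<open>\<epsilon> < 2\<close>.

  The obstacle is that arguments around a vertex seem to need the cyclic order of its edges, which
  is awkward to extract from arbitrary arcs. No such order is set up: every cycle is a sum modulo 2
  of face boundaries, and parity counts of the edges at a vertex take its place.

  The path with chords serves only \<open>\<epsilon> \<le> 1 / 18\<close>. For larger
  \<open>\<epsilon>\<close> any planar graph that is dense enough will do, since
  \<open>1 / (36 * \<epsilon>)\<close> is then below the four vertices that every model has.\<close>

definition adj_in :: "'a set set \<Rightarrow> 'a set \<Rightarrow> ('a \<times> 'a) set" where
  "adj_in E S = {(x, y). x \<in> S \<and> y \<in> S \<and> {x, y} \<in> E}"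

definition conn :: "'a set set \<Rightarrow> 'a set \<Rightarrow> bool" where
  "conn E S \<longleftrightarrow> S \<noteq> {} \<and> (\<forall>u\<in>S. \<forall>v\<in>S. (u, v) \<in> (adj_in E S)\<^sup>*)"

definition nbrs :: "'a set set \<Rightarrow> 'a \<Rightarrow> 'a set" where
  "nbrs E v = {u. {v, u} \<in> E}"

text \<open>The model only has to lie in \<open>W\<close>, so its size is bounded by
  \<open>card W\<close> and branch sets can be rearranged without counting them.\<close>

definition has_model :: "nat \<Rightarrow> 'a set set \<Rightarrow> 'a set \<Rightarrow> bool" where
  "has_model t E W \<longleftrightarrow> (\<exists>S. (\<forall>i<t. conn E (S i) \<and> S i \<subseteq> W) \<and>
     (\<forall>i<t. \<forall>j<t. i \<noteq> j \<longrightarrow> S i \<inter> S j = {} \<and> (\<exists>x\<in>S i. \<exists>y\<in>S j. {x, y} \<in> E)))"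

fun path_edges :: "'a list \<Rightarrow> 'a set set" where
  "path_edges (x # y # zs) = insert {x, y} (path_edges (y # zs))"
| "path_edges _ = {}"

definition cyc_edges :: "'a list \<Rightarrow> 'a set set" where
  "cyc_edges xs = insert {last xs, hd xs} (path_edges xs)"

text \<open>A cycle is its edge set, so that rotated and reversed vertex lists give the same
  object.\<close>

definition is_cycle :: "'a set set \<Rightarrow> bool" where
  "is_cycle C \<longleftrightarrow> (\<exists>xs. distinct xs \<and> length xs \<ge> 3 \<and> C = cyc_edges xs)"

lemma path_edges_Cons: "p \<noteq> [] \<Longrightarrow> path_edges (x # p) = insert {x, hd p} (path_edges p)"
  by (cases p) auto

lemma path_edges_append:
  "xs \<noteq> [] \<Longrightarrow> ys \<noteq> [] \<Longrightarrow>
   path_edges (xs @ ys) = insert {last xs, hd ys} (path_edges xs \<union> path_edges ys)"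
proof (induction xs)
  case (Cons x xs)
  show ?case
  proof (cases xs)
    case Nil
    then show ?thesis using Cons by (simp add: path_edges_Cons)
  next
    case (Cons a list)
    then show ?thesis using Cons.IH Cons.prems by (auto simp: path_edges_Cons)
  qed
qed simp

lemma path_edges_rev: "path_edges (rev xs) = path_edges xs"
proof (induction xs)
  case (Cons x xs)
  show ?case
  proof (cases "xs = []")
    case False
    then show ?thesis using Cons
      by (simp add: path_edges_append path_edges_Cons last_rev insert_commute)
  qed simp
qed simp

lemma path_edges_subset_set: "e \<in> path_edges xs \<Longrightarrow> e \<subseteq> set xs"
  by (induction xs rule: path_edges.induct) auto

lemma finite_path_edges [simp]: "finite (path_edges xs)"
  by (induction xs rule: path_edges.induct) auto

lemma Union_path_edges: "length xs \<ge> 2 \<Longrightarrow> \<Union>(path_edges xs) = set xs"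
proof (induction xs rule: path_edges.induct)
  case (1 x y zs)
  show ?case
  proof (cases zs)
    case Nil
    then show ?thesis by simp
  next
    case (Cons z zs')
    then show ?thesis using 1 by auto
  qed
qed auto

lemma card_path_edges: "distinct xs \<Longrightarrow> card (path_edges xs) = length xs - 1"
proof (induction xs rule: path_edges.induct)
  case (1 x y zs)
  have "{x, y} \<notin> path_edges (y # zs)"
    using 1(2) path_edges_subset_set[of "{x,y}" "y # zs"] by auto
  then show ?case using 1 by simp
qed auto

lemma path_edges_drop: "path_edges (drop n xs) \<subseteq> path_edges xs"
proof (induction xs arbitrary: n)
  case (Cons x xs)
  have "path_edges xs \<subseteq> path_edges (x # xs)" by (cases xs) auto
  then show ?case using Cons.IH by (cases n) (auto dest: subsetD)
qed auto

lemma path_edges_take: "path_edges (take n xs) \<subseteq> path_edges xs"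
proof -
  have "path_edges (take n xs) = path_edges (drop (length xs - n) (rev xs))"
    by (metis path_edges_rev rev_take)
  also have "\<dots> \<subseteq> path_edges xs"
    by (metis path_edges_drop path_edges_rev)
  finally show ?thesis .
qed

lemma path_edges_appendL: "path_edges xs \<subseteq> path_edges (xs @ ys)"
  by (metis append_eq_conv_conj path_edges_take)

lemma path_edges_nbr_hd:
  "distinct (x # p) \<Longrightarrow> {x, y} \<in> path_edges (x # p) \<Longrightarrow> p \<noteq> [] \<and> y = hd p"
proof (cases p)
  case (Cons a p')
  assume "distinct (x # p)" "{x, y} \<in> path_edges (x # p)"
  then show ?thesis using Cons path_edges_subset_set[of "{x,y}" p]
    by (auto simp: doubleton_eq_iff)
qed simp

lemma cyc_edges_Cons:
  "p \<noteq> [] \<Longrightarrow> cyc_edges (v # p) = insert {v, hd p} (insert {v, last p} (path_edges p))"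
  by (auto simp: cyc_edges_def path_edges_Cons insert_commute)

lemma cyc_edges_rotate: "cyc_edges (xs @ ys) = cyc_edges (ys @ xs)"
proof (cases "xs = [] \<or> ys = []")
  case False
  then show ?thesis by (auto simp: cyc_edges_def path_edges_append)
qed auto

lemma cyc_edges_rev: "cyc_edges (rev xs) = cyc_edges xs"
  by (cases "xs = []") (simp_all add: cyc_edges_def path_edges_rev last_rev hd_rev insert_commute)

text \<open>Used to cut a face boundary at two of its vertices, either for an ear or for a
  chord.\<close>

lemma cyc_edges_split:
  "cyc_edges (a # xs @ b # ys) = path_edges (a # xs @ [b]) \<union> path_edges (b # ys @ [a])"
  using path_edges_append[of "a # xs @ [b]" ys] path_edges_append[of "b # ys" "[a]"]
  by (cases "ys = []") (auto simp: cyc_edges_def path_edges_append path_edges_Cons)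

lemma finite_cyc_edges [simp]: "finite (cyc_edges xs)"
  by (simp add: cyc_edges_def)

lemma Union_cyc_edges: "length xs \<ge> 2 \<Longrightarrow> \<Union>(cyc_edges xs) = set xs"
proof -
  assume a: "length xs \<ge> 2"
  then have "xs \<noteq> []" by auto
  then have "{last xs, hd xs} \<subseteq> set xs" by auto
  then show ?thesis using Union_path_edges[OF a] by (auto simp: cyc_edges_def)
qed

lemma card_cyc_edges:
  assumes "distinct xs" "length xs \<ge> 3"
  shows "card (cyc_edges xs) = length xs"
proof -
  obtain x y z zs where xs: "xs = x # y # z # zs"
    using assms(2) by (auto simp: numeral_3_eq_3 Suc_le_length_iff)
  have "{last xs, hd xs} \<notin> path_edges xs"
  proof
    assume "{last xs, hd xs} \<in> path_edges xs"
    then have "{x, last xs} \<in> path_edges (x # y # z # zs)" by (simp add: xs insert_commute)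
    from path_edges_nbr_hd[OF _ this] assms(1) xs show False
      by (metis distinct.simps(2) last_ConsR last_in_set list.sel(1) list.distinct(1))
  qed
  then show ?thesis using assms by (simp add: cyc_edges_def card_path_edges)
qed

lemma cycle_nbrs:
  assumes "distinct (v # p)" "length p \<ge> 2"
  shows "{v, y} \<in> cyc_edges (v # p) \<longleftrightarrow> y = hd p \<or> y = last p" "hd p \<noteq> last p"
proof -
  have p: "p \<noteq> []" using assms(2) by auto
  have "{v, y} \<notin> path_edges p"
    using assms(1) path_edges_subset_set[of "{v,y}" p] by auto
  moreover have "v \<noteq> hd p" "v \<noteq> last p" using assms(1) p by auto
  ultimately show "{v, y} \<in> cyc_edges (v # p) \<longleftrightarrow> y = hd p \<or> y = last p"
    using p by (auto simp: cyc_edges_Cons doubleton_eq_iff)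
  show "hd p \<noteq> last p" using assms
    by (cases p) (auto split: if_splits)
qed

lemma is_cycle_at:
  assumes "is_cycle C" "v \<in> \<Union>C"
  obtains p where "distinct (v # p)" "length p \<ge> 2" "C = cyc_edges (v # p)"
    "\<Union>C = insert v (set p)" "card C = Suc (length p)"
proof -
  obtain xs where xs: "distinct xs" "length xs \<ge> 3" "C = cyc_edges xs"
    using assms(1) by (auto simp: is_cycle_def)
  have "v \<in> set xs" using assms(2) xs Union_cyc_edges[of xs] by auto
  then obtain as bs where ab: "xs = as @ v # bs" by (meson split_list)
  let ?p = "bs @ as"
  have *: "distinct (v # ?p)" "length ?p \<ge> 2" using xs ab by auto
  have C: "C = cyc_edges (v # ?p)" using xs ab cyc_edges_rotate[of as "v # bs"] by simp
  moreover have "\<Union>C = insert v (set ?p)" using C Union_cyc_edges[of "v # ?p"] * by auto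
  moreover have "card C = Suc (length ?p)" using C card_cyc_edges[of "v # ?p"] * by auto
  ultimately show thesis using * that by blast
qed

lemma is_cycleI: "distinct (v # p) \<Longrightarrow> length p \<ge> 2 \<Longrightarrow> is_cycle (cyc_edges (v # p))"
  unfolding is_cycle_def by (rule exI[of _ "v # p"]) auto

section \<open>Connected vertex sets\<close>

lemma adj_in_mono: "S \<subseteq> T \<Longrightarrow> E \<subseteq> F \<Longrightarrow> adj_in E S \<subseteq> adj_in F T"
  by (auto simp: adj_in_def)

lemma adj_in_rtrancl_sym: "(x, y) \<in> (adj_in E S)\<^sup>* \<Longrightarrow> (y, x) \<in> (adj_in E S)\<^sup>*"
proof -
  have "sym (adj_in E S)" by (auto simp: sym_def adj_in_def insert_commute)
  then show "(x, y) \<in> (adj_in E S)\<^sup>* \<Longrightarrow> (y, x) \<in> (adj_in E S)\<^sup>*"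
    by (meson sym_rtrancl symD)
qed

lemma adj_in_rtrancl_in: "(x, y) \<in> (adj_in E S)\<^sup>* \<Longrightarrow> x \<in> S \<Longrightarrow> y \<in> S"
  by (induction rule: rtrancl_induct) (auto simp: adj_in_def)

lemma conn_path:
  assumes "path_edges xs \<subseteq> E" "xs \<noteq> []"
  shows "conn E (set xs)"
  using assms
proof (induction xs rule: path_edges.induct)
  case (1 x y zs)
  let ?R = "(adj_in E (set (x # y # zs)))\<^sup>*"
  have IH: "conn E (set (y # zs))" using 1 by auto
  have sub: "(adj_in E (set (y # zs)))\<^sup>* \<subseteq> ?R" by (intro rtrancl_mono adj_in_mono) auto
  have y: "(y, v) \<in> ?R" if "v \<in> set (y # zs)" for v using IH that sub by (auto simp: conn_def)
  have "(y, x) \<in> ?R" using 1 by (auto simp: adj_in_def insert_commute)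
  then have "(y, v) \<in> ?R" if "v \<in> set (x # y # zs)" for v using that y by auto
  then have "(u, v) \<in> ?R" if "u \<in> set (x # y # zs)" "v \<in> set (x # y # zs)" for u v
    using that by (meson adj_in_rtrancl_sym rtrancl_trans)
  then show ?case unfolding conn_def by blast
qed (auto simp: conn_def)

lemma conn_sing [simp]: "conn E {x}"
  by (auto simp: conn_def)

lemma conn_two: "{x, y} \<in> E \<Longrightarrow> conn E {x, y}"
  using conn_path[of "[x, y]" E] by simp

lemma rtrancl_path:
  assumes "(x, y) \<in> (adj_in E S)\<^sup>*" "x \<in> S"
  obtains p where "distinct p" "p \<noteq> []" "hd p = x" "last p = y" "set p \<subseteq> S" "path_edges p \<subseteq> E"
proof -
  have "\<exists>p. distinct p \<and> p \<noteq> [] \<and> hd p = x \<and> last p = y \<and> set p \<subseteq> S \<and> path_edges p \<subseteq> E"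
    using assms(1)
  proof (induction rule: rtrancl_induct)
    case base
    then show ?case using assms(2) by (intro exI[of _ "[x]"]) auto
  next
    case (step y z)
    then obtain p where p: "distinct p" "p \<noteq> []" "hd p = x" "last p = y" "set p \<subseteq> S" "path_edges p \<subseteq> E"
      by blast
    have z: "z \<in> S" "{y, z} \<in> E" using step by (auto simp: adj_in_def)
    show ?case
    proof (cases "z \<in> set p")
      \<comment> \<open>The walk returns to the path built so far, which is then cut off at
        \<open>z\<close>.\<close>
      case True
      then obtain as bs where ab: "p = as @ z # bs" by (meson split_list)
      have "path_edges (as @ [z]) \<subseteq> path_edges p"
        using path_edges_appendL[of "as @ [z]" bs] ab by simp
      then have "path_edges (as @ [z]) \<subseteq> E" using p by auto
      moreover have "hd (as @ [z]) = x" using p ab by (cases as) auto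
      ultimately show ?thesis using p ab by (intro exI[of _ "as @ [z]"]) auto
    next
      case False
      then show ?thesis using p z
        by (intro exI[of _ "p @ [z]"]) (auto simp: path_edges_append)
    qed
  qed
  then show thesis using that by blast
qed

lemma conn_obtain_path:
  assumes "conn E S" "x \<in> S" "y \<in> S"
  obtains p where "distinct p" "p \<noteq> []" "hd p = x" "last p = y" "set p \<subseteq> S" "path_edges p \<subseteq> E"
  using assms rtrancl_path[of x y E S] unfolding conn_def by blast

lemma conn_component: "x \<in> S \<Longrightarrow> conn E {y. (x, y) \<in> (adj_in E S)\<^sup>*}"
proof -
  assume x: "x \<in> S"
  let ?T = "{y. (x, y) \<in> (adj_in E S)\<^sup>*}"
  have "(x, y) \<in> (adj_in E ?T)\<^sup>*" if "(x, y) \<in> (adj_in E S)\<^sup>*" for y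
    using that
  proof (induction rule: rtrancl_induct)
    case (step y z)
    then have "(y, z) \<in> adj_in E ?T" by (auto simp: adj_in_def intro: rtrancl_into_rtrancl)
    then show ?case using step.IH by (meson rtrancl_into_rtrancl)
  qed simp
  then show ?thesis unfolding conn_def
    by (metis (no_types, lifting) adj_in_rtrancl_sym empty_iff mem_Collect_eq rtrancl.rtrancl_refl rtrancl_trans)
qed

lemma conn_closed:
  assumes "conn E S" "A \<subseteq> S" "A \<noteq> {}" "\<And>x y. x \<in> A \<Longrightarrow> y \<in> S \<Longrightarrow> {x, y} \<in> E \<Longrightarrow> y \<in> A"
  shows "A = S"
proof -
  obtain a where a: "a \<in> A" using assms by auto
  have "y \<in> A" if "(a, y) \<in> (adj_in E S)\<^sup>*" for y
    using that by (induction rule: rtrancl_induct) (use a assms in \<open>auto simp: adj_in_def\<close>)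
  then show ?thesis using assms a unfolding conn_def by blast
qed

lemma conn_imp_nbr:
  assumes "conn E S" "x \<in> S" "y \<in> S" "x \<noteq> y"
  obtains z where "z \<in> S" "{x, z} \<in> E"
proof -
  have "(x, y) \<in> (adj_in E S)\<^sup>*" using assms by (auto simp: conn_def)
  then show thesis using assms(4) that
    by (cases rule: converse_rtranclE) (auto simp: adj_in_def)
qed

section \<open>Sides of a theta curve\<close>

text \<open>Arcs are point sets with two named ends. The parametrization is hidden, so that arcs can
  be reversed and combined freely.\<close>

definition arc_set :: "complex set \<Rightarrow> complex \<Rightarrow> complex \<Rightarrow> bool" where
  "arc_set A a b \<longleftrightarrow> (\<exists>g. arc g \<and> pathstart g = a \<and> pathfinish g = b \<and> path_image g = A)"

lemma arc_set_sym: "arc_set A a b \<Longrightarrow> arc_set A b a"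
  unfolding arc_set_def by (metis arc_reversepath path_image_reversepath pathfinish_reversepath pathstart_reversepath)

lemma arc_set_neq: "arc_set A a b \<Longrightarrow> a \<noteq> b"
  unfolding arc_set_def by (metis arc_distinct_ends)

lemma arc_set_ends: "arc_set A a b \<Longrightarrow> a \<in> A \<and> b \<in> A"
  unfolding arc_set_def by (metis pathfinish_in_path_image pathstart_in_path_image)

lemma arc_set_join:
  assumes "arc_set A a b" "arc_set B b c" "A \<inter> B \<subseteq> {b}"
  shows "arc_set (A \<union> B) a c"
proof -
  obtain g h where g: "arc g" "pathstart g = a" "pathfinish g = b" "path_image g = A"
    and h: "arc h" "pathstart h = b" "pathfinish h = c" "path_image h = B"
    using assms by (auto simp: arc_set_def)
  have "arc (g +++ h)" using g h assms by (intro arc_join) auto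
  then show ?thesis unfolding arc_set_def using g h
    by (intro exI[of _ "g +++ h"]) (auto simp: path_image_join)
qed

text \<open>For the last claim: an end outside the closure of the interior would be an isolated
  point of the connected set \<open>A\<close>. The claim later places the ends of an ear on the
  boundary of the face that contains its interior.\<close>

lemma arc_set_interior:
  assumes "arc_set A a b"
  shows "connected (A - {a, b})" "A - {a, b} \<noteq> {}" "closed A"
    "A \<subseteq> closure (A - {a, b})"
proof -
  obtain g where g: "arc g" "pathstart g = a" "pathfinish g = b" "path_image g = A"
    using assms by (auto simp: arc_set_def)
  then have s: "simple_path g" by (simp add: arc_imp_simple_path)
  show "connected (A - {a, b})" "A - {a, b} \<noteq> {}"
    using connected_simple_path_endless[OF s] nonempty_simple_path_endless[OF s] g by auto
  show c: "closed A" using g closed_arc_image by blast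
  show "A \<subseteq> closure (A - {a, b})"
  proof
    fix x assume x: "x \<in> A"
    show "x \<in> closure (A - {a, b})"
    proof (rule ccontr)
      assume n: "x \<notin> closure (A - {a, b})"
      then have xab: "x \<in> {a, b}" using x closure_subset[of "A - {a, b}"] by blast
      have conA: "connected A" using g connected_arc_image by blast
      obtain e where e: "e > 0" "ball x e \<inter> (A - {a, b}) = {}"
      proof -
        obtain e where "e > 0" "\<And>y. y \<in> A - {a, b} \<Longrightarrow> \<not> dist y x < e"
          using n unfolding closure_approachable by blast
        then have "e > 0" "ball x e \<inter> (A - {a, b}) = {}"
          by (simp, metis disjoint_iff dist_commute mem_ball)
        then show thesis by (rule that)
      qed
      have ne: "a \<noteq> b" using assms arc_set_neq by blast
      \<comment> \<open>The radius must exclude the other end of the arc as well.\<close>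
      obtain d where d: "d > 0" "d \<le> e" "ball x d \<inter> A = {x}"
      proof
        show "min e (dist a b) > 0" using e ne by auto
        show "min e (dist a b) \<le> e" by simp
        show "ball x (min e (dist a b)) \<inter> A = {x}"
        proof -
          have "y = x" if "y \<in> A" "dist x y < e" "dist x y < dist a b" for y
          proof -
            have "y \<in> {a, b}" using e(2) that by (auto simp: disjoint_iff)
            then show ?thesis using xab that(3) by (auto simp: dist_commute)
          qed
          then show ?thesis using e(1) ne x by auto
        qed
      qed
      have "openin (top_of_set A) {x}"
        using d(3) x by (metis Int_commute open_ball openin_open_Int)
      moreover have "closedin (top_of_set A) {x}" using x by auto
      ultimately have "{x} = A" using conA x by (auto simp: connected_clopen)
      then show False using assms arc_set_ends ne by blast
    qed
  qed
qed

section \<open>Jordan curves and their sides\<close>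

definition jordan :: "complex set \<Rightarrow> bool" where
  "jordan J \<longleftrightarrow> (\<exists>c. simple_path c \<and> pathfinish c = pathstart c \<and> path_image c = J)"

text \<open>A bounded face is the inside of its boundary cycle and the unbounded face the outside;
  one predicate serves both.\<close>

definition is_side :: "complex set \<Rightarrow> complex set \<Rightarrow> bool" where
  "is_side D J \<longleftrightarrow> D = inside J \<or> D = outside J"

lemma jordan_arcs:
  assumes "arc_set A a b" "arc_set B a b" "A \<inter> B = {a, b}"
  shows "jordan (A \<union> B)"
proof -
  obtain g h where g: "arc g" "pathstart g = a" "pathfinish g = b" "path_image g = A"
    and h: "arc h" "pathstart h = a" "pathfinish h = b" "path_image h = B"
    using assms by (auto simp: arc_set_def)
  have "simple_path (g +++ reversepath h)"
    using g h assms by (auto simp: simple_path_join_loop_eq arc_reversepath)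
  then show ?thesis unfolding jordan_def using g h
    by (intro exI[of _ "g +++ reversepath h"]) (auto simp: path_image_join)
qed

lemma jordan_sides:
  assumes "jordan J"
  shows "closed J" "open (inside J)" "open (outside J)" "inside J \<noteq> {}" "outside J \<noteq> {}"
    "connected (inside J)" "connected (outside J)"
    "frontier (inside J) = J" "frontier (outside J) = J"
proof -
  obtain c where c: "simple_path c" "pathfinish c = pathstart c" "path_image c = J"
    using assms by (auto simp: jordan_def)
  show "closed J" using c closed_simple_path_image by blast
  show "open (inside J)" "open (outside J)" "inside J \<noteq> {}" "outside J \<noteq> {}"
    "connected (inside J)" "connected (outside J)"
    "frontier (inside J) = J" "frontier (outside J) = J"
    using Jordan_inside_outside[OF c(1,2)] c(3) by auto
qed

lemma side_props:
  assumes "jordan J" "is_side D J"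
  shows "open D" "connected D" "D \<noteq> {}" "frontier D = J" "D \<inter> J = {}" "closure D = D \<union> J"
proof -
  show "open D" "connected D" "D \<noteq> {}" "frontier D = J"
    using assms jordan_sides[of J] by (auto simp: is_side_def)
  moreover show "D \<inter> J = {}"
    using assms inside_no_overlap[of J] outside_no_overlap[of J] unfolding is_side_def by metis
  ultimately show "closure D = D \<union> J"
    by (metis closure_Un_frontier)
qed

lemma connected_in_side:
  assumes "jordan J" "connected S" "S \<inter> J = {}" "is_side D J" "S \<inter> D \<noteq> {}"
  shows "S \<subseteq> D"
  using connected_Int_frontier[OF assms(2,5)] side_props[OF assms(1,4)] assms(3) by blast

lemma outside_eq: "outside J = - (J \<union> inside J)" for J :: "complex set"
  using inside_Un_outside[of J] inside_Int_outside[of J] outside_no_overlap[of J] by blast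

lemma theta_inside:
  assumes "arc_set c1 a b" "arc_set c2 a b" "arc_set c a b"
    "c1 \<inter> c2 = {a, b}" "c1 \<inter> c = {a, b}" "c2 \<inter> c = {a, b}"
    "c \<inter> inside (c1 \<union> c2) \<noteq> {}"
  shows "inside (c1 \<union> c) \<inter> inside (c2 \<union> c) = {}"
    "inside (c1 \<union> c) \<union> inside (c2 \<union> c) \<union> (c - {a, b}) = inside (c1 \<union> c2)"
proof -
  obtain g1 g2 g where
    g1: "arc g1" "pathstart g1 = a" "pathfinish g1 = b" "path_image g1 = c1" and
    g2: "arc g2" "pathstart g2 = a" "pathfinish g2 = b" "path_image g2 = c2" and
    g: "arc g" "pathstart g = a" "pathfinish g = b" "path_image g = c"
    using assms by (auto simp: arc_set_def)
  have ne: "a \<noteq> b" using assms arc_set_neq by blast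
  note * = split_inside_simple_closed_curve[of g1 a b g2 g]
  have **: thesis if "inside (c1 \<union> c) \<inter> inside (c2 \<union> c) = {} \<Longrightarrow>
    inside (c1 \<union> c) \<union> inside (c2 \<union> c) \<union> (c - {a, b}) = inside (c1 \<union> c2) \<Longrightarrow> thesis" for thesis
    by (rule *) (use that g1 g2 g assms(4-) ne in \<open>simp_all add: arc_imp_simple_path\<close>)
  show "inside (c1 \<union> c) \<inter> inside (c2 \<union> c) = {}"
    "inside (c1 \<union> c) \<union> inside (c2 \<union> c) \<union> (c - {a, b}) = inside (c1 \<union> c2)"
    by (rule **, assumption)+
qed

text \<open>
  The three loops formed by a theta curve have additive winding numbers, and these are
  \<open>\<plusminus>1\<close> inside and \<open>0\<close> outside. So a point is inside an even number of the loops.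
\<close>

lemma theta_parity:
  assumes "arc_set c1 a b" "arc_set c2 a b" "arc_set c a b"
    "c1 \<inter> c2 = {a, b}" "c1 \<inter> c = {a, b}" "c2 \<inter> c = {a, b}"
    "z \<in> inside (c1 \<union> c2)" "z \<notin> c"
  shows "z \<in> inside (c1 \<union> c) \<or> z \<in> inside (c2 \<union> c)"
proof (rule ccontr)
  assume n: "\<not> ?thesis"
  obtain g1 g2 g where
    g1: "arc g1" "pathstart g1 = a" "pathfinish g1 = b" "path_image g1 = c1" and
    g2: "arc g2" "pathstart g2 = a" "pathfinish g2 = b" "path_image g2 = c2" and
    g: "arc g" "pathstart g = a" "pathfinish g = b" "path_image g = c"
    using assms by (auto simp: arc_set_def)
  note pa = g1(1)[THEN arc_imp_path] g2(1)[THEN arc_imp_path] g(1)[THEN arc_imp_path]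
  have z: "z \<notin> c1" "z \<notin> c2" using assms(7) by (auto simp: inside_def)
  have "z \<in> outside (c1 \<union> c)" "z \<in> outside (c2 \<union> c)"
    using n z assms(8) by (auto simp: outside_eq)
  then have "winding_number (g1 +++ reversepath g) z = 0" "winding_number (g2 +++ reversepath g) z = 0"
    using g1 g2 g pa by (auto intro!: winding_number_zero_in_outside simp: path_image_join)
  then have "winding_number g1 z = winding_number g z" "winding_number g2 z = winding_number g z"
    using g1 g2 g pa z assms(8)
    by (simp_all add: winding_number_join winding_number_reversepath)
  then have "winding_number (g1 +++ reversepath g2) z = 0"
    using g1 g2 g pa z by (simp add: winding_number_join winding_number_reversepath)
  moreover have "simple_path (g1 +++ reversepath g2)"
    using g1 g2 assms by (auto simp: simple_path_join_loop_eq arc_reversepath)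
  moreover have "z \<in> inside (path_image (g1 +++ reversepath g2))"
    using assms(7) g1 g2 by (simp add: path_image_join)
  ultimately show False
    using simple_closed_path_norm_winding_number_inside by fastforce
qed

text \<open>Each of the two insides would avoid the boundary of the other, so by connectedness they
  would be equal. Equal frontiers would then leave no room for the interior of
  \<open>c2\<close>.\<close>

lemma theta_inside_mono:
  assumes "arc_set c1 a b" "arc_set c2 a b" "arc_set c a b"
    "c1 \<inter> c2 = {a, b}" "c1 \<inter> c = {a, b}" "c2 \<inter> c = {a, b}"
    "z \<in> inside (c1 \<union> c2)" "z \<in> inside (c1 \<union> c)"
    "c \<inter> inside (c1 \<union> c2) = {}" "c2 \<inter> inside (c1 \<union> c) = {}"
  shows False
proof -
  have J12: "jordan (c1 \<union> c2)" and J1c: "jordan (c1 \<union> c)"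
    using jordan_arcs[OF assms(1,2,4)] jordan_arcs[OF assms(1,3,5)] by simp_all
  have "inside (c1 \<union> c2) \<subseteq> inside (c1 \<union> c)"
  proof (rule connected_in_side[OF J1c jordan_sides(6)[OF J12]])
    show "inside (c1 \<union> c2) \<inter> (c1 \<union> c) = {}"
      using assms(9) inside_no_overlap[of "c1 \<union> c2"] by blast
    show "inside (c1 \<union> c2) \<inter> inside (c1 \<union> c) \<noteq> {}" using assms(7,8) by blast
  qed (simp add: is_side_def)
  moreover have "inside (c1 \<union> c) \<subseteq> inside (c1 \<union> c2)"
  proof (rule connected_in_side[OF J12 jordan_sides(6)[OF J1c]])
    show "inside (c1 \<union> c) \<inter> (c1 \<union> c2) = {}"
      using assms(10) inside_no_overlap[of "c1 \<union> c"] by blast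
    show "inside (c1 \<union> c) \<inter> inside (c1 \<union> c2) \<noteq> {}" using assms(7,8) by blast
  qed (simp add: is_side_def)
  ultimately have "inside (c1 \<union> c2) = inside (c1 \<union> c)" by (rule subset_antisym)
  then have "c1 \<union> c2 = c1 \<union> c"
    using jordan_sides(8)[OF J12] jordan_sides(8)[OF J1c] by metis
  then have "c2 - {a, b} \<subseteq> {}" using assms(4,6) by blast
  then show False using arc_set_interior(2)[OF assms(2)] by blast
qed

text \<open>By parity a point inside \<open>c1 \<union> c2\<close> is inside one more of the loops,
  and by \<open>theta_inside_mono\<close> the arc that is not part of that loop must enter
  it.\<close>

lemma theta_outside:
  assumes "arc_set c1 a b" "arc_set c2 a b" "arc_set c a b"
    "c1 \<inter> c2 = {a, b}" "c1 \<inter> c = {a, b}" "c2 \<inter> c = {a, b}"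
    "c \<inter> inside (c1 \<union> c2) = {}"
  shows "c2 \<inter> inside (c1 \<union> c) \<noteq> {} \<or> c1 \<inter> inside (c2 \<union> c) \<noteq> {}"
proof (rule ccontr)
  assume n: "\<not> ?thesis"
  have J12: "jordan (c1 \<union> c2)" using assms by (intro jordan_arcs)
  obtain z where z: "z \<in> inside (c1 \<union> c2)" using jordan_sides(4)[OF J12] by auto
  then have "z \<notin> c" using assms(7) by blast
  from theta_parity[OF assms(1-6) z this] show False
  proof
    assume "z \<in> inside (c1 \<union> c)"
    then show False using theta_inside_mono[OF assms(1-6) z] n assms(7) by auto
  next
    assume *: "z \<in> inside (c2 \<union> c)"
    have "z \<in> inside (c2 \<union> c1)" using z by (simp add: Un_commute)
    from theta_inside_mono[OF assms(2,1,3) _ assms(6,5) this *] show False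
      using n assms(4,7) by (auto simp: Un_commute)
  qed
qed

text \<open>Here \<open>c2\<close> is the middle arc: \<open>theta_inside\<close> splits the inside
  of \<open>c1 \<union> c\<close> along \<open>c2\<close>, and taking complements gives the claims
  about the outside of \<open>c1 \<union> c2\<close>.\<close>

lemma theta_split_outside:
  assumes "arc_set c1 a b" "arc_set c2 a b" "arc_set c a b"
    "c1 \<inter> c2 = {a, b}" "c1 \<inter> c = {a, b}" "c2 \<inter> c = {a, b}"
    "c2 \<inter> inside (c1 \<union> c) \<noteq> {}"
  shows "outside (c1 \<union> c2) - c \<subseteq> outside (c1 \<union> c) \<union> inside (c2 \<union> c)"
    "outside (c1 \<union> c) \<subseteq> outside (c1 \<union> c2)" "inside (c2 \<union> c) \<subseteq> outside (c1 \<union> c2)"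
    "outside (c1 \<union> c) \<inter> inside (c2 \<union> c) = {}"
proof -
  have "c \<inter> c2 = {a, b}" using assms(6) by auto
  note t = theta_inside[OF assms(1,3,2,5,4) this assms(7)]
  have u: "inside (c2 \<union> c) = inside (c \<union> c2)" by (simp add: Un_commute)
  have ab: "{a, b} \<subseteq> c1" using assms by auto
  note o = outside_eq
  show "outside (c1 \<union> c2) - c \<subseteq> outside (c1 \<union> c) \<union> inside (c2 \<union> c)"
    using t(2) u ab unfolding o by blast
  show "outside (c1 \<union> c) \<subseteq> outside (c1 \<union> c2)"
    using t(2) u ab unfolding o by blast
  have "inside (c \<union> c2) \<inter> (c1 \<union> c2) = {}"
    using t inside_no_overlap[of "c1 \<union> c"] inside_no_overlap[of "c \<union> c2"] by blast
  then show "inside (c2 \<union> c) \<subseteq> outside (c1 \<union> c2)"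
    using t(1) u unfolding o by blast
  show "outside (c1 \<union> c) \<inter> inside (c2 \<union> c) = {}"
    using t(2) u unfolding o by blast
qed

text \<open>This is what an ear \<open>c\<close> does to a face \<open>D\<close>. If
  \<open>D\<close> is the outer side, the new unbounded face is bounded by \<open>c\<close> and by
  whichever of \<open>c1\<close> and \<open>c2\<close> is not enclosed.\<close>

lemma theta_split:
  assumes arcs: "arc_set c1 a b" "arc_set c2 a b" "arc_set c a b"
    and int: "c1 \<inter> c2 = {a, b}" "c1 \<inter> c = {a, b}" "c2 \<inter> c = {a, b}"
    and D: "is_side D (c1 \<union> c2)" "c - {a, b} \<subseteq> D"
  obtains D1 D2 where "is_side D1 (c1 \<union> c)" "is_side D2 (c2 \<union> c)" "D1 \<subseteq> D" "D2 \<subseteq> D"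
    "D - c \<subseteq> D1 \<union> D2" "D1 \<inter> D2 = {}"
proof -
  have ne: "c - {a, b} \<noteq> {}" using arc_set_interior(2)[OF arcs(3)] .
  show thesis
  proof (cases "D = inside (c1 \<union> c2)")
    case True
    then have "c \<inter> inside (c1 \<union> c2) \<noteq> {}" using ne D by auto
    note t = theta_inside[OF arcs int this]
    show ?thesis using t True by (intro that[of "inside (c1 \<union> c)" "inside (c2 \<union> c)"])
        (auto simp: is_side_def)
  next
    case False
    then have Do: "D = outside (c1 \<union> c2)" using D by (auto simp: is_side_def)
    have "c \<inter> inside (c1 \<union> c2) = {}"
      using D(2) Do inside_Int_outside[of "c1 \<union> c2"] inside_no_overlap[of "c1 \<union> c2"] int by blast
    from theta_outside[OF arcs int this] show ?thesis
    proof
      assume "c2 \<inter> inside (c1 \<union> c) \<noteq> {}"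
      note t = theta_split_outside[OF arcs int this]
      show ?thesis using t Do by (intro that[of "outside (c1 \<union> c)" "inside (c2 \<union> c)"])
          (auto simp: is_side_def)
    next
      assume *: "c1 \<inter> inside (c2 \<union> c) \<noteq> {}"
      have "c2 \<inter> c1 = {a, b}" using int by auto
      note t = theta_split_outside[OF arcs(2,1,3) this int(3,2) *]
      have "outside (c2 \<union> c1) = D" by (simp add: Do Un_commute)
      then show ?thesis using t by (intro that[of "inside (c1 \<union> c)" "outside (c2 \<union> c)"])
          (auto simp: is_side_def)
    qed
  qed
qed

section \<open>Faces of plane graphs\<close>

text \<open>Shows that a path whose inner vertices avoid a graph has no edge in common with
  it.\<close>

lemma path_edges_meets:
  assumes "e \<in> path_edges (a # r @ [b])" "r \<noteq> []"
  shows "e \<inter> set r \<noteq> {}"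
proof -
  have "path_edges (a # r @ [b]) = insert {a, hd r} (insert {last r, b} (path_edges r))"
    using assms(2) by (auto simp: path_edges_Cons path_edges_append)
  then consider "e = {a, hd r}" | "e = {last r, b}" | "e \<in> path_edges r" using assms by auto
  then show ?thesis
  proof cases
    case 3
    have "e \<noteq> {}" if "e \<in> path_edges xs" for xs :: "'a list"
      using that by (induction xs rule: path_edges.induct) auto
    then show ?thesis using 3 path_edges_subset_set by fast
  qed (use assms in auto)
qed

locale plane_graph =
  fixes V :: "'a set" and E :: "'a set set" and pos :: "'a \<Rightarrow> complex" and \<gamma> :: "'a set \<Rightarrow> real \<Rightarrow> complex"
  assumes finV: "finite V" and simp: "\<And>e. e \<in> E \<Longrightarrow> e \<subseteq> V \<and> card e = 2"
    and drawing: "plane_drawing \<lparr>verts = V, edges = E\<rparr> pos \<gamma>"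
begin

definition img :: "'a set set \<Rightarrow> complex set" where
  "img C = (\<Union>e\<in>C. path_image (\<gamma> e))"

lemma img_Un: "img (A \<union> B) = img A \<union> img B"
  by (auto simp: img_def)

lemma img_mono: "A \<subseteq> B \<Longrightarrow> img A \<subseteq> img B"
  by (auto simp: img_def)

lemma finE: "finite E"
  using finV simp by (meson PowI finite_Pow_iff finite_subset subsetI)

lemma inj_pos: "inj_on pos V"
  using drawing by (simp add: plane_drawing_def)

lemma edge_interior_vertices: "e \<in> E \<Longrightarrow> (path_image (\<gamma> e) - pos ` e) \<inter> pos ` V = {}"
  using drawing unfolding plane_drawing_def by simp

lemma edge_interiors:
  "e \<in> E \<Longrightarrow> f \<in> E \<Longrightarrow> e \<noteq> f \<Longrightarrow> (path_image (\<gamma> e) - pos ` e) \<inter> path_image (\<gamma> f) = {}"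
  using drawing unfolding plane_drawing_def by simp

lemma edge_arc:
  assumes "{a, b} \<in> E"
  shows "arc_set (path_image (\<gamma> {a, b})) (pos a) (pos b)"
proof -
  have *: "arc (\<gamma> {a, b})" "{pathstart (\<gamma> {a, b}), pathfinish (\<gamma> {a, b})} = {pos a, pos b}"
    using drawing assms by (auto simp: plane_drawing_def)
  from *(2) consider "pathstart (\<gamma> {a, b}) = pos a" "pathfinish (\<gamma> {a, b}) = pos b"
    | "pathstart (\<gamma> {a, b}) = pos b" "pathfinish (\<gamma> {a, b}) = pos a"
    by (auto simp: doubleton_eq_iff)
  then show ?thesis
  proof cases
    case 1
    then show ?thesis using * unfolding arc_set_def by blast
  next
    case 2
    then have "arc_set (path_image (\<gamma> {a, b})) (pos b) (pos a)"
      using * unfolding arc_set_def by blast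
    then show ?thesis by (rule arc_set_sym)
  qed
qed

lemma edge_pair: "e \<in> E \<Longrightarrow> \<exists>a b. e = {a, b} \<and> a \<noteq> b \<and> a \<in> V \<and> b \<in> V"
  using simp[of e] by (auto simp: card_2_iff)

lemma vertex_on_edge:
  assumes "v \<in> V" "e \<in> E"
  shows "pos v \<in> path_image (\<gamma> e) \<longleftrightarrow> v \<in> e"
proof
  assume "pos v \<in> path_image (\<gamma> e)"
  then have "pos v \<in> pos ` e" using edge_interior_vertices assms by blast
  then show "v \<in> e" using inj_pos assms simp[of e] by (auto simp: inj_on_def)
next
  assume v: "v \<in> e"
  obtain a b where ab: "e = {a, b}" using edge_pair assms by blast
  show "pos v \<in> path_image (\<gamma> e)" using arc_set_ends[OF edge_arc[of a b]] assms v ab by auto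
qed

lemma edge_inter:
  assumes "e \<in> E" "f \<in> E" "e \<noteq> f"
  shows "path_image (\<gamma> e) \<inter> path_image (\<gamma> f) \<subseteq> pos ` (e \<inter> f)"
proof
  fix x assume x: "x \<in> path_image (\<gamma> e) \<inter> path_image (\<gamma> f)"
  have "x \<in> pos ` e" "x \<in> pos ` f"
    using edge_interiors[OF assms] edge_interiors[OF assms(2,1)] assms(3) x by blast+
  then obtain u w where uw: "u \<in> e" "w \<in> f" "x = pos u" "x = pos w" by auto
  then have "u = w" using inj_pos simp assms by (metis inj_on_def subsetD)
  then show "x \<in> pos ` (e \<inter> f)" using uw by auto
qed

lemma img_inter:
  assumes "A \<subseteq> E" "B \<subseteq> E" "A \<inter> B = {}"
  shows "img A \<inter> img B \<subseteq> pos ` (\<Union>A \<inter> \<Union>B)"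
proof
  fix x assume "x \<in> img A \<inter> img B"
  then obtain e f where ef: "e \<in> A" "f \<in> B" "x \<in> path_image (\<gamma> e) \<inter> path_image (\<gamma> f)"
    by (auto simp: img_def)
  then have "x \<in> pos ` (e \<inter> f)" using edge_inter[of e f] assms by blast
  then show "x \<in> pos ` (\<Union>A \<inter> \<Union>B)" using ef by auto
qed

lemma vertex_on_img:
  assumes "v \<in> V" "C \<subseteq> E"
  shows "pos v \<in> img C \<longleftrightarrow> v \<in> \<Union>C"
  using assms vertex_on_edge by (auto simp: img_def)

lemma path_arc:
  assumes "distinct xs" "length xs \<ge> 2" "path_edges xs \<subseteq> E"
  shows "arc_set (img (path_edges xs)) (pos (hd xs)) (pos (last xs))"
  using assms
proof (induction xs rule: path_edges.induct)
  case (1 x y zs)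
  have e: "arc_set (path_image (\<gamma> {x, y})) (pos x) (pos y)" using 1 edge_arc by simp
  show ?case
  proof (cases "zs = []")
    case True
    then show ?thesis using e by (simp add: img_def)
  next
    case False
    have IH: "arc_set (img (path_edges (y # zs))) (pos y) (pos (last (y # zs)))"
      using 1 False by (cases zs) auto
    have nin: "{x, y} \<notin> path_edges (y # zs)"
      using 1(2) path_edges_subset_set[of "{x, y}" "y # zs"] by auto
    have "img {{x, y}} \<inter> img (path_edges (y # zs)) \<subseteq> pos ` ({x, y} \<inter> \<Union>(path_edges (y # zs)))"
      using img_inter[of "{{x, y}}" "path_edges (y # zs)"] nin 1 by auto
    also have "\<dots> \<subseteq> {pos y}"
      using 1(2) path_edges_subset_set[of _ "y # zs"] by auto
    finally have "path_image (\<gamma> {x, y}) \<inter> img (path_edges (y # zs)) \<subseteq> {pos y}"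
      by (simp add: img_def)
    from arc_set_join[OF e IH this] show ?thesis using False by (simp add: img_def)
  qed
qed auto

lemma jordan_cycle:
  assumes "is_cycle C" "C \<subseteq> E"
  shows "jordan (img C)"
proof -
  obtain xs where xs: "distinct xs" "length xs \<ge> 3" "C = cyc_edges xs"
    using assms by (auto simp: is_cycle_def)
  \<comment> \<open>One edge and the rest of the cycle are two arcs with common ends.\<close>
  obtain a b r where r: "xs = a # b # r" "r \<noteq> []" using xs
    by (cases xs rule: path_edges.cases) (auto simp: Suc_le_eq)
  have C: "C = path_edges [a, b] \<union> path_edges (b # r @ [a])"
    using cyc_edges_split[of a "[]" b r] xs r by simp
  have "path_edges [a, b] \<inter> path_edges (b # r @ [a]) = {}"
    using path_edges_meets[of "{a, b}" b r a] xs r by auto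
  then have "img (path_edges [a, b]) \<inter> img (path_edges (b # r @ [a])) \<subseteq>
     pos ` (\<Union>(path_edges [a, b]) \<inter> \<Union>(path_edges (b # r @ [a])))"
    using C assms by (intro img_inter) auto
  moreover have 1: "arc_set (img (path_edges [a, b])) (pos a) (pos b)"
    using path_arc[of "[a, b]"] xs r C assms by auto
  moreover have 2: "arc_set (img (path_edges (b # r @ [a]))) (pos a) (pos b)"
    using path_arc[of "b # r @ [a]"] xs r C assms by (auto intro: arc_set_sym)
  ultimately have "img (path_edges [a, b]) \<inter> img (path_edges (b # r @ [a])) = {pos a, pos b}"
    using arc_set_ends[OF 1] arc_set_ends[OF 2] by auto
  from jordan_arcs[OF 1 2 this] show ?thesis unfolding C img_Un .
qed

text \<open>The invariant of the ear decomposition, with boundary cycles \<open>bd i\<close> and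
  open regions \<open>D i\<close>. Faces are numbered rather than identified with their boundaries,
  because the two faces of a single cycle have the same boundary.\<close>

definition faces_of :: "'a set set \<Rightarrow> nat \<Rightarrow> (nat \<Rightarrow> 'a set set) \<Rightarrow> (nat \<Rightarrow> complex set) \<Rightarrow> bool" where
  "faces_of H n bd D \<longleftrightarrow>
     (\<forall>i<n. is_cycle (bd i) \<and> bd i \<subseteq> H \<and> is_side (D i) (img (bd i)) \<and> D i \<inter> img H = {}) \<and>
     (\<forall>i<n. \<forall>j<n. i \<noteq> j \<longrightarrow> D i \<inter> D j = {}) \<and>
     (\<forall>e\<in>H. card {i. i < n \<and> e \<in> bd i} = 2) \<and>
     n + card (\<Union>H) = card H + 2 \<and> - img H \<subseteq> (\<Union>i<n. D i)"

lemma faces_of_cycle: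
  assumes "is_cycle C" "C \<subseteq> E"
  shows "faces_of C 2 (\<lambda>_. C) (\<lambda>i. if i = 0 then inside (img C) else outside (img C))"
proof -
  obtain xs where xs: "distinct xs" "length xs \<ge> 3" "C = cyc_edges xs"
    using assms by (auto simp: is_cycle_def)
  then have "card (\<Union>C) = card C" using card_cyc_edges[of xs] Union_cyc_edges[of xs]
    by (simp add: distinct_card)
  moreover have "{i::nat. i < 2} = {0, 1}" by auto
  moreover have "- img C \<subseteq> outside (img C) \<union> inside (img C)"
    by (metis Un_commute inside_Un_outside order_refl)
  moreover have "{..<2} = {0, 1::nat}" by auto
  moreover have "inside (img C) \<inter> img C = {}" "outside (img C) \<inter> img C = {}"
    "inside (img C) \<inter> outside (img C) = {}" "outside (img C) \<inter> inside (img C) = {}"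
    by (metis inside_no_overlap outside_no_overlap inside_Int_outside Int_commute)+
  ultimately show ?thesis using assms unfolding faces_of_def is_side_def
    by (simp add: less_2_cases_iff)
qed

text \<open>The interior of the ear is connected and avoids \<open>img H\<close>, so it lies in a
  single face \<open>D i\<close>. Both ends are then on the boundary of that face, and
  \<open>theta_split\<close> divides it.\<close>

lemma faces_of_ear:
  assumes F: "faces_of H n bd D" and H: "H \<subseteq> E"
    and q: "distinct (a # q0 @ [b])" "path_edges (a # q0 @ [b]) \<subseteq> E" "path_edges (a # q0 @ [b]) \<inter> H = {}"
      "a \<in> \<Union>H" "b \<in> \<Union>H" "set q0 \<inter> \<Union>H = {}"
  shows "\<exists>bd' D'. faces_of (H \<union> path_edges (a # q0 @ [b])) (Suc n) bd' D'"
proof -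
  let ?q = "a # q0 @ [b]"
  define P where "P = img (path_edges ?q)"
  have Uq: "\<Union>(path_edges ?q) = set ?q" by (rule Union_path_edges) simp
  have UH: "\<Union>H \<subseteq> V" using H simp by blast
  have abV: "a \<in> V" "b \<in> V" using q UH by auto
  have arcP: "arc_set P (pos a) (pos b)" using path_arc[of ?q] q by (simp add: P_def)
  have "P \<inter> img H \<subseteq> pos ` (set ?q \<inter> \<Union>H)" using img_inter[OF q(2) H q(3)] unfolding Uq P_def .
  also have "set ?q \<inter> \<Union>H = {a, b}" using q by auto
  finally have PH: "P \<inter> img H \<subseteq> {pos a, pos b}" by simp
  let ?P0 = "P - {pos a, pos b}"
  have P0: "?P0 \<subseteq> - img H" using PH by blast
  obtain x where x: "x \<in> ?P0" using arc_set_interior(2)[OF arcP] by blast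
  moreover have cover: "- img H \<subseteq> (\<Union>i<n. D i)" using F by (simp add: faces_of_def)
  ultimately obtain i where i: "i < n" "x \<in> D i" using P0 by blast
  have Fi: "is_cycle (bd j)" "bd j \<subseteq> H" "is_side (D j) (img (bd j))" "D j \<inter> img H = {}" if "j < n" for j
    using F that by (simp_all add: faces_of_def)
  have Fd: "D j \<inter> D k = {}" if "j < n" "k < n" "j \<noteq> k" for j k
    using F that by (simp add: faces_of_def)
  have J: "jordan (img (bd i))" using Fi[OF i(1)] H by (intro jordan_cycle) auto
  note sp = side_props[OF J Fi(3)[OF i(1)]]
  have P0D: "?P0 \<subseteq> D i"
  proof (rule connected_in_side[OF J arc_set_interior(1)[OF arcP]])
    show "?P0 \<inter> img (bd i) = {}" using P0 img_mono[OF Fi(2)[OF i(1)]] by blast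
  qed (use Fi i x in auto)
  \<comment> \<open>The ends of the ear lie in the closure of \<open>D i\<close>; as points of
    \<open>img H\<close> they are not in \<open>D i\<close> itself, so they are on its
    boundary.\<close>
  have "P \<subseteq> D i \<union> img (bd i)"
    using subset_trans[OF arc_set_interior(4)[OF arcP] closure_mono[OF P0D]] unfolding sp(6) .
  then have in_cl: "pos a \<in> D i \<union> img (bd i)" "pos b \<in> D i \<union> img (bd i)"
    using arc_set_ends[OF arcP] by (simp_all add: subset_eq)
  have posH: "pos a \<in> img H" "pos b \<in> img H" using vertex_on_img H q(4,5) abV by auto
  then have "pos a \<notin> D i" "pos b \<notin> D i" using Fi(4)[OF i(1)] by auto
  then have "pos a \<in> img (bd i)" "pos b \<in> img (bd i)" using in_cl by auto
  then have abi: "a \<in> \<Union>(bd i)" "b \<in> \<Union>(bd i)"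
    using vertex_on_img[OF abV(1), of "bd i"] vertex_on_img[OF abV(2), of "bd i"] Fi(2)[OF i(1)] H by auto
  obtain r where r: "distinct (a # r)" "length r \<ge> 2" "bd i = cyc_edges (a # r)" "\<Union>(bd i) = insert a (set r)"
    using is_cycle_at[OF Fi(1)[OF i(1)] abi(1)] by metis
  have "a \<noteq> b" using q(1) by auto
  then have "b \<in> set r" using abi(2) unfolding r(4) by simp
  then obtain r1 r2 where r12: "r = r1 @ b # r2" by (meson split_list)
  define A1 where "A1 = path_edges (a # r1 @ [b])"
  define A2 where "A2 = path_edges (b # r2 @ [a])"
  have bdA: "bd i = A1 \<union> A2" using r(3) unfolding r12 A1_def A2_def cyc_edges_split .
  have dis1: "distinct (a # r1 @ [b])" "distinct (b # r2 @ [a])" using r(1) r12 by auto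
  have U1: "\<Union>A1 = set (a # r1 @ [b])" "\<Union>A2 = set (b # r2 @ [a])"
    unfolding A1_def A2_def by (rule Union_path_edges, simp)+
  have c1: "card A1 = length r1 + 1" "card A2 = length r2 + 1"
    unfolding A1_def A2_def using card_path_edges dis1 by fastforce+
  \<comment> \<open>The two arcs together have exactly as many edges, counted separately, as the
    cycle, so they share none.\<close>
  have "card (bd i) = length r1 + length r2 + 2"
    using card_cyc_edges[of "a # r"] r r12 by simp
  then have "card (A1 \<inter> A2) = 0"
    using card_Un_Int[of A1 A2] c1 bdA by (simp add: A1_def A2_def)
  then have A12: "A1 \<inter> A2 = {}" by (simp add: A1_def A2_def)
  have AH: "A1 \<subseteq> H" "A2 \<subseteq> H" using bdA Fi(2)[OF i(1)] by auto
  have arc1: "arc_set (img A1) (pos a) (pos b)"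
    using path_arc[of "a # r1 @ [b]"] dis1 AH H by (simp add: A1_def)
  have arc2: "arc_set (img A2) (pos a) (pos b)"
    using path_arc[of "b # r2 @ [a]"] dis1 AH H by (simp add: A2_def arc_set_sym)
  have i12: "img A1 \<inter> img A2 = {pos a, pos b}"
  proof -
    have "img A1 \<inter> img A2 \<subseteq> pos ` (\<Union>A1 \<inter> \<Union>A2)" using AH H A12 by (intro img_inter) auto
    also have "\<Union>A1 \<inter> \<Union>A2 = {a, b}" unfolding U1 using r(1) r12 by auto
    finally show ?thesis using arc_set_ends[OF arc1] arc_set_ends[OF arc2] by auto
  qed
  have i1P: "img A1 \<inter> P = {pos a, pos b}"
    using PH img_mono[OF AH(1)] arc_set_ends[OF arc1] arc_set_ends[OF arcP] by blast
  have i2P: "img A2 \<inter> P = {pos a, pos b}"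
    using PH img_mono[OF AH(2)] arc_set_ends[OF arc2] arc_set_ends[OF arcP] by blast
  have "is_side (D i) (img A1 \<union> img A2)" using Fi(3)[OF i(1)] bdA by (simp add: img_Un P_def[symmetric])
  then obtain D1 D2 where D12: "is_side D1 (img A1 \<union> P)" "is_side D2 (img A2 \<union> P)"
    "D1 \<subseteq> D i" "D2 \<subseteq> D i" "D i - P \<subseteq> D1 \<union> D2" "D1 \<inter> D2 = {}"
    using theta_split[OF arc1 arc2 arcP i12 i1P i2P _ P0D] by metis
  let ?E = "path_edges ?q"
  \<comment> \<open>The part at \<open>A1\<close> keeps the number \<open>i\<close> and the part at
    \<open>A2\<close> gets the new number \<open>n\<close>. Thus only the edges of \<open>A2\<close>
    change faces.\<close>
  let ?bd = "bd(i := A1 \<union> ?E, n := A2 \<union> ?E)" and ?D = "D(i := D1, n := D2)"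
  \<comment> \<open>If \<open>r1\<close> and \<open>q0\<close> were both empty, the arc and the ear
    would be the same edge \<open>ab\<close>, which is in \<open>H\<close>. Hence the new boundaries
    have at least three vertices.\<close>
  have rq: "r1 @ q0 \<noteq> []" "r2 @ q0 \<noteq> []"
    using AH q(3) by (auto simp: A1_def A2_def insert_commute)
  have sr: "set r1 \<subseteq> \<Union>H" "set r2 \<subseteq> \<Union>H" using Union_mono[OF AH(1)] Union_mono[OF AH(2)] unfolding U1 by simp_all
  have revq: "path_edges (b # rev q0 @ [a]) = ?E" using path_edges_rev[of ?q] by simp
  have cyc1: "is_cycle (A1 \<union> ?E)"
  proof -
    have "cyc_edges (a # r1 @ b # rev q0) = A1 \<union> ?E"
      unfolding cyc_edges_split revq A1_def ..
    moreover have "distinct (a # r1 @ b # rev q0)" using dis1 q sr by auto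
    moreover have "length (a # r1 @ b # rev q0) \<ge> 3" using rq(1) by (cases r1; cases q0) auto
    ultimately show ?thesis unfolding is_cycle_def by metis
  qed
  have cyc2: "is_cycle (A2 \<union> ?E)"
  proof -
    have "cyc_edges (b # r2 @ a # q0) = A2 \<union> ?E"
      unfolding cyc_edges_split A2_def ..
    moreover have "distinct (b # r2 @ a # q0)" using dis1 q sr by auto
    moreover have "length (b # r2 @ a # q0) \<ge> 3" using rq(2) by (cases r2; cases q0) auto
    ultimately show ?thesis unfolding is_cycle_def by metis
  qed
  have PD: "D j \<inter> P = {}" if "j < n" "j \<noteq> i" for j
  proof -
    have "pos a \<notin> D j" "pos b \<notin> D j" using Fi(4)[OF that(1)] posH by auto
    then show ?thesis using P0D Fd[OF that(1) i(1) that(2)] by blast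
  qed
  have D1P: "D1 \<inter> P = {}" "D2 \<inter> P = {}"
    using side_props(5)[OF jordan_arcs[OF arc1 arcP i1P] D12(1)] side_props(5)[OF jordan_arcs[OF arc2 arcP i2P] D12(2)]
    by auto
  have part1: "is_cycle (?bd j) \<and> ?bd j \<subseteq> H \<union> ?E \<and> is_side (?D j) (img (?bd j)) \<and> ?D j \<inter> img (H \<union> ?E) = {}"
    if j: "j < Suc n" for j
  proof -
    consider "j = n" | "j = i" "i \<noteq> n" | "j < n" "j \<noteq> i" using j i by linarith
    then show ?thesis
    proof cases
      case 1
      then show ?thesis using cyc2 AH D12 D1P Fi(4)[OF i(1)] by (auto simp: img_Un P_def[symmetric])
    next
      case 2
      then show ?thesis using cyc1 AH D12 D1P Fi(4)[OF i(1)] by (auto simp: img_Un P_def[symmetric])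
    next
      case 3
      then show ?thesis using Fi[of j] PD[of j] by (auto simp: img_Un P_def[symmetric])
    qed
  qed
  have part2: "?D j \<inter> ?D k = {}" if "j < Suc n" "k < Suc n" "j \<noteq> k" for j k
  proof -
    have *: "D1 \<inter> D l = {}" "D2 \<inter> D l = {}" if "l < n" "l \<noteq> i" for l
      using Fd[OF that(1) i(1) that(2)] D12 by auto
    have n: "k < n" if "k < Suc n" "k \<noteq> n" for k using that by simp
    show ?thesis
      using that i(1) *[of j] *[of k] D12(6) Fd[of j k] n[of j] n[of k]
      by (simp add: Int_commute)
  qed
  have part3: "card {j. j < Suc n \<and> e \<in> ?bd j} = 2" if e: "e \<in> H \<union> ?E" for e
  proof (cases "e \<in> ?E")
    case True
    then have "e \<notin> H" using q by auto
    then have "{j. j < Suc n \<and> e \<in> ?bd j} = {i, n}"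
      using True i Fi(2) by (auto simp: less_Suc_eq)
    then show ?thesis using i by simp
  next
    case False
    then have "e \<in> H" using e by auto
    then have c: "card {j. j < n \<and> e \<in> bd j} = 2" using F by (simp add: faces_of_def)
    show ?thesis
    proof (cases "e \<in> A2")
      case True
      then have "e \<notin> A1" using A12 by auto
      then have "{j. j < Suc n \<and> e \<in> ?bd j} = insert n ({j. j < n \<and> e \<in> bd j} - {i})"
        using True False i by (auto simp: less_Suc_eq)
      moreover have "i \<in> {j. j < n \<and> e \<in> bd j}" using True bdA i by auto
      ultimately show ?thesis using c by (simp add: card_Diff_singleton)
    next
      case ne: False
      then have "{j. j < Suc n \<and> e \<in> ?bd j} = {j. j < n \<and> e \<in> bd j}"
        using False i bdA by (auto simp: less_Suc_eq)
      then show ?thesis using c by simp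
    qed
  qed
  \<comment> \<open>An ear with \<open>k\<close> inner vertices adds \<open>k\<close> vertices,
    \<open>k + 1\<close> edges and one face.\<close>
  have part4: "Suc n + card (\<Union>(H \<union> ?E)) = card (H \<union> ?E) + 2"
  proof -
    have finH: "finite H" using H finE finite_subset by blast
    have "card (H \<union> ?E) = card H + card ?E" using q(3) finH by (metis card_Un_disjoint finite_path_edges inf_commute)
    moreover have "card ?E = length q0 + 1" using card_path_edges[OF q(1)] by simp
    moreover have "\<Union>(H \<union> ?E) = \<Union>H \<union> set q0" using Uq q by auto
    moreover have "card (\<Union>H \<union> set q0) = card (\<Union>H) + length q0"
    proof -
      have "finite (\<Union>H)" by (rule finite_subset[OF UH finV])
      then have "card (\<Union>H \<union> set q0) = card (\<Union>H) + card (set q0)"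
        using q(6) by (metis card_Un_disjoint finite_set inf_commute)
      then show ?thesis using q by (simp add: distinct_card)
    qed
    moreover have "n + card (\<Union>H) = card H + 2" using F by (simp add: faces_of_def)
    ultimately show ?thesis by simp
  qed
  have part5: "- img (H \<union> ?E) \<subseteq> (\<Union>j<Suc n. ?D j)"
  proof
    fix z assume "z \<in> - img (H \<union> ?E)"
    then have z: "z \<notin> img H" "z \<notin> P" by (auto simp: img_Un P_def[symmetric])
    then obtain j where j: "j < n" "z \<in> D j" using cover by blast
    show "z \<in> (\<Union>j<Suc n. ?D j)"
    proof (cases "j = i")
      case True
      then have "z \<in> D1 \<union> D2" using j z D12 by auto
      moreover have "?D i = D1" "?D n = D2" using i by auto
      ultimately show ?thesis using i by (metis UN_I UnE lessI less_SucI lessThan_iff)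
    next
      case False
      then have "?D j = D j" using j by auto
      then show ?thesis using j by (metis UN_I less_SucI lessThan_iff)
    qed
  qed
  have "faces_of (H \<union> ?E) (Suc n) ?bd ?D"
    unfolding faces_of_def using part1 part2 part3 part4 part5 by blast
  then show ?thesis by blast
qed

text \<open>If no missing edge joins two vertices of \<open>H\<close>, some edge \<open>ab\<close>
  leaves \<open>H\<close> at \<open>a\<close>, and the graph without \<open>a\<close> contains a way
  back from \<open>b\<close>; the ear ends where this way first meets \<open>H\<close>. The cycle in
  \<open>H\<close> provides a vertex other than \<open>a\<close> to return to.\<close>

lemma ear_exists:
  assumes con: "conn E V" "\<And>v. v \<in> V \<Longrightarrow> conn E (V - {v})"
    and H: "H \<subseteq> E" "H \<noteq> E" "is_cycle C" "C \<subseteq> H"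
  shows "\<exists>a q0 b. distinct (a # q0 @ [b]) \<and> path_edges (a # q0 @ [b]) \<subseteq> E \<and>
    path_edges (a # q0 @ [b]) \<inter> H = {} \<and> a \<in> \<Union>H \<and> b \<in> \<Union>H \<and> set q0 \<inter> \<Union>H = {}"
proof (cases "\<exists>e\<in>E - H. e \<subseteq> \<Union>H")
  case True
  then obtain e where e: "e \<in> E" "e \<notin> H" "e \<subseteq> \<Union>H" by auto
  obtain a b where "e = {a, b}" "a \<noteq> b" using edge_pair[OF e(1)] by auto
  then show ?thesis using e by (intro exI[of _ a] exI[of _ "[]"] exI[of _ b]) auto
next
  case False
  have UH: "\<Union>H \<subseteq> V" using H simp by blast
  obtain xs where xs: "distinct xs" "length xs \<ge> 3" "C = cyc_edges xs"
    using H by (auto simp: is_cycle_def)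
  have UC: "\<Union>C = set xs" using Union_cyc_edges[of xs] xs by simp
  obtain e where e: "e \<in> E" "e \<notin> H" using H by auto
  then have "\<not> e \<subseteq> \<Union>H" using False by auto
  then have "\<Union>H \<noteq> V" using simp[OF e(1)] by auto
  moreover have "\<Union>H \<noteq> {}" using UC xs H(4) by (metis Sup_subset_mono empty_subsetI length_greater_0_conv
        not_numeral_le_zero set_empty subset_antisym list.size(3))
  ultimately obtain a b where ab: "a \<in> \<Union>H" "b \<in> V" "{a, b} \<in> E" "b \<notin> \<Union>H"
    using conn_closed[OF con(1) UH] by blast
  have "card (set xs) \<ge> 3" using xs by (simp add: distinct_card)
  then have "\<not> set xs \<subseteq> {a}" using card_mono[of "{a}" "set xs"] by auto
  then obtain c where c: "c \<in> \<Union>H" "c \<noteq> a" using UC H(4) by blast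
  have "conn E (V - {a})" using con ab UH by blast
  moreover have "b \<in> V - {a}" "c \<in> V - {a}" using ab c UH by auto
  ultimately obtain r where r: "distinct r" "r \<noteq> []" "hd r = b" "last r = c"
    "set r \<subseteq> V - {a}" "path_edges r \<subseteq> E" using conn_obtain_path by metis
  have "\<exists>x\<in>set r. x \<in> \<Union>H" using r c by (metis last_in_set)
  then obtain r1 d r2 where d: "r = r1 @ d # r2" "d \<in> \<Union>H" "\<forall>x\<in>set r1. x \<notin> \<Union>H"
    using split_list_first_prop[of r "\<lambda>x. x \<in> \<Union>H"] by blast
  have r1: "r1 \<noteq> []" "hd r1 = b" using d r ab by (cases r1; auto)+
  have "path_edges (r1 @ [d]) \<subseteq> path_edges r"
    using path_edges_appendL[of "r1 @ [d]" r2] d by simp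
  then have "path_edges (a # r1 @ [d]) \<subseteq> E" using r r1 ab by (auto simp: path_edges_Cons)
  moreover have "distinct (a # r1 @ [d])" using r d by auto
  moreover have "path_edges (a # r1 @ [d]) \<inter> H = {}"
    using path_edges_meets[OF _ r1(1)] d(3) by fast
  moreover have "set r1 \<inter> \<Union>H = {}" using d(3) by blast
  ultimately show ?thesis using ab(1) d(2) by blast
qed

text \<open>A maximal subgraph that contains \<open>C\<close> and has a family of faces admits no
  further ear, so it is the whole graph.\<close>

lemma faces_exist:
  assumes con: "conn E V" "\<And>v. v \<in> V \<Longrightarrow> conn E (V - {v})"
    and C: "is_cycle C" "C \<subseteq> E"
  shows "\<exists>n bd D. faces_of E n bd D"
proof -
  let ?HH = "{H. H \<subseteq> E \<and> C \<subseteq> H \<and> (\<exists>n bd D. faces_of H n bd D)}"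
  have "finite ?HH" using finE by simp
  moreover have "C \<in> ?HH" using faces_of_cycle[OF C] C by blast
  ultimately obtain H where H: "H \<in> ?HH" and max: "\<And>H'. H' \<in> ?HH \<Longrightarrow> H \<subseteq> H' \<Longrightarrow> H' = H"
    using finite_has_maximal[of ?HH] by (metis (no_types, lifting) empty_iff)
  obtain n bd D where F: "faces_of H n bd D" using H by blast
  have "H = E"
  proof (rule ccontr)
    assume "H \<noteq> E"
    have HE: "H \<subseteq> E" "C \<subseteq> H" using H by simp_all
    from ear_exists[OF con HE(1) \<open>H \<noteq> E\<close> C(1) HE(2)]
    obtain a q0 b where q: "distinct (a # q0 @ [b])" "path_edges (a # q0 @ [b]) \<subseteq> E"
      "path_edges (a # q0 @ [b]) \<inter> H = {}" "a \<in> \<Union>H" "b \<in> \<Union>H" "set q0 \<inter> \<Union>H = {}"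
      by metis
    let ?H' = "H \<union> path_edges (a # q0 @ [b])"
    have "?H' \<in> ?HH" using faces_of_ear[OF F HE(1) q] HE q(2) by blast
    then have "?H' = H" using max by blast
    moreover have "path_edges (a # q0 @ [b]) \<noteq> {}" by (cases q0) auto
    ultimately show False using q by blast
  qed
  then show ?thesis using F by blast
qed

text \<open>
  The faces inside the Jordan curve \<open>img C\<close> generate \<open>C\<close>: near an interior point of an edge \<open>e\<close>
  only the two faces bounded by \<open>e\<close> are visible.
\<close>

lemma faces_generate:
  assumes F: "faces_of E n bd D" and C: "is_cycle C" "C \<subseteq> E"
  shows "\<exists>A\<subseteq>{..<n}. \<forall>e\<in>E. e \<in> C \<longleftrightarrow> card {i\<in>A. e \<in> bd i} = 1"
proof (intro exI conjI ballI)
  let ?A = "{i. i < n \<and> D i \<subseteq> inside (img C)}"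
  show "?A \<subseteq> {..<n}" by auto
  fix e assume e: "e \<in> E"
  have Fi: "is_cycle (bd i)" "bd i \<subseteq> E" "is_side (D i) (img (bd i))" "D i \<inter> img E = {}" if "i < n" for i
    using F that by (simp_all add: faces_of_def)
  have Ji: "jordan (img (bd i))" if "i < n" for i using jordan_cycle[OF Fi(1)[OF that] Fi(2)[OF that]] .
  have sp: "connected (D i)" "closure (D i) = D i \<union> img (bd i)" if "i < n" for i
    using side_props[OF Ji[OF that] Fi(3)[OF that]] by auto
  have JC: "jordan (img C)" using C jordan_cycle by blast
  let ?I = "inside (img C)" and ?O = "outside (img C)"
  have sIO: "is_side ?I (img C)" "is_side ?O (img C)" by (simp_all add: is_side_def)
  note sI = side_props[OF JC sIO(1)] and sO = side_props[OF JC sIO(2)]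
  have IO: "?I \<inter> ?O = {}" by simp
  have DC: "D i \<inter> img C = {}" if "i < n" for i using Fi(4)[OF that] img_mono[OF C(2)] by blast
  have DI: "D i \<subseteq> ?I" if "i < n" "D i \<inter> ?I \<noteq> {}" for i
    using connected_in_side[OF JC sp(1)[OF that(1)] DC[OF that(1)] sIO(1) that(2)] .
  have DO: "D i \<subseteq> ?O" if "i < n" "D i \<inter> ?O \<noteq> {}" for i
    using connected_in_side[OF JC sp(1)[OF that(1)] DC[OF that(1)] sIO(2) that(2)] .
  have DnI: "\<not> D i \<subseteq> ?I" if "i < n" "D i \<inter> ?O \<noteq> {}" for i
    using that IO by blast
  obtain a b where ab: "e = {a, b}" using edge_pair[OF e] by blast
  have arc: "arc_set (path_image (\<gamma> e)) (pos a) (pos b)" using edge_arc e ab by simp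
  obtain z where z: "z \<in> path_image (\<gamma> e)" "z \<notin> pos ` e"
    using arc_set_interior(2)[OF arc] ab by auto
  have zE: "z \<notin> img (E - {e})"
  proof
    assume "z \<in> img (E - {e})"
    then obtain f where "f \<in> E" "f \<noteq> e" "z \<in> path_image (\<gamma> f)" by (auto simp: img_def)
    then show False using edge_inter[OF e, of f] z by blast
  qed
  have zinE: "z \<in> img E" using z e by (auto simp: img_def)
  define K where "K = {k. k < n \<and> e \<notin> bd k}"
  \<comment> \<open>An open neighbourhood of \<open>z\<close> that misses all other edges and the
    closures of all faces not bounded by \<open>e\<close>.\<close>
  define N where "N = - (img (E - {e}) \<union> (\<Union>k\<in>K. closure (D k)))"
  have "closed (img (E - {e}))"
  proof -
    have "closed (path_image (\<gamma> f))" if "f \<in> E" for f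
      using arc_set_interior(3)[OF edge_arc] edge_pair[OF that] that by metis
    then show ?thesis unfolding img_def using finE by (intro closed_UN) auto
  qed
  then have oN: "open N" unfolding N_def K_def
    by (intro open_Compl closed_Un closed_UN) auto
  have zN: "z \<in> N"
  proof -
    have "z \<notin> closure (D k)" if k: "k \<in> K" for k
    proof -
      have kn: "k < n" "bd k \<subseteq> E - {e}" using k Fi(2) by (auto simp: K_def)
      have "z \<notin> D k" using Fi(4)[OF kn(1)] zinE by auto
      moreover have "z \<notin> img (bd k)" using zE img_mono[OF kn(2)] by blast
      ultimately show ?thesis using sp(2)[OF kn(1)] by simp
    qed
    then show ?thesis using zE by (simp add: N_def)
  qed
  define S where "S = {i. i < n \<and> e \<in> bd i}"
  have cS: "card S = 2" using F e by (simp add: faces_of_def S_def)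
  have eqA: "{i \<in> ?A. e \<in> bd i} = {i \<in> S. D i \<subseteq> ?I}" by (auto simp: S_def)
  have near: "D k \<inter> X \<noteq> {}" if "k \<in> S" "open X" "z \<in> X" for k X
  proof -
    have k: "k < n" "e \<in> bd k" using that by (auto simp: S_def)
    have "z \<in> img (bd k)" using k z by (auto simp: img_def)
    then have "z \<in> closure (D k)" using sp(2)[OF k(1)] by simp
    then show ?thesis using that(2,3) open_Int_closure_eq_empty[of X "D k"] by blast
  qed
  show "e \<in> C \<longleftrightarrow> card {i \<in> ?A. e \<in> bd i} = 1"
  proof (cases "e \<in> C")
    case True
    have zC: "z \<in> img C" using True z by (auto simp: img_def)
    \<comment> \<open>Each side of \<open>C\<close> accumulates at \<open>z\<close>, so it enters
      \<open>N\<close>, where all faces are bounded by \<open>e\<close>. Hence the two faces at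
      \<open>e\<close> are on different sides.\<close>
    have meet: "\<exists>k\<in>S. D k \<inter> X \<noteq> {}" if X: "is_side X (img C)" for X
    proof -
      note sX = side_props[OF JC X]
      have "z \<in> closure X" using zC sX(6) by simp
      then have "N \<inter> X \<noteq> {}" using oN zN open_Int_closure_eq_empty[of N X] by blast
      then obtain y where y: "y \<in> N" "y \<in> X" by blast
      have "y \<notin> path_image (\<gamma> e)" using y(2) sX(5) True by (auto simp: img_def)
      then have "y \<notin> img E" using y(1) by (auto simp: N_def img_def)
      then obtain k where k: "k < n" "y \<in> D k" using F unfolding faces_of_def by blast
      have "k \<notin> K" using y(1) k closure_subset[of "D k"] unfolding N_def by blast
      then show ?thesis using k y by (auto simp: S_def K_def)
    qed
    obtain i where i: "i \<in> S" "D i \<inter> ?I \<noteq> {}" using meet[OF sIO(1)] by blast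
    obtain j where j: "j \<in> S" "D j \<inter> ?O \<noteq> {}" using meet[OF sIO(2)] by blast
    have ij: "i < n" "j < n" using i j by (auto simp: S_def)
    have Di: "D i \<subseteq> ?I" and Dj: "\<not> D j \<subseteq> ?I" using DI DnI i j ij by auto
    then have "i \<noteq> j" by auto
    have "S = {i, j}"
    proof -
      have "finite S" using cS card.infinite by fastforce
      moreover have "{i, j} \<subseteq> S" using i j by auto
      moreover have "card {i, j} = card S" using cS \<open>i \<noteq> j\<close> by simp
      ultimately show ?thesis by (metis card_subset_eq)
    qed
    then have "{k \<in> S. D k \<subseteq> ?I} = {i}" using Di Dj by auto
    then show ?thesis using True unfolding eqA by simp
  next
    case False
    have zC: "z \<notin> img C"
    proof -
      have "C \<subseteq> E - {e}" using False C by auto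
      then show ?thesis using zE img_mono by blast
    qed
    show ?thesis
    proof (cases "z \<in> ?I")
      case True
      have "D k \<subseteq> ?I" if "k \<in> S" for k
        using near[OF that sI(1) True] DI that by (simp add: S_def)
      then have "{k \<in> S. D k \<subseteq> ?I} = S" by auto
      then show ?thesis using False cS unfolding eqA by simp
    next
      case nI: False
      then have "z \<in> ?O" using zC by (simp add: outside_eq)
      have "\<not> D k \<subseteq> ?I" if "k \<in> S" for k
        using near[OF that sO(1) \<open>z \<in> ?O\<close>] DnI that by (simp add: S_def)
      then have "{k \<in> S. D k \<subseteq> ?I} = {}" by auto
      then have "card {k \<in> S. D k \<subseteq> ?I} = 0" by (simp only: card.empty)
      then show ?thesis using False unfolding eqA by simp
    qed
  qed
qed

end

section \<open>Cuts in face systems\<close>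

lemma has_model4I:
  assumes "conn E A" "conn E B" "conn E C" "conn E D" "A \<union> B \<union> C \<union> D \<subseteq> W"
    "A \<inter> B = {}" "A \<inter> C = {}" "A \<inter> D = {}" "B \<inter> C = {}" "B \<inter> D = {}" "C \<inter> D = {}"
    "\<exists>x\<in>A. \<exists>y\<in>B. {x, y} \<in> E" "\<exists>x\<in>A. \<exists>y\<in>C. {x, y} \<in> E" "\<exists>x\<in>A. \<exists>y\<in>D. {x, y} \<in> E"
    "\<exists>x\<in>B. \<exists>y\<in>C. {x, y} \<in> E" "\<exists>x\<in>B. \<exists>y\<in>D. {x, y} \<in> E" "\<exists>x\<in>C. \<exists>y\<in>D. {x, y} \<in> E"
  shows "has_model 4 E W"
proof -
  define S where "S = (!) [A, B, C, D]"
  have S: "S 0 = A" "S (Suc 0) = B" "S 2 = C" "S 3 = D"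
    by (simp_all add: S_def numeral_2_eq_2 numeral_3_eq_3)
  have four: "i < 4 \<longleftrightarrow> i = 0 \<or> i = Suc 0 \<or> i = 2 \<or> i = 3" for i :: nat by auto
  define R where "R X Y \<longleftrightarrow> X \<inter> Y = {} \<and> (\<exists>x\<in>X. \<exists>y\<in>Y. {x, y} \<in> E)" for X Y
  have sym: "R Y X" if "R X Y" for X Y
    using that unfolding R_def by (metis Int_commute insert_commute)
  have R: "R A B" "R A C" "R A D" "R B C" "R B D" "R C D"
    unfolding R_def using assms by simp_all
  have "R (S i) (S j)" if "i < 4" "j < 4" "i \<noteq> j" for i j
    using that R R[THEN sym] unfolding four by (elim disjE) (simp_all add: S)
  then have "S i \<inter> S j = {} \<and> (\<exists>x\<in>S i. \<exists>y\<in>S j. {x, y} \<in> E)" if "i < 4" "j < 4" "i \<noteq> j" for i j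
    using that unfolding R_def by blast
  moreover have "conn E (S i) \<and> S i \<subseteq> W" if "i < 4" for i
    using that assms(1-5) unfolding four by (elim disjE) (simp_all add: S)
  ultimately show ?thesis unfolding has_model_def by blast
qed

lemma even_card_iff: "card X \<le> 2 \<Longrightarrow> card X \<noteq> 1 \<Longrightarrow> even (card X)"
  by (cases "card X"; cases "card X - 1") auto

lemma rtrancl_along_path:
  assumes "path_edges q \<subseteq> E" "set q \<subseteq> S" "u \<in> set q" "w \<in> set q"
  shows "(u, w) \<in> (adj_in E S)\<^sup>*"
proof -
  have "conn E (set q)" using assms by (intro conn_path) auto
  then show ?thesis using assms rtrancl_mono[OF adj_in_mono[OF assms(2) order_refl]]
    unfolding conn_def by blast
qed

text \<open>This is all that remains of the topology. As \<open>two\<close> only allows the counts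
  0, 1 and 2, \<open>gen\<close> says that every cycle is a sum of face boundaries modulo 2. The
  assumptions \<open>con1\<close>, \<open>con2\<close> and \<open>deg3\<close> will come from the
  minimality of the dense set.\<close>

locale face_system =
  fixes V :: "'a set" and E :: "'a set set" and n :: nat and bd :: "nat \<Rightarrow> 'a set set"
  assumes finV: "finite V" and simp: "\<And>e. e \<in> E \<Longrightarrow> e \<subseteq> V \<and> card e = 2"
    and cycle: "\<And>i. i < n \<Longrightarrow> is_cycle (bd i)" and sub: "\<And>i. i < n \<Longrightarrow> bd i \<subseteq> E"
    and two: "\<And>e. e \<in> E \<Longrightarrow> card {i. i < n \<and> e \<in> bd i} = 2"
    and gen: "\<And>C. is_cycle C \<Longrightarrow> C \<subseteq> E \<Longrightarrow> \<exists>A\<subseteq>{..<n}. \<forall>e\<in>E. e \<in> C \<longleftrightarrow> card {i\<in>A. e \<in> bd i} = 1"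
    and euler: "n + card V = card E + 2"
    and con1: "\<And>v. v \<in> V \<Longrightarrow> conn E (V - {v})"
    and con2: "\<And>x y. {x, y} \<in> E \<Longrightarrow> conn E (V - {x, y})"
    and deg3: "\<And>v. v \<in> V \<Longrightarrow> card (nbrs E v) \<ge> 3"
begin

definition vs :: "nat \<Rightarrow> 'a set" where "vs i = \<Union>(bd i)"

definition faces_at :: "'a \<Rightarrow> nat set" where "faces_at v = {i. i < n \<and> v \<in> vs i}"

definition star :: "'a \<Rightarrow> 'a set" where "star v = (\<Union>i\<in>faces_at v. vs i)"

text \<open>Each face of length \<open>l\<close> divides \<open>l - 3\<close> equally among its
  vertices, so the total measures how far the graph is from a triangulation.\<close>

definition excess :: "'a \<Rightarrow> real" where
  "excess v = (\<Sum>i\<in>faces_at v. 1 - 3 / real (card (bd i)))"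

section \<open>The faces around a vertex\<close>

lemma finE: "finite E"
  using finV simp by (meson PowI finite_Pow_iff finite_subset subsetI)

lemma nbrs_V: "nbrs E v \<subseteq> V - {v}"
proof
  fix u assume "u \<in> nbrs E v"
  then have "{v, u} \<in> E" by (simp add: nbrs_def)
  then show "u \<in> V - {v}" using simp[of "{v, u}"] by (auto simp: card_2_iff doubleton_eq_iff)
qed

lemma finite_nbrs: "finite (nbrs E v)"
  using nbrs_V finV by (meson finite_Diff finite_subset)

lemma vs_V: "i < n \<Longrightarrow> vs i \<subseteq> V"
  using sub simp unfolding vs_def by blast

lemma finite_faces_at [simp]: "finite (faces_at v)"
  by (simp add: faces_at_def)

text \<open>Unrolls a face from \<open>v\<close>, starting along a chosen edge; if the cycle meets
  that edge last, it is reversed.\<close>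

lemma face_path:
  assumes "i < n" "{v, s} \<in> bd i"
  obtains p where "distinct (v # p)" "length p \<ge> 2" "bd i = cyc_edges (v # p)" "hd p = s"
    "vs i = insert v (set p)" "card (bd i) = Suc (length p)" "path_edges (v # p) \<subseteq> E"
    "{v, last p} \<in> bd i" "last p \<noteq> s"
    "\<And>t. {v, t} \<in> bd i \<longleftrightarrow> t = s \<or> t = last p"
proof -
  have "v \<in> \<Union>(bd i)" using assms by auto
  then obtain q where q: "distinct (v # q)" "length q \<ge> 2" "bd i = cyc_edges (v # q)"
    "\<Union>(bd i) = insert v (set q)" "card (bd i) = Suc (length q)"
    using is_cycle_at[OF cycle[OF assms(1)]] by metis
  have qn: "q \<noteq> []" using q by auto
  have "s = hd q \<or> s = last q" using cycle_nbrs(1)[OF q(1,2)] assms q(3) by simp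
  then obtain p where p: "distinct (v # p)" "length p \<ge> 2" "bd i = cyc_edges (v # p)" "hd p = s"
     "\<Union>(bd i) = insert v (set p)" "card (bd i) = Suc (length p)"
  proof
    assume "s = hd q"
    then show thesis using that[of q] q by auto
  next
    assume s: "s = last q"
    have "cyc_edges (v # rev q) = cyc_edges (v # q)"
      using cyc_edges_rotate[of "rev q" "[v]"] cyc_edges_rev[of "v # q"] by simp
    then show thesis using that[of "rev q"] q s qn by (auto simp: hd_rev)
  qed
  have "path_edges (v # p) \<subseteq> E" using sub[OF assms(1)] p(3) by (auto simp: cyc_edges_def)
  then show thesis
    using that[of p] p cycle_nbrs[OF p(1,2)] by (auto simp: vs_def)
qed

lemma face_at_nbr:
  assumes "i < n" "v \<in> vs i"
  obtains s where "{v, s} \<in> bd i"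
proof -
  obtain e where e: "e \<in> bd i" "v \<in> e" using assms by (auto simp: vs_def)
  then have "card e = 2" using sub simp assms by blast
  then obtain s where "e = {v, s}" using e(2) by (auto simp: card_2_iff)
  then show thesis using e that by auto
qed

lemma face_nbrs_card:
  assumes "i < n"
  shows "card {s. {v, s} \<in> bd i} = (if v \<in> vs i then 2 else 0)"
proof (cases "v \<in> vs i")
  case True
  then obtain s where "{v, s} \<in> bd i" using face_at_nbr assms by blast
  then obtain p where "last p \<noteq> s" "\<And>t. {v, t} \<in> bd i \<longleftrightarrow> t = s \<or> t = last p"
    using face_path assms by metis
  then have "{s. {v, s} \<in> bd i} = {s, last p}" "last p \<noteq> s" by auto
  then show ?thesis using True by simp
next
  case False
  then have "{s. {v, s} \<in> bd i} = {}" by (auto simp: vs_def)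
  then show ?thesis using False by simp
qed

lemma other_face:
  assumes "i < n" "e \<in> bd i"
  obtains j where "j < n" "j \<noteq> i" "e \<in> bd j" "{k. k < n \<and> e \<in> bd k} = {i, j}"
proof -
  have e: "e \<in> E" using assms sub by blast
  from two[OF e] obtain x y where xy: "{k. k < n \<and> e \<in> bd k} = {x, y}" "x \<noteq> y"
    by (auto simp: card_2_iff)
  have "i \<in> {x, y}" using assms xy by auto
  moreover have "x < n" "e \<in> bd x" "y < n" "e \<in> bd y" using xy by blast+
  ultimately show thesis
    using that[of x] that[of y] xy by (cases "i = x") (auto simp: insert_commute)
qed

lemma face_of_nbr: "s \<in> nbrs E v \<Longrightarrow> \<exists>i<n. {v, s} \<in> bd i"
proof -
  assume "s \<in> nbrs E v"
  then have "card {i. i < n \<and> {v, s} \<in> bd i} = 2" using two by (simp add: nbrs_def)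
  then have "{i. i < n \<and> {v, s} \<in> bd i} \<noteq> {}" by force
  then show ?thesis by auto
qed

lemma count_swap:
  assumes "finite A" "finite S"
  shows "(\<Sum>i\<in>A. card {s\<in>S. {v, s} \<in> bd i}) = (\<Sum>s\<in>S. card {i\<in>A. {v, s} \<in> bd i})"
  using sum_multicount_gen[of A S "\<lambda>i s. {v, s} \<in> bd i" "\<lambda>s. card {i\<in>A. {v, s} \<in> bd i}"] assms by auto

text \<open>
  Otherwise a cycle through \<open>v\<close> leaves through one edge to \<open>S\<close> and one edge to the other
  neighbours, but every sum of face boundaries has an even number of edges from \<open>v\<close> to \<open>S\<close>.
\<close>

lemma rotation_connected:
  assumes v: "v \<in> V" and S: "S \<subseteq> nbrs E v" "S \<noteq> {}"
    and closed: "\<And>i s t. i < n \<Longrightarrow> s \<in> S \<Longrightarrow> {v, s} \<in> bd i \<Longrightarrow> {v, t} \<in> bd i \<Longrightarrow> t \<in> S"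
  shows "S = nbrs E v"
proof (rule ccontr)
  assume "S \<noteq> nbrs E v"
  then obtain s t where st: "s \<in> S" "t \<in> nbrs E v" "t \<notin> S" using S by auto
  have finS: "finite S" using finite_nbrs S finite_subset by blast
  have stV: "s \<in> V - {v}" "t \<in> V - {v}" using nbrs_V st S by auto
  obtain p where p: "distinct p" "p \<noteq> []" "hd p = s" "last p = t" "set p \<subseteq> V - {v}" "path_edges p \<subseteq> E"
    using conn_obtain_path[OF con1[OF v] stV] by metis
  have "s \<noteq> t" using st by auto
  then have lp: "length p \<ge> 2" using p by (cases p) (auto simp: Suc_le_eq)
  have dp: "distinct (v # p)" using p by auto
  let ?C = "cyc_edges (v # p)"
  have "?C \<subseteq> E" using p st S by (auto simp: cyc_edges_Cons nbrs_def)
  then obtain A where A: "A \<subseteq> {..<n}" "\<forall>e\<in>E. e \<in> ?C \<longleftrightarrow> card {i\<in>A. e \<in> bd i} = 1"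
    using gen[OF is_cycleI[OF dp lp]] by metis
  have finA: "finite A" using A finite_subset by blast
  have "even (\<Sum>i\<in>A. card {s\<in>S. {v, s} \<in> bd i})"
  proof (rule dvd_sum)
    fix i assume "i \<in> A"
    then have i: "i < n" using A by auto
    show "even (card {s\<in>S. {v, s} \<in> bd i})"
    proof (cases "{s\<in>S. {v, s} \<in> bd i} = {}")
      case False
      then have "{s\<in>S. {v, s} \<in> bd i} = {s. {v, s} \<in> bd i}" using closed[OF i] by auto
      then show ?thesis using face_nbrs_card[OF i] by simp
    next
      case True
      then have "card {s\<in>S. {v, s} \<in> bd i} = 0" by (simp only: card.empty)
      then show ?thesis by simp
    qed
  qed
  then have ev: "even (\<Sum>u\<in>S. card {i\<in>A. {v, u} \<in> bd i})" using count_swap[OF finA finS] by simp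
  have uE: "{v, u} \<in> E" if "u \<in> S" for u using that S by (auto simp: nbrs_def)
  \<comment> \<open>Edges from \<open>v\<close> to the rest of \<open>S\<close> are not on the
    cycle, so none or two of the chosen faces contain them.\<close>
  have "even (\<Sum>u\<in>S - {s}. card {i\<in>A. {v, u} \<in> bd i})"
  proof (rule dvd_sum)
    fix u assume u: "u \<in> S - {s}"
    then have "u \<noteq> hd p" "u \<noteq> last p" using p st by auto
    then have "{v, u} \<notin> ?C" using cycle_nbrs(1)[OF dp lp] by simp
    then have "card {i\<in>A. {v, u} \<in> bd i} \<noteq> 1" using A uE u by auto
    moreover have "card {i\<in>A. {v, u} \<in> bd i} \<le> card {i. i < n \<and> {v, u} \<in> bd i}"
      using A by (intro card_mono) auto
    ultimately show "even (card {i\<in>A. {v, u} \<in> bd i})"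
      using two[OF uE] u by (intro even_card_iff) auto
  qed
  moreover have "{v, s} \<in> ?C" using cycle_nbrs(1)[OF dp lp] p by simp
  then have "card {i\<in>A. {v, s} \<in> bd i} = 1" using A uE st by auto
  ultimately have "odd (\<Sum>u\<in>S. card {i\<in>A. {v, u} \<in> bd i})"
    using finS st by (simp add: sum.remove[of S s])
  then show False using ev by simp
qed

text \<open>Two such faces would close up around \<open>b\<close>: no face leads from
  \<open>x\<close> or \<open>y\<close> to a further neighbour, so by
  \<open>rotation_connected\<close> the degree of \<open>b\<close> would be 2.\<close>

lemma faces_share_two_edges:
  assumes "b \<in> V" "i < n" "j < n" "i \<noteq> j" "x \<noteq> y"
    "{b, x} \<in> bd i" "{b, y} \<in> bd i" "{b, x} \<in> bd j" "{b, y} \<in> bd j"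
  shows False
proof -
  have two_only: "t = x \<or> t = y" if k: "k < n" "{b, s} \<in> bd k" "{b, t} \<in> bd k" "s = x \<or> s = y" for k s t
  proof -
    have "{k. k < n \<and> {b, s} \<in> bd k} = {i, j}"
    proof -
      have "{b, s} \<in> bd i" "{b, s} \<in> bd j" using k assms by auto
      then obtain l where "{k. k < n \<and> {b, s} \<in> bd k} = {i, l}"
        using other_face[OF assms(2)] by metis
      moreover have "j \<in> {k. k < n \<and> {b, s} \<in> bd k}" using \<open>{b, s} \<in> bd j\<close> assms by simp
      ultimately show ?thesis using assms(4) by auto
    qed
    then have "k = i \<or> k = j" using k by blast
    then have xy: "{b, x} \<in> bd k" "{b, y} \<in> bd k" using assms by auto
    obtain p where "\<And>t. {b, t} \<in> bd k \<longleftrightarrow> t = x \<or> t = last p"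
      using face_path[OF k(1) xy(1)] by metis
    then show ?thesis using xy(2) k(3) assms(5) by metis
  qed
  have "{x, y} = nbrs E b"
  proof (rule rotation_connected[OF assms(1)])
    show "{x, y} \<subseteq> nbrs E b" using sub[OF assms(2)] assms(6,7) by (auto simp: nbrs_def)
    show "t \<in> {x, y}" if k: "k < n" "s \<in> {x, y}" "{b, s} \<in> bd k" "{b, t} \<in> bd k" for k s t
      using two_only[OF k(1,3,4)] k(2) by simp
  qed simp
  moreover have "card {x, y} = 2" using assms(5) by simp
  ultimately show False using deg3[OF assms(1)] by simp
qed

text \<open>Every edge is on two faces, so a set of faces and its complement generate the same
  cycle, and the one without \<open>i\<close> can be chosen. The last two conclusions say that
  crossing an edge changes sides exactly if the edge is on \<open>C\<close>.\<close>

lemma gen_avoid: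
  assumes "is_cycle C" "C \<subseteq> E" "i < n"
  obtains A where "A \<subseteq> {..<n}" "i \<notin> A"
    "\<And>e k l. e \<in> E \<Longrightarrow> e \<notin> C \<Longrightarrow> k < n \<Longrightarrow> l < n \<Longrightarrow> e \<in> bd k \<Longrightarrow> e \<in> bd l \<Longrightarrow> k \<in> A \<longleftrightarrow> l \<in> A"
    "\<And>e k l. e \<in> E \<Longrightarrow> e \<in> C \<Longrightarrow> k < n \<Longrightarrow> l < n \<Longrightarrow> e \<in> bd k \<Longrightarrow> e \<in> bd l \<Longrightarrow> k \<noteq> l \<Longrightarrow> k \<in> A \<longleftrightarrow> l \<notin> A"
proof -
  obtain A where A: "A \<subseteq> {..<n}" "\<forall>e\<in>E. e \<in> C \<longleftrightarrow> card {i\<in>A. e \<in> bd i} = 1"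
    using gen[OF assms(1,2)] by metis
  have pair: "card {i\<in>A. e \<in> bd i} = (if k \<in> A then 1 else 0) + (if l \<in> A then 1 else 0)"
    if kl: "e \<in> E" "k < n" "l < n" "e \<in> bd k" "e \<in> bd l" "k \<noteq> l" for e k l
  proof -
    obtain j where "{m. m < n \<and> e \<in> bd m} = {k, j}" using other_face[OF kl(2,4)] by metis
    moreover have "l \<in> {m. m < n \<and> e \<in> bd m}" using kl by simp
    ultimately have kl2: "{m. m < n \<and> e \<in> bd m} = {k, l}" using kl(6) by auto
    have "{i\<in>A. e \<in> bd i} = {m. m < n \<and> e \<in> bd m} \<inter> A" using A(1) by auto
    also have "\<dots> = (if k \<in> A then {k} else {}) \<union> (if l \<in> A then {l} else {})"
      unfolding kl2 by auto
    finally show ?thesis using kl(6) by simp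
  qed
  have 1: "k \<in> A \<longleftrightarrow> l \<in> A" if "e \<in> E" "e \<notin> C" "k < n" "l < n" "e \<in> bd k" "e \<in> bd l" for e k l
  proof (cases "k = l")
    case False
    have "card {i\<in>A. e \<in> bd i} \<noteq> 1" using A(2)[rule_format, OF that(1)] that(2) by simp
    then show ?thesis using pair[OF that(1,3-6) False] by (cases "k \<in> A"; cases "l \<in> A"; simp)
  qed simp
  have 2: "k \<in> A \<longleftrightarrow> l \<notin> A" if "e \<in> E" "e \<in> C" "k < n" "l < n" "e \<in> bd k" "e \<in> bd l" "k \<noteq> l" for e k l
  proof -
    have "card {i\<in>A. e \<in> bd i} = 1" using A(2)[rule_format, OF that(1)] that(2) by simp
    then show ?thesis using pair[OF that(1,3-7)] by (cases "k \<in> A"; cases "l \<in> A"; simp)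
  qed
  show thesis
  proof (cases "i \<in> A")
    case False
    then show ?thesis using that[OF A(1)] 1 2 by blast
  next
    case True
    show ?thesis
    proof (rule that[of "{..<n} - A"])
      show "k \<in> {..<n} - A \<longleftrightarrow> l \<in> {..<n} - A"
        if "e \<in> E" "e \<notin> C" "k < n" "l < n" "e \<in> bd k" "e \<in> bd l" for e k l
        using 1[OF that] that by auto
      show "k \<in> {..<n} - A \<longleftrightarrow> l \<notin> {..<n} - A"
        if "e \<in> E" "e \<in> C" "k < n" "l < n" "e \<in> bd k" "e \<in> bd l" "k \<noteq> l" for e k l
        using 2[OF that] that by auto
    qed (use True in auto)
  qed
qed

text \<open>
  A chord \<open>xy\<close> of a face would make \<open>{x, y}\<close> a cut: the faces on one side of the cycle formed by
  \<open>xy\<close> and an arc of the face include all faces at the interior vertices of that arc except the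
  given face.
\<close>

lemma face_induced:
  assumes xyE: "{x, y} \<in> E" and i: "i < n" and xy: "x \<in> vs i" "y \<in> vs i"
  shows "{x, y} \<in> bd i"
proof (rule ccontr)
  assume nin: "{x, y} \<notin> bd i"
  have xyV: "x \<in> V" "y \<in> V" "x \<noteq> y" using simp[OF xyE] by (auto simp: card_2_iff)
  obtain p where p: "distinct (x # p)" "length p \<ge> 2" "bd i = cyc_edges (x # p)" "vs i = insert x (set p)"
    using is_cycle_at[OF cycle[OF i]] xy by (metis vs_def)
  have "y \<in> set p" using xy(2) xyV(3) unfolding p(4) by simp
  then obtain P Q where PQ: "p = P @ y # Q" by (meson split_list)
  let ?A1 = "path_edges (x # P @ [y])" and ?A2 = "path_edges (y # Q @ [x])"
  have bdi: "bd i = ?A1 \<union> ?A2" using p(3) unfolding PQ cyc_edges_split .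
  have Pn: "P \<noteq> []" using nin unfolding bdi by fastforce
  have Qn: "Q \<noteq> []" using nin unfolding bdi by (fastforce simp: insert_commute)
  let ?C = "cyc_edges (x # P @ [y])"
  have C: "?C = insert {x, y} ?A1" by (auto simp: cyc_edges_def insert_commute)
  have cyc: "is_cycle ?C" using p PQ Pn by (intro is_cycleI) (auto simp: Suc_le_eq)
  have CE: "?C \<subseteq> E" using C xyE bdi sub[OF i] by auto
  obtain A where A: "A \<subseteq> {..<n}" "i \<notin> A"
    and same: "\<And>e k l. e \<in> E \<Longrightarrow> e \<notin> ?C \<Longrightarrow> k < n \<Longrightarrow> l < n \<Longrightarrow> e \<in> bd k \<Longrightarrow> e \<in> bd l \<Longrightarrow> k \<in> A \<longleftrightarrow> l \<in> A"
    and differ: "\<And>e k l. e \<in> E \<Longrightarrow> e \<in> ?C \<Longrightarrow> k < n \<Longrightarrow> l < n \<Longrightarrow> e \<in> bd k \<Longrightarrow> e \<in> bd l \<Longrightarrow> k \<noteq> l \<Longrightarrow> k \<in> A \<longleftrightarrow> l \<notin> A"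
    by (rule gen_avoid[OF cyc CE i], rule that, assumption+)
  have UC: "\<Union>?C = set (x # P @ [y])" by (rule Union_cyc_edges) simp
  have at_P: "e \<in> ?A1" if "u \<in> set P" "u \<in> e" "e \<in> bd i" for e u
  proof (rule ccontr)
    assume "e \<notin> ?A1"
    then have "e \<subseteq> set (y # Q @ [x])" using that bdi path_edges_subset_set by blast
    then show False using that p PQ by auto
  qed
  \<comment> \<open>Going around \<open>u\<close> through faces outside \<open>A\<close>, one could
    stop only at an edge of the cycle. The face met there would have to be \<open>i\<close>, but
    both edges of \<open>i\<close> at \<open>u\<close> are on the cycle. So one would reach all
    neighbours by edges off the cycle, although some edge at \<open>u\<close> is on it.\<close>
  have from_P: "k \<in> A" if u: "u \<in> set P" "{u, w} \<in> E" "{u, w} \<notin> ?C" "k < n" "{u, w} \<in> bd k" for u w k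
  proof (rule ccontr)
    assume kA: "k \<notin> A"
    let ?S = "{s \<in> nbrs E u. {u, s} \<notin> ?C \<and> (\<exists>k<n. k \<notin> A \<and> {u, s} \<in> bd k)}"
    have uV: "u \<in> V" using simp[OF u(2)] by auto
    have "?S = nbrs E u"
    proof (rule rotation_connected[OF uV])
      have "w \<in> ?S" using u kA unfolding nbrs_def by blast
      then show "?S \<noteq> {}" by blast
      fix k' s t assume k': "k' < n" "s \<in> ?S" "{u, s} \<in> bd k'" "{u, t} \<in> bd k'"
      have tE: "{u, t} \<in> E" using sub[OF k'(1)] k'(4) by blast
      have sE: "{u, s} \<in> E" using sub[OF k'(1)] k'(3) by blast
      obtain l where l: "{u, s} \<notin> ?C" "l < n" "l \<notin> A" "{u, s} \<in> bd l" using k'(2) by blast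
      have k'A: "k' \<notin> A" using same[OF sE l(1) k'(1) l(2) k'(3) l(4)] l(3) by simp
      have "{u, t} \<notin> ?C"
      proof
        assume tC: "{u, t} \<in> ?C"
        have "u \<noteq> x" "u \<noteq> y" using u(1) p PQ by auto
        then have "{u, t} \<in> bd i" using tC C bdi by (auto simp: doubleton_eq_iff)
        then have "k' = i" using differ[OF tE tC k'(1) i k'(4)] k'A A(2) by auto
        then have "{u, s} \<in> ?A1" using at_P u(1) k'(3) by auto
        then show False using l(1) unfolding C by simp
      qed
      then show "t \<in> ?S" using k'(1,4) k'A tE unfolding nbrs_def by blast
    qed blast
    moreover obtain e where e: "e \<in> ?C" "u \<in> e" using UC u(1) by auto
    then have "card e = 2" using CE simp by blast
    then obtain s where s: "e = {u, s}" using e(2) by (auto simp: card_2_iff)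
    then have "s \<in> nbrs E u" using e CE by (auto simp: nbrs_def)
    ultimately show False using e s by auto
  qed
  \<comment> \<open>The vertices on the side \<open>A\<close>. No edge leaves this set except to
    \<open>x\<close> and \<open>y\<close>, so it contains all other vertices; but
    \<open>hd Q\<close> is on face \<open>i\<close>, which is not in \<open>A\<close>.\<close>
  let ?T = "set P \<union> {w \<in> V - {x, y}. w \<notin> set P \<and> (\<forall>k<n. w \<in> vs k \<longrightarrow> k \<in> A)}"
  have PV: "set P \<subseteq> V - {x, y}" using vs_V[OF i] p PQ by auto
  have "?T = V - {x, y}"
  proof (rule conn_closed[OF con2[OF xyE]])
    show "?T \<subseteq> V - {x, y}" using PV by auto
    show "?T \<noteq> {}" using Pn by auto
    fix u w assume u: "u \<in> ?T" and w: "w \<in> V - {x, y}" and uw: "{u, w} \<in> E"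
    show "w \<in> ?T"
    proof (cases "w \<in> set P")
      case False
      then have wC: "w \<notin> \<Union>?C" using w UC by auto
      then have notC: "{w, s} \<notin> ?C" for s by auto
      obtain k where k: "k < n" "{w, u} \<in> bd k" using face_of_nbr[of u w] uw
        by (auto simp: nbrs_def insert_commute)
      have kA: "k \<in> A"
      proof (cases "u \<in> set P")
        case True
        have "{u, w} = {w, u}" by blast
        then show ?thesis using from_P[OF True, of w k] uw notC[of u] k by metis
      next
        case False
        moreover have "u \<in> vs k" using k by (auto simp: vs_def)
        ultimately show ?thesis using u k by auto
      qed
      \<comment> \<open>No edge at \<open>w\<close> is on the cycle, so a single face in
        \<open>A\<close> brings all faces at \<open>w\<close> into \<open>A\<close>.\<close>
      let ?S = "{s \<in> nbrs E w. \<exists>k<n. k \<in> A \<and> {w, s} \<in> bd k}"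
      have S: "?S = nbrs E w"
      proof (rule rotation_connected)
        have "{w, u} \<in> E" using uw by (simp add: insert_commute)
        then have "u \<in> ?S" using k kA unfolding nbrs_def by blast
        then show "?S \<noteq> {}" by blast
        fix k' s t assume k': "k' < n" "s \<in> ?S" "{w, s} \<in> bd k'" "{w, t} \<in> bd k'"
        have tE: "{w, t} \<in> E" "{w, s} \<in> E" using sub[OF k'(1)] k'(3,4) by blast+
        obtain l where l: "l < n" "l \<in> A" "{w, s} \<in> bd l" using k'(2) by blast
        have "k' \<in> A" using same[OF tE(2) notC k'(1) l(1) k'(3) l(3)] l(2) by simp
        then show "t \<in> ?S" using k'(1,4) tE unfolding nbrs_def by blast
      qed (use w in blast)+
      have "k' \<in> A" if k': "k' < n" "w \<in> vs k'" for k'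
      proof -
        obtain s where s: "{w, s} \<in> bd k'" using face_at_nbr[OF k'] by blast
        then have sE: "{w, s} \<in> E" using sub[OF k'(1)] by blast
        then have "s \<in> ?S" using S unfolding nbrs_def by blast
        then obtain l where l: "l < n" "l \<in> A" "{w, s} \<in> bd l" by blast
        show ?thesis using same[OF sE notC k'(1) l(1) s l(3)] l(2) by simp
      qed
      then show ?thesis using w False by auto
    qed simp
  qed
  moreover have "hd Q \<in> V - {x, y}" "hd Q \<notin> set P" "hd Q \<in> vs i"
    using vs_V[OF i] p PQ Qn by (cases Q; auto)+
  ultimately show False using A i by blast
qed

end

section \<open>Models around a vertex\<close>

context face_system
begin

lemma vs_subset_star: "i < n \<Longrightarrow> v \<in> vs i \<Longrightarrow> vs i \<subseteq> star v"
  by (auto simp: star_def faces_at_def)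

lemma edge_faces: "i < n \<Longrightarrow> {v, s} \<in> bd i \<Longrightarrow> v \<in> vs i \<and> s \<in> vs i \<and> {v, s} \<in> E"
  using sub by (auto simp: vs_def)

text \<open>
  Given a triangular face \<open>vab\<close>, the branch sets are \<open>{v}\<close>, \<open>{a}\<close>, \<open>{b}\<close> and a component of the
  rest of the star. Going around \<open>v\<close> away from that face, a parity argument shows that the
  component next to \<open>b\<close> is also next to \<open>a\<close>.
\<close>

lemma model_at_triangle:
  assumes v: "v \<in> V" and T: "T < n" "v \<in> vs T" "card (bd T) = 3"
  shows "has_model 4 E (star v)"
proof -
  obtain a where a: "{v, a} \<in> bd T" using face_at_nbr[OF T(1,2)] by blast
  obtain p where p: "distinct (v # p)" "length p \<ge> 2"
    "bd T = cyc_edges (v # p)" "hd p = a" "vs T = insert v (set p)" "card (bd T) = Suc (length p)"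
    "path_edges (v # p) \<subseteq> E"
    "{v, last p} \<in> bd T" "last p \<noteq> a" "\<And>t. {v, t} \<in> bd T \<longleftrightarrow> t = a \<or> t = last p"
      by (rule face_path[OF T(1) a], rule that, assumption+)
  define b where "b = last p"
  have lp: "length p = 2" using p T by simp
  then have pab: "p = [a, b]" using p(4) b_def by (cases p rule: path_edges.cases) auto
  have ab: "a \<noteq> b" "v \<noteq> a" "v \<noteq> b" using p(1) pab by auto
  have abE: "{v, a} \<in> E" "{v, b} \<in> E" "{a, b} \<in> E"
    using sub[OF T(1)] p(3) pab by (auto simp: cyc_edges_def insert_commute)
  have vb: "{v, b} \<in> bd T" using p(8) b_def by simp
  have nT: "t = a \<or> t = b" if "{v, t} \<in> bd T" for t using that p(10) b_def by simp
  obtain F where F: "F < n" "F \<noteq> T" "{v, b} \<in> bd F" and Fb: "{k. k < n \<and> {v, b} \<in> bd k} = {T, F}"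
    by (rule other_face[OF T(1) vb], rule that, assumption+)
  obtain q where q: "distinct (v # q)" "length q \<ge> 2"
    "bd F = cyc_edges (v # q)" "hd q = b" "vs F = insert v (set q)"
    "card (bd F) = Suc (length q)" "path_edges (v # q) \<subseteq> E"
    "{v, last q} \<in> bd F" "last q \<noteq> b" "\<And>t. {v, t} \<in> bd F \<longleftrightarrow> t = b \<or> t = last q"
      by (rule face_path[OF F(1,3)], rule that, assumption+)
  define c where "c = last q"
  have qn: "q \<noteq> []" "tl q \<noteq> []" using q(2) by (cases q; auto)+
  have qb: "q = b # tl q" using q(4) qn by (cases q) auto
  have notF: "a \<notin> vs F"
  proof
    assume "a \<in> vs F"
    then have va: "{v, a} \<in> bd F" using face_induced[OF abE(1) F(1)] q(5) by auto
    show False using faces_share_two_edges[OF v T(1) F(1) _ ab(1) a vb va F(3)] F(2) by simp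
  qed
  have c: "c \<in> set (tl q)" using qn qb c_def by (metis last_in_set last_tl)
  define S0 where "S0 = star v - {v, a, b}"
  define K where "K = {w. (c, w) \<in> (adj_in E S0)\<^sup>*}"
  have sq: "set (tl q) \<subseteq> S0"
  proof -
    have "set q \<subseteq> star v" using vs_subset_star[OF F(1), of v] q(5) by auto
    moreover have "b \<notin> set (tl q)" "v \<notin> set (tl q)"
      using q(1) qb by (metis distinct.simps(2) list.set_intros(2))+
    moreover have "a \<notin> set q" using notF q(5) by auto
    moreover have "set (tl q) \<subseteq> set q" using qb by (metis set_subset_Cons)
    ultimately show ?thesis unfolding S0_def by blast
  qed
  have K: "conn E K" "K \<subseteq> S0"
  proof -
    have cS: "c \<in> S0" using c sq by (rule rev_subsetD)
    show "conn E K" unfolding K_def by (rule conn_component[OF cS])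
    show "K \<subseteq> S0"
    proof
      fix w assume "w \<in> K"
      then have "(c, w) \<in> (adj_in E S0)\<^sup>*" by (simp add: K_def)
      then show "w \<in> S0" using cS by (rule adj_in_rtrancl_in)
    qed
  qed
  have Kpath: "set r \<subseteq> K" if "path_edges r \<subseteq> E" "set r \<subseteq> S0" "u \<in> set r" "u \<in> K" for r u
  proof
    fix w assume "w \<in> set r"
    then have "(u, w) \<in> (adj_in E S0)\<^sup>*" by (rule rtrancl_along_path[OF that(1,2,3)])
    moreover have "(c, u) \<in> (adj_in E S0)\<^sup>*" using that(4) by (simp add: K_def)
    ultimately have "(c, w) \<in> (adj_in E S0)\<^sup>*" by (meson rtrancl_trans)
    then show "w \<in> K" unfolding K_def by (rule CollectI)
  qed
  have cK: "c \<in> K" by (simp add: K_def)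
  have tlE: "path_edges (tl q) \<subseteq> E"
  proof -
    have "path_edges (tl q) \<subseteq> path_edges (v # q)"
      by (metis drop_Suc drop_0 path_edges_drop list.sel(3) subset_trans)
    then show ?thesis using q(7) by auto
  qed
  have "set (tl q) \<subseteq> K" by (rule Kpath[OF tlE sq c cK])
  then have hK: "hd (tl q) \<in> K" using qn by auto
  have bh: "{b, hd (tl q)} \<in> E"
  proof -
    have "{b, hd (tl q)} \<in> path_edges (v # b # tl q)" using qn(2) by (simp add: path_edges_Cons)
    then show ?thesis using q(7) qb by (metis subsetD)
  qed
  have vc: "{v, c} \<in> E" using q(8) sub[OF F(1)] c_def by auto
  have aK: "\<exists>x\<in>K. {a, x} \<in> E"
  proof (rule ccontr)
    assume n: "\<not> ?thesis"
    define S where "S = {s \<in> nbrs E v. s \<in> K}"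
    have S0: "a \<notin> S" "b \<notin> S" using K by (auto simp: S_def S0_def)
    have finS: "finite S" using finite_nbrs by (simp add: S_def)
    have cS: "c \<in> S" using vc cK by (simp add: S_def nbrs_def)
    have notb: "b \<notin> vs k" if k: "k < n" "v \<in> vs k" "{v, b} \<notin> bd k" for k
      using face_induced[OF abE(2) k(1,2)] k(3) by auto
    have nota: "a \<notin> vs k" if k: "k < n" "v \<in> vs k" "{v, a} \<notin> bd k" for k
      using face_induced[OF abE(1) k(1,2)] k(3) by auto
    \<comment> \<open>Such a face avoids \<open>b\<close>, since \<open>T\<close> and
      \<open>F\<close> are the only faces that contain both \<open>v\<close> and \<open>b\<close>.
      It does not end in \<open>a\<close> either: the vertex before \<open>a\<close> would be in
      \<open>K\<close> and adjacent to \<open>a\<close>. So all its vertices other than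
      \<open>v\<close> are in \<open>K\<close>.\<close>
    have step: "t \<in> S" if k: "k < n" "k \<noteq> F" "s \<in> S" "{v, s} \<in> bd k" "{v, t} \<in> bd k" for k s t
    proof -
      have vk: "v \<in> vs k" using k edge_faces by blast
      obtain r where r0: "distinct (v # r)" "length r \<ge> 2"
        "bd k = cyc_edges (v # r)" "hd r = s" "vs k = insert v (set r)"
        "card (bd k) = Suc (length r)" "path_edges (v # r) \<subseteq> E" "{v, last r} \<in> bd k"
        "last r \<noteq> s" "\<And>t. {v, t} \<in> bd k \<longleftrightarrow> t = s \<or> t = last r"
      by (rule face_path[OF k(1,4)], rule that, assumption+)
      note r = r0(1,2,4,5,7,9,10)
      have rn: "r \<noteq> []" "butlast r \<noteq> []" using r(2) by (cases r; auto)+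
      have rE: "path_edges r \<subseteq> E" using r(5) rn by (auto simp: path_edges_Cons)
      have sK: "s \<in> K" "s \<noteq> a" "s \<noteq> b" using k(3) S0 by (auto simp: S_def)
      have kT: "k \<noteq> T" using nT k(4) sK by auto
      have vbk: "{v, b} \<notin> bd k" using Fb kT k(1,2) by blast
      have bk: "b \<notin> vs k" using notb[OF k(1) vk vbk] .
      have rst: "set r \<subseteq> star v - {v, b}"
        using vs_subset_star[OF k(1) vk] r(1,4) bk by auto
      have "last r \<noteq> a"
      proof
        assume la: "last r = a"
        have rs: "r = butlast r @ [a]" using rn(1) la by (metis append_butlast_last_id)
        then have "a \<notin> set (butlast r)" using r(1)
          by (metis distinct.simps(2) distinct_append list.set_intros(1) disjoint_iff)
        then have "set (butlast r) \<subseteq> S0" using rst unfolding S0_def by (auto dest: in_set_butlastD)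
        moreover have "path_edges (butlast r) \<subseteq> E"
          using rE path_edges_take[of "length r - 1" r] by (simp add: butlast_conv_take)
        moreover have "s \<in> set (butlast r)"
          using r(3) rn by (metis hd_append2 hd_in_set rs)
        ultimately have "set (butlast r) \<subseteq> K" using Kpath sK by blast
        then have "last (butlast r) \<in> K" using rn(2) by auto
        moreover have "{last (butlast r), a} \<in> path_edges r"
        proof -
          have "{last (butlast r), a} \<in> path_edges (butlast r @ [a])"
            using rn(2) by (simp add: path_edges_append)
          then show ?thesis using rs by metis
        qed
        ultimately show False using n rE by (metis insert_commute subsetD)
      qed
      then have "{v, a} \<notin> bd k" using r(7) sK by auto
      then have "a \<notin> vs k" using nota[OF k(1) vk] by simp
      then have "set r \<subseteq> S0" using rst r(4) unfolding S0_def by auto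
      moreover have "s \<in> set r" using r(3) rn by auto
      ultimately have "set r \<subseteq> K" using Kpath rE sK by blast
      then have "last r \<in> K" using rn by auto
      moreover have "{v, last r} \<in> E" using r(7) sub[OF k(1)] by blast
      ultimately have "last r \<in> S" by (simp add: S_def nbrs_def)
      then show "t \<in> S" using r(7) k(3,5) by metis
    qed
    have "even (\<Sum>k\<in>{..<n} - {F}. card {s\<in>S. {v, s} \<in> bd k})"
    proof (rule dvd_sum)
      fix k assume "k \<in> {..<n} - {F}"
      then have k: "k < n" "k \<noteq> F" by auto
      show "even (card {s\<in>S. {v, s} \<in> bd k})"
      proof (cases "{s\<in>S. {v, s} \<in> bd k} = {}")
        case False
        then have "{s\<in>S. {v, s} \<in> bd k} = {s. {v, s} \<in> bd k}" using step[OF k] by blast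
        then show ?thesis using face_nbrs_card[OF k(1)] by simp
      next
        case True
        then have "card {s\<in>S. {v, s} \<in> bd k} = 0" by (simp only: card.empty)
        then show ?thesis by simp
      qed
    qed
    \<comment> \<open>The other edge of \<open>F\<close> at \<open>v\<close> leads to
      \<open>b\<close>, so \<open>F\<close> has a single edge to \<open>S\<close> and the total is
      odd. Counting by edges instead gives \<open>2 * card S\<close>.\<close>
    moreover have "{s\<in>S. {v, s} \<in> bd F} = {c}" using q(10) S0 cS c_def by auto
    ultimately have "odd (\<Sum>k<n. card {s\<in>S. {v, s} \<in> bd k})"
      using F(1) by (simp add: sum.remove[of "{..<n}" F])
    moreover have "(\<Sum>k<n. card {s\<in>S. {v, s} \<in> bd k}) = (\<Sum>s\<in>S. card {k\<in>{..<n}. {v, s} \<in> bd k})"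
      using count_swap finS by blast
    moreover have "(\<Sum>s\<in>S. card {k\<in>{..<n}. {v, s} \<in> bd k}) = (\<Sum>s\<in>S. 2)"
    proof (rule sum.cong)
      fix s assume "s \<in> S"
      then have "{v, s} \<in> E" by (simp add: S_def nbrs_def)
      then show "card {k\<in>{..<n}. {v, s} \<in> bd k} = 2" using two by simp
    qed simp
    ultimately show False by simp
  qed
  have vsT: "{v, a, b} \<subseteq> star v" using vs_subset_star[OF T(1,2)] p(5) pab by auto
  show ?thesis
  proof (rule has_model4I[of E "{v}" "{a}" "{b}" K])
    show "{v} \<union> {a} \<union> {b} \<union> K \<subseteq> star v" using vsT K(2) S0_def by auto
    show "{v} \<inter> K = {}" "{a} \<inter> K = {}" "{b} \<inter> K = {}" using K(2) S0_def by auto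
    show "\<exists>x\<in>{v}. \<exists>y\<in>K. {x, y} \<in> E" using vc cK by auto
    show "\<exists>x\<in>{a}. \<exists>y\<in>K. {x, y} \<in> E" using aK by auto
    show "\<exists>x\<in>{b}. \<exists>y\<in>K. {x, y} \<in> E" using bh hK by auto
  qed (use K ab abE in auto)
qed

section \<open>The number of vertices around a vertex\<close>

lemma card_faces_at: "v \<in> V \<Longrightarrow> card (faces_at v) = card (nbrs E v)"
proof -
  assume v: "v \<in> V"
  have "(\<Sum>i\<in>faces_at v. card {s\<in>nbrs E v. {v, s} \<in> bd i}) =
     (\<Sum>s\<in>nbrs E v. card {i\<in>faces_at v. {v, s} \<in> bd i})"
    by (rule count_swap) (simp_all add: finite_nbrs)
  moreover have "card {s\<in>nbrs E v. {v, s} \<in> bd i} = 2" if "i \<in> faces_at v" for i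
  proof -
    have i: "i < n" "v \<in> vs i" using that by (auto simp: faces_at_def)
    have "{s\<in>nbrs E v. {v, s} \<in> bd i} = {s. {v, s} \<in> bd i}"
      using sub[OF i(1)] by (auto simp: nbrs_def)
    then show ?thesis using face_nbrs_card[OF i(1), of v] i(2) by simp
  qed
  moreover have "card {i\<in>faces_at v. {v, s} \<in> bd i} = 2" if "s \<in> nbrs E v" for s
  proof -
    have "{i\<in>faces_at v. {v, s} \<in> bd i} = {i. i < n \<and> {v, s} \<in> bd i}"
      by (auto simp: faces_at_def vs_def)
    then show ?thesis using two that by (simp add: nbrs_def)
  qed
  ultimately show ?thesis by simp
qed

lemma card_vs: "i < n \<Longrightarrow> card (vs i) = card (bd i)"
proof -
  assume "i < n"
  then obtain xs where "distinct xs" "length xs \<ge> 3" "bd i = cyc_edges xs"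
    using cycle by (auto simp: is_cycle_def)
  then show ?thesis using card_cyc_edges[of xs] Union_cyc_edges[of xs]
    by (simp add: vs_def distinct_card)
qed

lemma card_bd: "i < n \<Longrightarrow> card (bd i) \<ge> 3"
  using cycle card_cyc_edges by (metis is_cycle_def)

text \<open>There are as many neighbours of \<open>v\<close> as faces at \<open>v\<close>, and each
  face of length \<open>l\<close> has \<open>l - 3\<close> vertices besides \<open>v\<close> and its
  two neighbours there. Vertices shared by several faces only help.\<close>

lemma card_star:
  assumes "v \<in> V"
  shows "card (star v) \<le> 1 + card (faces_at v) + (\<Sum>i\<in>faces_at v. card (bd i) - 3)"
proof -
  have "star v \<subseteq> insert v (nbrs E v) \<union> (\<Union>i\<in>faces_at v. vs i - insert v {s. {v, s} \<in> bd i})"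
    using sub by (auto simp: star_def nbrs_def faces_at_def)
  moreover have fin: "finite (insert v (nbrs E v) \<union> (\<Union>i\<in>faces_at v. vs i - insert v {s. {v, s} \<in> bd i}))"
    using finite_nbrs finV vs_V by (auto simp: faces_at_def intro: finite_subset)
  ultimately have "card (star v) \<le>
     card (insert v (nbrs E v) \<union> (\<Union>i\<in>faces_at v. vs i - insert v {s. {v, s} \<in> bd i}))"
    by (rule card_mono[rotated])
  also have "\<dots> \<le> card (insert v (nbrs E v)) + card (\<Union>i\<in>faces_at v. vs i - insert v {s. {v, s} \<in> bd i})"
    by (rule card_Un_le)
  also have "card (insert v (nbrs E v)) \<le> 1 + card (faces_at v)"
    using card_faces_at[OF assms] card_insert_le_m1 by (simp add: card_insert_if finite_nbrs)
  also have "card (\<Union>i\<in>faces_at v. vs i - insert v {s. {v, s} \<in> bd i}) \<le>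
     (\<Sum>i\<in>faces_at v. card (vs i - insert v {s. {v, s} \<in> bd i}))"
    by (rule card_UN_le) simp
  also have "\<dots> = (\<Sum>i\<in>faces_at v. card (bd i) - 3)"
  proof (rule sum.cong)
    fix i assume "i \<in> faces_at v"
    then have i: "i < n" "v \<in> vs i" by (auto simp: faces_at_def)
    have 2: "card {s. {v, s} \<in> bd i} = 2" using face_nbrs_card[OF i(1)] i(2) by simp
    have "{v, v} \<notin> E" using simp[of "{v, v}"] by auto
    then have "v \<notin> {s. {v, s} \<in> bd i}" using sub[OF i(1)] by blast
    then have 3: "card (insert v {s. {v, s} \<in> bd i}) = 3"
      using 2 by (metis card_insert_disjoint card.infinite eval_nat_numeral(3) zero_neq_numeral)
    have "insert v {s. {v, s} \<in> bd i} \<subseteq> vs i" using i by (auto simp: vs_def)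
    then show "card (vs i - insert v {s. {v, s} \<in> bd i}) = card (bd i) - 3"
      using 3 card_vs[OF i(1)] by (metis card_Diff_subset card.infinite zero_neq_numeral)
  qed simp
  finally show ?thesis by simp
qed

text \<open>The three faces surround \<open>v\<close> by a closed walk through \<open>a\<close>,
  \<open>y\<close>, \<open>b\<close>, \<open>z\<close>, \<open>c\<close>. Unless this walk meets
  itself, \<open>{v}\<close> and three consecutive pieces of it are the branch sets. Most
  coincidences are excluded by \<open>faces_share_two_edges\<close>.\<close>

lemma model_at_quadrangles_aux:
  assumes v: "v \<in> V" and ijk: "i < n" "j < n" "k < n" "i \<noteq> j" "j \<noteq> k" "i \<noteq> k"
    and abc: "a \<noteq> b" "b \<noteq> c" "a \<noteq> c"
    and ed: "{v, a} \<in> bd i" "{v, b} \<in> bd i" "{v, b} \<in> bd j" "{v, c} \<in> bd j" "{v, c} \<in> bd k" "{v, a} \<in> bd k"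
    and cards: "card (bd i) = 4" "card (bd j) = 4" "4 \<le> card (bd k)" "card (bd k) \<le> 5"
  shows "has_model 4 E (star v)"
proof -
  note E = edge_faces[OF ijk(1) ed(1)] edge_faces[OF ijk(1) ed(2)] edge_faces[OF ijk(2) ed(4)]
  have vE: "{v, a} \<in> E" "{v, b} \<in> E" "{v, c} \<in> E" using E by auto
  have iV: "v \<in> vs i" "v \<in> vs j" "v \<in> vs k" using E edge_faces[OF ijk(3) ed(5)] by auto
  obtain p where p: "distinct (v # p)" "length p \<ge> 2"
    "bd i = cyc_edges (v # p)" "hd p = a" "vs i = insert v (set p)" "card (bd i) = Suc (length p)"
    "path_edges (v # p) \<subseteq> E" "{v, last p} \<in> bd i" "last p \<noteq> a"
    "\<And>t. {v, t} \<in> bd i \<longleftrightarrow> t = a \<or> t = last p"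
      by (rule face_path[OF ijk(1) ed(1)], rule that, assumption+)
  obtain q where q: "distinct (v # q)" "length q \<ge> 2"
    "bd j = cyc_edges (v # q)" "hd q = b" "vs j = insert v (set q)" "card (bd j) = Suc (length q)"
    "path_edges (v # q) \<subseteq> E" "{v, last q} \<in> bd j" "last q \<noteq> b"
    "\<And>t. {v, t} \<in> bd j \<longleftrightarrow> t = b \<or> t = last q"
      by (rule face_path[OF ijk(2) ed(3)], rule that, assumption+)
  obtain r where r: "distinct (v # r)" "length r \<ge> 2"
    "bd k = cyc_edges (v # r)" "hd r = c" "vs k = insert v (set r)" "card (bd k) = Suc (length r)"
    "path_edges (v # r) \<subseteq> E" "{v, last r} \<in> bd k" "last r \<noteq> c"
    "\<And>t. {v, t} \<in> bd k \<longleftrightarrow> t = c \<or> t = last r"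
      by (rule face_path[OF ijk(3) ed(5)], rule that, assumption+)
  have lasts: "last p = b" "last q = c" "last r = a"
    using p(10) q(10) r(10) ed abc by metis+
  have len: "length p = 3" "length q = 3" "length r = 3 \<or> length r = 4"
    using cards p(6) q(6) r(6) by auto
  obtain y where py: "p = [a, y, b]"
    using len(1) p(4) lasts(1) by (auto simp: length_Suc_conv eval_nat_numeral)
  obtain z where qz: "q = [b, z, c]"
    using len(2) q(4) lasts(2) by (auto simp: length_Suc_conv eval_nat_numeral)
  have vne: "v \<noteq> a" "v \<noteq> b" "v \<noteq> c" using p(1) q(1) py qz by auto
  have bdi: "bd i = {{v, a}, {v, b}, {a, y}, {y, b}}"
    unfolding p(3) py by (auto simp: cyc_edges_Cons)
  have bdj: "bd j = {{v, b}, {v, c}, {b, z}, {z, c}}"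
    unfolding q(3) qz by (auto simp: cyc_edges_Cons)
  have yE: "{a, y} \<in> E" "{y, b} \<in> E" "{b, z} \<in> E" "{z, c} \<in> E"
    using sub[OF ijk(1)] sub[OF ijk(2)] bdi bdj by auto
  have y: "y \<noteq> v" "y \<noteq> a" "y \<noteq> b" "y \<noteq> c"
    using p(1) py face_induced[OF vE(3) ijk(1) iV(1)] p(5) p(10)[of c] lasts abc by auto
  have z: "z \<noteq> v" "z \<noteq> b" "z \<noteq> c" "z \<noteq> a"
    using q(1) qz face_induced[OF vE(1) ijk(2) iV(2)] q(5) q(10)[of a] lasts abc by auto
  have sym: "{x, w} \<in> X \<Longrightarrow> {w, x} \<in> X" for x w :: 'a and X by (simp add: insert_commute)
  have abcV: "a \<in> V" "b \<in> V" "c \<in> V" using simp[OF vE(1)] simp[OF vE(2)] simp[OF vE(3)] by auto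
  have yz: "y \<noteq> z"
    using faces_share_two_edges[OF abcV(2) ijk(1,2,4) y(1)[symmetric]] bdi bdj by (auto simp: insert_commute)
  have W: "{v, a, b, c, y, z} \<union> set r \<subseteq> star v"
    using vs_subset_star[OF ijk(1) iV(1)] vs_subset_star[OF ijk(2) iV(2)] vs_subset_star[OF ijk(3) iV(3)]
      p(5) q(5) r(5) py qz by auto
  have nb: "b \<notin> set r" using face_induced[OF vE(2) ijk(3) iV(3)] r(5) r(10)[of b] lasts abc by auto
  note ee = vE yE vE[THEN sym] yE[THEN sym]
  show ?thesis
  proof (cases "length r = 3")
    case True
    then obtain g where rg: "r = [c, g, a]"
      using r(4) lasts(3) by (auto simp: length_Suc_conv eval_nat_numeral)
    have bdk: "bd k = {{v, c}, {v, a}, {c, g}, {g, a}}"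
      unfolding r(3) rg by (auto simp: cyc_edges_Cons)
    have gE: "{c, g} \<in> E" "{g, a} \<in> E" using sub[OF ijk(3)] bdk by auto
    have g: "g \<noteq> v" "g \<noteq> c" "g \<noteq> a" "g \<noteq> b" using r(1) rg nb by auto
    have gy: "g \<noteq> y"
      using faces_share_two_edges[OF abcV(1) ijk(1,3,6) y(1)[symmetric]] bdi bdk by (auto simp: insert_commute)
    have gz: "g \<noteq> z"
      using faces_share_two_edges[OF abcV(3) ijk(2,3,5) z(1)[symmetric]] bdj bdk by (auto simp: insert_commute)
    show ?thesis
    proof (rule has_model4I[of E "{v}" "{a, y}" "{b, z}" "{c, g}"])
      show "{v} \<union> {a, y} \<union> {b, z} \<union> {c, g} \<subseteq> star v" using W rg by auto
      show "conn E {a, y}" "conn E {b, z}" "conn E {c, g}" using yE gE by (auto intro: conn_two)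
    qed (use vne y z g gy gz yz abc ee gE gE[THEN sym] in auto)
  next
    case False
    then have "length r = 4" using len by simp
    then obtain g h where rg: "r = [c, g, h, a]"
      using r(4) lasts(3) by (auto simp: length_Suc_conv eval_nat_numeral)
    have bdk: "bd k = {{v, c}, {v, a}, {c, g}, {g, h}, {h, a}}"
      unfolding r(3) rg by (auto simp: cyc_edges_Cons)
    have gE: "{c, g} \<in> E" "{g, h} \<in> E" "{h, a} \<in> E" using sub[OF ijk(3)] bdk by auto
    have g: "g \<noteq> v" "g \<noteq> c" "g \<noteq> a" "g \<noteq> b" "h \<noteq> v" "h \<noteq> c" "h \<noteq> a" "h \<noteq> b" "g \<noteq> h"
      using r(1) rg nb by auto
    have hy: "h \<noteq> y"
      using faces_share_two_edges[OF abcV(1) ijk(1,3,6) y(1)[symmetric]] bdi bdk by (auto simp: insert_commute)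
    have gz: "g \<noteq> z"
      using faces_share_two_edges[OF abcV(3) ijk(2,3,5) z(1)[symmetric]] bdj bdk by (auto simp: insert_commute)
    note ee = ee gE gE[THEN sym]
    \<comment> \<open>The two coincidences that remain possible. In each of them the common vertex
      is adjacent to all of \<open>a\<close>, \<open>b\<close> and \<open>c\<close>.\<close>
    consider "g = y" | "h = z" | "g \<noteq> y" "h \<noteq> z" by blast
    then show ?thesis
    proof cases
      case 1
      show ?thesis
      proof (rule has_model4I[of E "{v, a}" "{b}" "{c, z}" "{y}"])
        show "{v, a} \<union> {b} \<union> {c, z} \<union> {y} \<subseteq> star v" using W by auto
        show "conn E {v, a}" "conn E {c, z}" using ee by (auto intro: conn_two)
      qed (use vne y z g hy gz yz abc ee 1 E ed in auto)
    next
      case 2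
      show ?thesis
      proof (rule has_model4I[of E "{v, c}" "{a}" "{b, y}" "{z}"])
        show "{v, c} \<union> {a} \<union> {b, y} \<union> {z} \<subseteq> star v" using W by auto
        show "conn E {v, c}" "conn E {b, y}" using ee by (auto intro: conn_two)
      qed (use vne y z g hy gz yz abc ee 2 in auto)
    next
      case 3
      show ?thesis
      proof (rule has_model4I[of E "{v}" "{a, y}" "{b, z}" "{c, g, h}"])
        show "{v} \<union> {a, y} \<union> {b, z} \<union> {c, g, h} \<subseteq> star v" using W rg by auto
        show "conn E {a, y}" "conn E {b, z}" using ee by (auto intro: conn_two)
        show "conn E {c, g, h}" using conn_path[of "[c, g, h]" E] gE by simp
      qed (use vne y z g hy gz yz abc ee 3 in auto)
    qed
  qed
qed

lemma card_2_elem: "card X = 2 \<Longrightarrow> b \<in> X \<Longrightarrow> \<exists>a. X = {a, b} \<and> a \<noteq> b"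
  by (auto simp: card_2_iff)

text \<open>The faces use three different pairs from the three neighbours of \<open>v\<close>, hence
  all the pairs, and this determines how the faces are arranged.\<close>

lemma model_at_quadrangles:
  assumes v: "v \<in> V" and F: "faces_at v = {i, j, k}" "card (faces_at v) = 3"
    and cards: "card (bd i) = 4" "card (bd j) = 4" "4 \<le> card (bd k)" "card (bd k) \<le> 5"
  shows "has_model 4 E (star v)"
proof -
  have ne: "i \<noteq> j" "j \<noteq> k" "i \<noteq> k" using F by (auto simp: card_insert_if split: if_splits)
  have ijk: "i < n" "j < n" "k < n" "v \<in> vs i" "v \<in> vs j" "v \<in> vs k"
    using F(1) by (auto simp: faces_at_def)
  define N where "N l = {s. {v, s} \<in> bd l}" for l
  have N2: "card (N l) = 2" if "l \<in> {i, j, k}" for l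
    using that face_nbrs_card ijk unfolding N_def by auto
  have Nsub: "N l \<subseteq> nbrs E v" if "l \<in> {i, j, k}" for l
    using that sub ijk unfolding N_def nbrs_def by blast
  have n3: "card (nbrs E v) = 3" using card_faces_at[OF v] F(2) by simp
  have Nne: "N l \<noteq> N m" if lm: "l \<in> {i, j, k}" "m \<in> {i, j, k}" "l \<noteq> m" for l m
  proof
    assume eq: "N l = N m"
    obtain x w where xw: "N l = {x, w}" "x \<noteq> w" using N2[OF lm(1)] by (auto simp: card_2_iff)
    then have "x \<in> N l" "w \<in> N l" "x \<in> N m" "w \<in> N m" using eq by auto
    moreover have "l < n" "m < n" using lm ijk by auto
    ultimately show False
      using faces_share_two_edges[OF v _ _ lm(3) xw(2)] unfolding N_def by blast
  qed
  have fin: "finite (nbrs E v)" using n3 card.infinite by force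
  have inter: "card (N i \<inter> N j) = 1"
  proof -
    have "card (N i \<union> N j) \<le> 3" using card_mono[OF fin, of "N i \<union> N j"] Nsub n3 by simp
    moreover have "finite (N i)" "finite (N j)" using Nsub fin finite_subset by blast+
    ultimately have "card (N i \<inter> N j) \<ge> 1" using card_Un_Int[of "N i" "N j"] N2 by simp
    moreover have "card (N i \<inter> N j) \<noteq> 2"
    proof
      assume 2: "card (N i \<inter> N j) = 2"
      have "N i \<inter> N j = N i" "N i \<inter> N j = N j"
        using card_subset_eq[of "N i" "N i \<inter> N j"] card_subset_eq[of "N j" "N i \<inter> N j"] 2 N2
          \<open>finite (N i)\<close> \<open>finite (N j)\<close> by auto
      then show False using Nne[of i j] ne by auto
    qed
    moreover have "card (N i \<inter> N j) \<le> 2" using card_mono[of "N i" "N i \<inter> N j"] N2[of i] \<open>finite (N i)\<close> by simp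
    ultimately show ?thesis by linarith
  qed
  then obtain b where b: "N i \<inter> N j = {b}" by (auto simp: card_1_singleton_iff)
  have "b \<in> N i" "b \<in> N j" using b by auto
  then obtain a c where ac: "N i = {a, b}" "a \<noteq> b" "N j = {b, c}" "c \<noteq> b"
    using card_2_elem[OF N2[of i]] card_2_elem[OF N2[of j]] by (metis insert_commute insertI1 insertI2)
  have "a \<noteq> c" using b ac by auto
  have "card {a, b, c} = 3" using ac \<open>a \<noteq> c\<close> by simp
  moreover have "{a, b, c} \<subseteq> nbrs E v" using Nsub[of i] Nsub[of j] ac by auto
  ultimately have abc: "nbrs E v = {a, b, c}" using n3 fin by (metis card_subset_eq)
  have "N k = {a, c}"
  proof -
    obtain x w where xw: "N k = {x, w}" "x \<noteq> w" using N2[of k] by (auto simp: card_2_iff)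
    moreover have "{x, w} \<subseteq> {a, b, c}" using Nsub[of k] abc xw by auto
    moreover have "N k \<noteq> {a, b}" "N k \<noteq> {b, c}" using Nne[of i k] Nne[of j k] ne ac by auto
    ultimately show ?thesis by auto
  qed
  then have "{v, a} \<in> bd i" "{v, b} \<in> bd i" "{v, b} \<in> bd j" "{v, c} \<in> bd j" "{v, c} \<in> bd k" "{v, a} \<in> bd k"
    using ac unfolding N_def by blast+
  then show ?thesis
    using model_at_quadrangles_aux[OF v ijk(1,2,3) ne(1,2,3) ac(2) ac(4)[symmetric] \<open>a \<noteq> c\<close>] cards by blast
qed

text \<open>Without a triangle each face contributes at least \<open>1 / 4\<close>, so there are
  just three faces, and their reciprocal lengths add up to more than \<open>2 / 3\<close>. This
  leaves the lengths 4, 4, 4 and 4, 4, 5.\<close>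

lemma model_at:
  assumes v: "v \<in> V" and ex: "excess v < 1"
  shows "has_model 4 E (star v)"
proof (cases "\<exists>T\<in>faces_at v. card (bd T) = 3")
  case True
  then show ?thesis using model_at_triangle[OF v] by (auto simp: faces_at_def)
next
  case False
  have ge4: "card (bd i) \<ge> 4" if "i \<in> faces_at v" for i
  proof -
    have "i < n" using that by (auto simp: faces_at_def)
    then have "card (bd i) \<ge> 3" by (rule card_bd)
    moreover have "card (bd i) \<noteq> 3" using False that by auto
    ultimately show ?thesis by linarith
  qed
  have "real (card (faces_at v)) * (1 / 4) \<le> excess v"
    unfolding excess_def
  proof (rule sum_bounded_below)
    fix i assume "i \<in> faces_at v"
    then have "real (card (bd i)) \<ge> 4" using ge4 by (simp add: numeral_le_real_of_nat_iff)
    then show "1 / 4 \<le> 1 - 3 / real (card (bd i))" by (simp add: field_simps)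
  qed
  then have "card (faces_at v) < 4" using ex by linarith
  moreover have "card (faces_at v) \<ge> 3" using card_faces_at[OF v] deg3[OF v] by simp
  ultimately have c3: "card (faces_at v) = 3" by simp
  then obtain i j k where F: "faces_at v = {i, j, k}" and ne: "i \<noteq> j" "j \<noteq> k" "i \<noteq> k"
    by (auto simp: card_3_iff)
  let ?x = "real (card (bd i))" and ?y = "real (card (bd j))" and ?z = "real (card (bd k))"
  have ge: "card (bd i) \<ge> 4" "card (bd j) \<ge> 4" "card (bd k) \<ge> 4" using ge4 F by auto
  have sum: "3 / ?x + 3 / ?y + 3 / ?z > 2" using ex ne unfolding excess_def F by simp
  have le: "3 / real m \<le> 3 / real l" if "l \<le> m" "0 < l" for l m :: nat
    using that by (intro divide_left_mono) auto
  have "\<not> (5 \<le> x \<and> 5 \<le> y)" if "3 / real x + 3 / real y + 3 / real z > 2" "4 \<le> z" for x y z :: nat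
    using le[of 5 x] le[of 5 y] le[of 4 z] that by auto
  from this[of "card (bd i)" "card (bd j)" "card (bd k)"] this[of "card (bd j)" "card (bd k)" "card (bd i)"]
    this[of "card (bd i)" "card (bd k)" "card (bd j)"] sum ge
  consider "card (bd i) = 4" "card (bd j) = 4" | "card (bd j) = 4" "card (bd k) = 4"
    | "card (bd i) = 4" "card (bd k) = 4" by (auto simp: algebra_simps)
  moreover have fin: "z \<le> 5" if "x = 4" "y = 4" "3 / real x + 3 / real y + 3 / real z > 2" for x y z :: nat
  proof (rule ccontr)
    assume "\<not> z \<le> 5"
    then have "3 / real z \<le> 3 / real 6" by (intro le) auto
    then show False using that by simp
  qed
  ultimately show ?thesis
  proof cases
    case 1
    then show ?thesis using model_at_quadrangles[OF v F c3] ge fin[OF 1] sum by simp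
  next
    case 2
    have "faces_at v = {j, k, i}" using F by auto
    from model_at_quadrangles[OF v this c3] show ?thesis using 2 ge fin[OF 2] sum by (simp add: algebra_simps)
  next
    case 3
    have "faces_at v = {i, k, j}" using F by auto
    from model_at_quadrangles[OF v this c3] show ?thesis using 3 ge fin[OF 3] sum by (simp add: algebra_simps)
  qed
qed

section \<open>Double counting and Euler's formula\<close>

lemma sum_faces_at: "(\<Sum>v\<in>V. \<Sum>i\<in>faces_at v. f i) = (\<Sum>i<n. real (card (bd i)) * f i)"
proof -
  have "(\<Sum>v\<in>V. \<Sum>i\<in>faces_at v. f i) = (\<Sum>v\<in>V. \<Sum>i<n. if v \<in> vs i then f i else 0)"
    by (rule sum.cong) (auto simp: faces_at_def sum.If_cases intro!: sum.cong)
  also have "\<dots> = (\<Sum>i<n. \<Sum>v\<in>V. if v \<in> vs i then f i else 0)" by (rule sum.swap)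
  also have "\<dots> = (\<Sum>i<n. real (card (bd i)) * f i)"
  proof (rule sum.cong)
    fix i assume "i \<in> {..<n}"
    then have i: "i < n" by simp
    have "V \<inter> {v. v \<in> vs i} = vs i" using vs_V[OF i] by auto
    then show "(\<Sum>v\<in>V. if v \<in> vs i then f i else 0) = real (card (bd i)) * f i"
      using finV card_vs[OF i] by (simp add: sum.If_cases)
  qed simp
  finally show ?thesis .
qed

lemma sum_card_bd: "(\<Sum>i<n. card (bd i)) = 2 * card E"
proof -
  have "(\<Sum>i<n. card {e\<in>E. e \<in> bd i}) = (\<Sum>e\<in>E. 2)"
    by (rule sum_multicount_gen) (use finE two in auto)
  moreover have "{e\<in>E. e \<in> bd i} = bd i" if "i < n" for i using sub[OF that] by auto
  ultimately show ?thesis by simp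
qed

text \<open>Merging two faces of lengths \<open>3 + x\<close> and \<open>3 + y\<close> into one of
  length \<open>3 + x + y\<close> does not increase the excess; all faces at \<open>v\<close> are
  merged into one.\<close>

lemma excess_lower:
  "excess v \<ge> 1 - 3 / (3 + (\<Sum>i\<in>faces_at v. real (card (bd i) - 3)))"
proof -
  have "1 - 3 / (3 + (\<Sum>i\<in>I. real (card (bd i) - 3))) \<le> (\<Sum>i\<in>I. 1 - 3 / real (card (bd i)))"
    if "finite I" "\<And>i. i \<in> I \<Longrightarrow> card (bd i) \<ge> 3" for I
    using that
  proof (induction I rule: finite_induct)
    case (insert i I)
    define x where "x = real (card (bd i) - 3)"
    define y where "y = (\<Sum>i\<in>I. real (card (bd i) - 3))"
    have xy: "x \<ge> 0" "y \<ge> 0" by (auto simp: x_def y_def sum_nonneg)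
    have cx: "real (card (bd i)) = 3 + x" using insert(4)[of i] by (simp add: x_def of_nat_diff)
    have "1 - 3 / (3 + (x + y)) \<le> (1 - 3 / (3 + x)) + (1 - 3 / (3 + y))"
    proof -
      have eq: "1 - 3 / (3 + t) = t / (3 + t)" if "t \<ge> 0" for t :: real using that by (simp add: field_simps)
      have "(x + y) / (3 + (x + y)) = x / (3 + (x + y)) + y / (3 + (x + y))" by (simp add: add_divide_distrib)
      also have "\<dots> \<le> x / (3 + x) + y / (3 + y)" using xy by (intro add_mono divide_left_mono) auto
      finally show ?thesis using xy by (simp only: eq add_nonneg_nonneg)
    qed
    moreover have sum1: "(\<Sum>i\<in>insert i I. real (card (bd i) - 3)) = x + y"
      using insert(1,2) by (simp add: x_def y_def)
    moreover have "1 - 3 / (3 + y) \<le> (\<Sum>i\<in>I. 1 - 3 / real (card (bd i)))"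
      using insert(3,4) unfolding y_def by simp
    moreover have sum2: "(\<Sum>i\<in>insert i I. 1 - 3 / real (card (bd i))) =
        (1 - 3 / (3 + x)) + (\<Sum>i\<in>I. 1 - 3 / real (card (bd i)))"
      using insert(1,2) cx by simp
    ultimately show ?case unfolding sum1 sum2 by linarith
  qed simp
  moreover have "card (bd i) \<ge> 3" if "i \<in> faces_at v" for i using that card_bd by (auto simp: faces_at_def)
  ultimately show ?thesis unfolding excess_def by simp
qed

text \<open>
  With \<open>L = 8 / \<epsilon> + 2\<close>, a vertex of degree \<open>d\<close> whose star has more than \<open>L\<close> vertices has excess at
  least \<open>1 - d / L\<close>: with \<open>s = 3 + \<Sum> (|F| - 3)\<close> over its faces \<open>F\<close> the excess is at least \<open>1 - 3 / s\<close>,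
  as \<open>x \<mapsto> x / (3 + x)\<close> is subadditive, and \<open>d s \<ge> 3 L\<close> because \<open>d, s \<ge> 3\<close> and \<open>d + s \<ge> L + 3\<close>.
  Summing over all vertices contradicts Euler's formula.
\<close>

lemma small_model:
  assumes eps: "0 < \<epsilon>" "\<epsilon> < 2" and ne: "V \<noteq> {}"
    and dense: "real (card E) > (2 + \<epsilon> / 2) * (real (card V) - 3)"
  shows "\<exists>v\<in>V. has_model 4 E (star v) \<and> int (card (star v)) \<le> \<lceil>8 / \<epsilon>\<rceil> + 2"
proof (rule ccontr)
  assume n: "\<not> ?thesis"
  define L where "L = 8 / \<epsilon> + 2"
  have L: "L > 0" using eps by (simp add: L_def add_pos_pos)
  have key: "1 - real (card (faces_at v)) / L \<le> excess v" if v: "v \<in> V" for v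
  proof (cases "excess v < 1")
    case True
    then have "int (card (star v)) > \<lceil>8 / \<epsilon>\<rceil> + 2" using model_at[OF v] n v by force
    \<comment> \<open>The step from 2 to 3 pays for \<open>v\<close> itself in
      \<open>card_star\<close>, so that \<open>L\<close> vertices remain for the degree and the long
      faces.\<close>
    then have "int (card (star v)) \<ge> \<lceil>8 / \<epsilon>\<rceil> + 3" by linarith
    then have *: "real (card (star v)) \<ge> L + 1" unfolding L_def by linarith
    let ?d = "real (card (faces_at v))"
    define x where "x = (\<Sum>i\<in>faces_at v. real (card (bd i) - 3))"
    have x0: "x \<ge> 0" by (simp add: x_def sum_nonneg)
    have "real (card (star v)) \<le> 1 + ?d + x"
      using card_star[OF v] unfolding x_def by (metis of_nat_1 of_nat_add of_nat_le_iff of_nat_sum)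
    then have dx: "?d + x \<ge> L" using * by simp
    have d3: "?d \<ge> 3" using card_faces_at[OF v] deg3[OF v] by simp
    have "3 * L \<le> ?d * (3 + x)"
    proof -
      have "0 \<le> (?d - 3) * x" using d3 x0 by simp
      then show ?thesis using dx by (simp add: algebra_simps)
    qed
    then have "3 / (3 + x) \<le> ?d / L" using L x0 by (simp add: field_simps)
    then show ?thesis using excess_lower[of v] unfolding x_def by simp
  next
    case False
    then show ?thesis using L by (smt (verit) divide_nonneg_pos of_nat_0_le_iff)
  qed
  have "(\<Sum>v\<in>V. 1 - real (card (faces_at v)) / L) \<le> (\<Sum>v\<in>V. excess v)"
    by (rule sum_mono) (rule key)
  moreover have "(\<Sum>v\<in>V. excess v) = 2 * real (card E) - 3 * real n"
  proof -
    have "(\<Sum>v\<in>V. excess v) = (\<Sum>i<n. real (card (bd i)) * (1 - 3 / real (card (bd i))))"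
      unfolding excess_def by (rule sum_faces_at)
    also have "\<dots> = (\<Sum>i<n. real (card (bd i)) - 3)"
    proof (rule sum.cong)
      fix i assume "i \<in> {..<n}"
      then have "card (bd i) \<ge> 3" using card_bd by simp
      then have "real (card (bd i)) \<noteq> 0" by auto
      then show "real (card (bd i)) * (1 - 3 / real (card (bd i))) = real (card (bd i)) - 3"
        by (simp add: right_diff_distrib)
    qed simp
    also have "\<dots> = 2 * real (card E) - 3 * real n"
      using sum_card_bd by (simp add: sum_subtractf flip: of_nat_sum)
    finally show ?thesis .
  qed
  moreover have "(\<Sum>v\<in>V. 1 - real (card (faces_at v)) / L) = real (card V) - 2 * real (card E) / L"
  proof -
    have "(\<Sum>v\<in>V. real (card (faces_at v))) = 2 * real (card E)"
      using sum_faces_at[of "\<lambda>_. 1"] sum_card_bd by (simp flip: of_nat_sum)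
    then show ?thesis by (simp add: sum_subtractf sum_divide_distrib[symmetric])
  qed
  moreover have "real n = real (card E) + 2 - real (card V)" using euler by linarith
  ultimately have "real (card E) * (1 - 2 / L) \<le> 2 * (real (card V) - 3)"
    by (simp add: algebra_simps)
  moreover have "1 - 2 / L = 4 / (4 + \<epsilon>)" using eps by (simp add: L_def field_simps)
  ultimately have "real (card E) * 4 \<le> 2 * (real (card V) - 3) * (4 + \<epsilon>)"
    using eps by (simp add: field_simps)
  then show False using dense by (simp add: algebra_simps)
qed

end

section \<open>Graphs without small models\<close>

text \<open>Pairs with the smaller end first keep the order of the vertices at hand, which is what
  the drawing and the edge counts refer to.\<close>

definition pairs_graph :: "nat \<Rightarrow> (nat \<times> nat) set \<Rightarrow> nat ugraph" where
  "pairs_graph N P = \<lparr>verts = {..<N}, edges = (\<lambda>(a, b). {a, b}) ` P\<rparr>"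

lemma inj_on_pairs: "P \<subseteq> {(a, b). a < (b::nat)} \<Longrightarrow> inj_on (\<lambda>(a, b). {a, b}) P"
proof (rule inj_onI)
  fix e f assume "P \<subseteq> {(a, b). a < b}" "e \<in> P" "f \<in> P" "(\<lambda>(a, b). {a, b}) e = (\<lambda>(a, b). {a, b}) f"
  moreover from this have "fst e < snd e" "fst f < snd f" by auto
  ultimately show "e = f" by (cases e; cases f) (auto simp: doubleton_eq_iff)
qed

lemma pairs_graph_edge:
  assumes "P \<subseteq> {(a, b). a < b}" "{x, y} \<in> edges (pairs_graph N P)"
  shows "(x < y \<and> (x, y) \<in> P) \<or> (y < x \<and> (y, x) \<in> P)"
  using assms by (auto simp: pairs_graph_def doubleton_eq_iff)

text \<open>With \<open>x = a + t * (b - a)\<close> this is the parabola of height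
  \<open>\<sigma> * (x - a) * (b - x)\<close>, and the sign of \<open>\<sigma>\<close> selects the
  side of the line.\<close>

definition page_arc :: "real \<Rightarrow> real \<Rightarrow> real \<Rightarrow> real \<Rightarrow> complex" where
  "page_arc \<sigma> a b t = Complex (a + t * (b - a)) (\<sigma> * (t * (b - a)) * ((1 - t) * (b - a)))"

lemma arc_page_arc: "a < b \<Longrightarrow> arc (page_arc \<sigma> a b)"
proof -
  assume "a < b"
  then have "inj_on (page_arc \<sigma> a b) {0..1}" by (auto simp: inj_on_def page_arc_def)
  moreover have "continuous_on {0..1} (page_arc \<sigma> a b)"
    unfolding page_arc_def Complex_eq by (intro continuous_intros)
  ultimately show ?thesis by (simp add: arc_def path_def)
qed

lemma page_arc_image:
  assumes "a < b" "z \<in> path_image (page_arc \<sigma> a b)"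
  shows "a \<le> Re z" "Re z \<le> b" "Im z = \<sigma> * (Re z - a) * (b - Re z)"
proof -
  obtain t where t: "0 \<le> t" "t \<le> 1" "z = page_arc \<sigma> a b t" using assms by (auto simp: path_image_def)
  have "t * (b - a) \<le> 1 * (b - a)" using t assms by (intro mult_right_mono) auto
  moreover have "0 \<le> t * (b - a)" using t assms by simp
  moreover have "Re z = a + t * (b - a)" using t by (simp add: page_arc_def)
  ultimately show "a \<le> Re z" "Re z \<le> b" by simp_all
  show "Im z = \<sigma> * (Re z - a) * (b - Re z)" using t by (simp add: page_arc_def algebra_simps)
qed

lemma nested_heights:
  fixes a b c d x :: real
  assumes "a \<le> c" "c < x" "x < d" "d \<le> b" "(a, b) \<noteq> (c, d)"
  shows "(x - c) * (d - x) < (x - a) * (b - x)"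
proof (cases "a = c")
  case True
  then show ?thesis using assms by (auto intro!: mult_strict_left_mono)
next
  case False
  have "(x - c) * (d - x) \<le> (x - c) * (b - x)" using assms by (intro mult_left_mono) auto
  also have "\<dots> < (x - a) * (b - x)" using assms False by (intro mult_strict_right_mono) auto
  finally show ?thesis .
qed

text \<open>
  Vertices lie on a line and edges are parabolic arcs above or below it. Nested arcs on the same
  side have strictly nested heights, so only interleaving edges can cross.
\<close>

lemma planar_two_pages:
  fixes up :: "nat \<Rightarrow> nat \<Rightarrow> bool"
  assumes P: "P \<subseteq> {(a, b). a < b \<and> b < N}"
    and nocross: "\<And>a b c d. (a, b) \<in> P \<Longrightarrow> (c, d) \<in> P \<Longrightarrow> a < c \<Longrightarrow> c < b \<Longrightarrow> b < d \<Longrightarrow> up a b \<noteq> up c d"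
  shows "planar (pairs_graph N P)"
proof -
  define \<sigma> :: "nat \<Rightarrow> nat \<Rightarrow> real" where "\<sigma> a b = (if up a b then 1 else -1)" for a b
  define p :: "nat \<Rightarrow> complex" where "p i = complex_of_real (real i)" for i
  define \<gamma> where "\<gamma> e = page_arc (\<sigma> (Min e) (Max e)) (real (Min e)) (real (Max e))" for e
  have g: "\<gamma> {a, b} = page_arc (\<sigma> a b) (real a) (real b)" if "(a, b) \<in> P" for a b
    using that P by (auto simp: \<gamma>_def min_def max_def)
  have height: "(x - real a) * (real b - x) \<noteq> (x - real c) * (real d - x)"
    if "(a, b) \<in> P" "(c, d) \<in> P" "(a, b) \<noteq> (c, d)" "up a b = up c d"
      "real a < x" "x < real b" "real c < x" "x < real d" for a b c d x
  proof -
    have "\<not> (a < c \<and> b < d)" "\<not> (c < a \<and> d < b)"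
      using nocross[of a b c d] nocross[of c d a b] that by auto
    then consider "a \<le> c" "d \<le> b" | "c \<le> a" "b \<le> d" by linarith
    then show ?thesis
    proof cases
      case 1
      then show ?thesis using nested_heights[of "real a" "real c" x "real d" "real b"] that by auto
    next
      case 2
      then show ?thesis using nested_heights[of "real c" "real a" x "real b" "real d"] that by auto
    qed
  qed
  have s0: "\<sigma> a b \<noteq> 0" for a b by (simp add: \<sigma>_def)
  have int: "real a < Re z \<and> Re z < real b \<and> Im z \<noteq> 0 \<and> Im z = \<sigma> a b * (Re z - real a) * (real b - Re z)"
    if "(a, b) \<in> P" "z \<in> path_image (\<gamma> {a, b})" "z \<notin> p ` {a, b}" for a b z
  proof -
    have ab: "real a < real b" using that P by auto
    note im = page_arc_image[OF ab that(2)[unfolded g[OF that(1)]]]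
    have "Re z \<noteq> real a" "Re z \<noteq> real b"
      using im(3) that(3) by (auto simp: p_def complex_eq_iff)
    then show ?thesis using im s0 by auto
  qed
  have "plane_drawing (pairs_graph N P) p \<gamma>"
    unfolding plane_drawing_def pairs_graph_def ugraph.simps
  proof (intro conjI ballI impI)
    show "inj_on p {..<N}" by (auto simp: inj_on_def p_def)
  next
    fix e assume "e \<in> (\<lambda>(a, b). {a, b}) ` P"
    then obtain a b where ab: "(a, b) \<in> P" "e = {a, b}" by auto
    have lt: "real a < real b" using ab P by auto
    show "arc (\<gamma> e)" using arc_page_arc[OF lt] g ab by simp
    show "{pathstart (\<gamma> e), pathfinish (\<gamma> e)} = p ` e"
      using g[OF ab(1)] ab(2)
      by (simp add: pathstart_def pathfinish_def page_arc_def p_def complex_of_real_def del: of_real_of_nat_eq)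
    show "(path_image (\<gamma> e) - p ` e) \<inter> p ` {..<N} = {}"
      using int[OF ab(1)] ab(2) by (fastforce simp: p_def)
  next
    fix e f assume "e \<in> (\<lambda>(a, b). {a, b}) ` P" "f \<in> (\<lambda>(a, b). {a, b}) ` P" and ne: "e \<noteq> f"
    then obtain a b c d where ab: "(a, b) \<in> P" "e = {a, b}" and cd: "(c, d) \<in> P" "f = {c, d}" by auto
    show "(path_image (\<gamma> e) - p ` e) \<inter> path_image (\<gamma> f) = {}"
    proof (rule ccontr)
      assume "\<not> ?thesis"
      then obtain z where z: "z \<in> path_image (\<gamma> e)" "z \<notin> p ` e" "z \<in> path_image (\<gamma> f)" by auto
      have i1: "real a < Re z" "Re z < real b" "Im z \<noteq> 0" "Im z = \<sigma> a b * (Re z - real a) * (real b - Re z)"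
        using int[OF ab(1) z(1)[unfolded ab(2)] z(2)[unfolded ab(2)]] by blast+
      then have "z \<notin> p ` {c, d}" by (auto simp: p_def)
      then have i2: "real c < Re z" "Re z < real d" "Im z = \<sigma> c d * (Re z - real c) * (real d - Re z)"
        using int[OF cd(1) z(3)[unfolded cd(2)]] by blast+
      have p1: "(Re z - real a) * (real b - Re z) > 0" "(Re z - real c) * (real d - Re z) > 0"
        using i1 i2 by auto
      have eq: "\<sigma> a b * ((Re z - real a) * (real b - Re z)) = \<sigma> c d * ((Re z - real c) * (real d - Re z))"
        using i1(4) i2(3) by (simp add: mult.assoc)
      have "up a b = up c d" using eq p1 by (auto simp: \<sigma>_def split: if_splits)
      moreover have "(a, b) \<noteq> (c, d)" using ne ab cd by auto
      ultimately show False
        using height[OF ab(1) cd(1)] eq i1(1,2) i2(1,2) by (auto simp: \<sigma>_def split: if_splits)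
    qed
  qed
  then show ?thesis unfolding planar_def by blast
qed

lemma simple_pairs_graph:
  "P \<subseteq> {(a, b). a < b \<and> b < N} \<Longrightarrow> simple_graph (pairs_graph N P)"
  by (fastforce simp: simple_graph_def pairs_graph_def)

lemma average_degree_pairs:
  "P \<subseteq> {(a, b). a < b \<and> b < N} \<Longrightarrow> average_degree (pairs_graph N P) = 2 * real (card P) / real N"
  using card_image[OF inj_on_pairs[of P]] by (auto simp: average_degree_def pairs_graph_def)

lemma finite_pairs: "P \<subseteq> {(a, b). a < b \<and> b < N} \<Longrightarrow> finite (P :: (nat \<times> nat) set)"
  by (rule finite_subset[of _ "{..<N} \<times> {..<N}"]) auto

text \<open>If \<open>{x}\<close> is a branch set, its at most two neighbours in \<open>W\<close>
  cannot meet three other branch sets. Otherwise \<open>x\<close> has a neighbour in its own branch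
  set, which is adjacent to the other neighbour of \<open>x\<close> and so can take over the role of
  \<open>x\<close>.\<close>

lemma model_eliminate:
  assumes M: "has_model 4 E W" and x: "x \<in> W" and nl: "x \<notin> nbrs E x" and nb: "nbrs E x \<inter> W \<subseteq> {y, z}" "y = z \<or> {y, z} \<in> E"
  shows "has_model 4 E (W - {x})"
proof -
  obtain S :: "nat \<Rightarrow> 'a set" where S: "\<And>i. i < 4 \<Longrightarrow> conn E (S i)" "\<And>i. i < 4 \<Longrightarrow> S i \<subseteq> W"
    "\<And>i j. i < 4 \<Longrightarrow> j < 4 \<Longrightarrow> i \<noteq> j \<Longrightarrow> S i \<inter> S j = {}"
    "\<And>i j. i < 4 \<Longrightarrow> j < 4 \<Longrightarrow> i \<noteq> j \<Longrightarrow> \<exists>u\<in>S i. \<exists>w\<in>S j. {u, w} \<in> E"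
    using M unfolding has_model_def by blast
  show ?thesis
  proof (cases "\<exists>i<4. x \<in> S i")
    case False
    then show ?thesis unfolding has_model_def using S by (intro exI[of _ S]) blast
  next
    case True
    then obtain i where i: "i < 4" "x \<in> S i" by auto
    have out: "x \<notin> S j" if "j < 4" "j \<noteq> i" for j using S(3)[OF that(1) i(1) that(2)] i by auto
    show ?thesis
    proof (cases "S i = {x}")
      case True
      have "\<exists>w. w \<in> S j \<inter> {y, z}" if j: "j \<in> {..<4} - {i}" for j
      proof -
        obtain w where "w \<in> S j" "{x, w} \<in> E" using S(4)[of i j] i j True by auto
        then show ?thesis using nb S(2)[of j] j by (auto simp: nbrs_def)
      qed
      then obtain h where h: "\<And>j. j \<in> {..<4} - {i} \<Longrightarrow> h j \<in> S j \<inter> {y, z}" by metis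
      have "inj_on h ({..<4} - {i})"
      proof (rule inj_onI)
        fix j k assume jk: "j \<in> {..<4} - {i}" "k \<in> {..<4} - {i}" "h j = h k"
        then show "j = k" using S(3)[of j k] h[of j] h[of k] by auto
      qed
      moreover have "h ` ({..<4} - {i}) \<subseteq> {y, z}" using h by auto
      ultimately have "card ({..<4} - {i}) \<le> card {y, z}" by (intro card_inj_on_le) auto
      also have "\<dots> \<le> 2" by (simp add: card_insert_if)
      finally show ?thesis using i by simp
    next
      case False
      then obtain w where "w \<in> S i" "w \<noteq> x" using i by auto
      then obtain y' where y': "y' \<in> S i" "{x, y'} \<in> E" using conn_imp_nbr[OF S(1)] i by metis
      have nbW: "u \<in> {y, z}" if "{x, u} \<in> E" "u \<in> W" for u using nb(1) that by (auto simp: nbrs_def)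
      have "y' \<in> {y, z}" using nbW y' S(2)[OF i(1)] by auto
      then obtain z' where yz: "{y, z} = {y', z'}" by auto
      from nb(2) have "y' = z' \<or> {y', z'} \<in> E"
      proof
        assume "y = z"
        then have "y' \<in> {y}" "z' \<in> {y}" using yz by auto
        then show ?thesis by simp
      next
        assume "{y, z} \<in> E"
        then show ?thesis unfolding yz by simp
      qed
      then have z': "\<And>u. {x, u} \<in> E \<Longrightarrow> u \<in> W \<Longrightarrow> u = y' \<or> u = z'" "y' = z' \<or> {y', z'} \<in> E"
        using nbW unfolding yz by simp_all
      have adj: "u = y' \<or> {y', u} \<in> E" if "{x, u} \<in> E" "u \<in> W" for u
        using z'(1)[OF that] z'(2) by auto
      have yx: "y' \<noteq> x" using y' nl by (auto simp: nbrs_def)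
      \<comment> \<open>Replacing \<open>x\<close> by \<open>y'\<close> turns each step of a walk
        into a step that avoids \<open>x\<close> or into no step at all.\<close>
      define f where "f u = (if u = x then y' else u)" for u
      let ?S' = "S(i := S i - {x})"
      have step: "(f u, f w) \<in> (adj_in E (S i - {x}))\<^sup>*" if "(u, w) \<in> (adj_in E (S i))\<^sup>*" for u w
        using that
      proof (induction rule: rtrancl_induct)
        case (step a b)
        then have ab: "a \<in> S i" "b \<in> S i" "{a, b} \<in> E" by (auto simp: adj_in_def)
        have "(f a, f b) \<in> (adj_in E (S i - {x}))\<^sup>="
          using ab adj[of a] adj[of b] S(2)[OF i(1)] y' yx
          by (auto simp: f_def adj_in_def insert_commute)
        then show ?case
        proof
          assume "(f a, f b) \<in> adj_in E (S i - {x})"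
          with step.IH show ?case by (rule rtrancl_into_rtrancl)
        qed (use step.IH in simp)
      qed simp
      have "conn E (S i - {x})"
        unfolding conn_def
      proof (intro conjI ballI)
        show "S i - {x} \<noteq> {}" using y' yx by auto
        fix u w assume uw: "u \<in> S i - {x}" "w \<in> S i - {x}"
        then have "(u, w) \<in> (adj_in E (S i))\<^sup>*" using S(1)[OF i(1)] unfolding conn_def by blast
        then show "(u, w) \<in> (adj_in E (S i - {x}))\<^sup>*"
          using step[of u w] uw unfolding f_def by simp
      qed
      then have 1: "conn E (?S' j) \<and> ?S' j \<subseteq> W - {x}" if "j < 4" for j
        using S(1)[OF that] S(2)[OF that] out[OF that] by auto
      have touch: "\<exists>u\<in>S i - {x}. \<exists>w\<in>S j. {u, w} \<in> E" if j: "j < 4" "j \<noteq> i" for j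
      proof -
        obtain u w where uw: "u \<in> S i" "w \<in> S j" "{u, w} \<in> E" using S(4)[of i j] i j by auto
        have "w \<noteq> y'" using uw y' S(3)[OF j(1) i(1) j(2)] by auto
        moreover have "w \<in> W" using uw S(2)[OF j(1)] by auto
        ultimately show ?thesis using uw y' yx adj[of w] by (cases "u = x") auto
      qed
      have 2: "?S' j \<inter> ?S' k = {} \<and> (\<exists>u\<in>?S' j. \<exists>w\<in>?S' k. {u, w} \<in> E)" if jk: "j < 4" "k < 4" "j \<noteq> k" for j k
      proof -
        have "?S' j \<inter> ?S' k = {}" using S(3)[OF jk] by auto
        moreover have "\<exists>u\<in>?S' j. \<exists>w\<in>?S' k. {u, w} \<in> E"
        proof -
          consider "j = i" "k \<noteq> i" | "k = i" "j \<noteq> i" | "j \<noteq> i" "k \<noteq> i" using jk by auto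
          then show ?thesis
          proof cases
            case 1
            then show ?thesis using touch[of k] jk by simp
          next
            case 2
            then obtain u w where "u \<in> S i - {x}" "w \<in> S j" "{u, w} \<in> E" using touch[of j] jk by auto
            moreover from this have "{w, u} \<in> E" by (simp add: insert_commute)
            ultimately have "\<exists>w\<in>S j. \<exists>u\<in>S i - {x}. {w, u} \<in> E" by blast
            then show ?thesis using 2 by simp
          next
            case 3
            then show ?thesis using S(4)[OF jk] by simp
          qed
        qed
        ultimately show ?thesis by blast
      qed
      show ?thesis unfolding has_model_def using 1 2 by (intro exI[of _ ?S']) blast
    qed
  qed
qed

text \<open>The condition is required of all subsets, so it survives a deletion and
  \<open>model_eliminate\<close> can be repeated until nothing is left.\<close>

lemma no_model_by_elimination:
  assumes "finite W" "\<And>x. x \<notin> nbrs E x"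
    and "\<And>U. U \<subseteq> W \<Longrightarrow> U \<noteq> {} \<Longrightarrow> \<exists>x\<in>U. \<exists>y z. nbrs E x \<inter> U \<subseteq> {y, z} \<and> (y = z \<or> {y, z} \<in> E)"
  shows "\<not> has_model 4 E W"
  using assms(1,3)
proof (induction "card W" arbitrary: W rule: less_induct)
  case less
  show ?case
  proof
    assume M: "has_model 4 E W"
    then have "W \<noteq> {}" unfolding has_model_def conn_def by (metis subset_empty zero_less_numeral)
    then obtain x y z where x: "x \<in> W" "nbrs E x \<inter> W \<subseteq> {y, z}" "y = z \<or> {y, z} \<in> E"
      using less.prems(2)[of W] by auto
    have "has_model 4 E (W - {x})" using model_eliminate[OF M x(1) assms(2) x(2,3)] .
    moreover have smaller: "card (W - {x}) < card W" using x less.prems(1) by (meson card_Diff1_less)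
    have "\<not> has_model 4 E (W - {x})"
    proof (rule less.hyps[OF smaller])
      show "finite (W - {x})" using less.prems(1) by simp
      show "\<exists>x\<in>U. \<exists>y z. nbrs E x \<inter> U \<subseteq> {y, z} \<and> (y = z \<or> {y, z} \<in> E)"
        if "U \<subseteq> W - {x}" "U \<noteq> {}" for U
        using less.prems(2)[of U] that by blast
    qed
    ultimately show False by simp
  qed
qed

lemma model_of_complete_model:
  assumes "complete_model t G B" "simple_graph G"
  shows "has_model t (edges G) (\<Union>i<t. verts (B i))" "model_order t B = card (\<Union>i<t. verts (B i))"
proof -
  have B: "verts (B i) \<subseteq> verts G" "edges (B i) \<subseteq> edges G" "connected_graph (B i)" "simple_graph (B i)" if "i < t" for i
    using assms that by (auto simp: complete_model_def subgraph_def)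
  have dis: "verts (B i) \<inter> verts (B j) = {} \<and> (\<exists>x\<in>verts (B i). \<exists>y\<in>verts (B j). {x, y} \<in> edges G)"
    if "i < t" "j < t" "i \<noteq> j" for i j using assms that by (auto simp: complete_model_def)
  have "conn (edges G) (verts (B i))" if i: "i < t" for i
  proof -
    have "{(x, y). {x, y} \<in> edges (B i)} \<subseteq> adj_in (edges G) (verts (B i))"
      using B[OF i] by (auto simp: adj_in_def simple_graph_def)
    then show ?thesis using B(3)[OF i] rtrancl_mono unfolding conn_def connected_graph_def by blast
  qed
  then show "has_model t (edges G) (\<Union>i<t. verts (B i))"
    unfolding has_model_def using dis by (intro exI[of _ "\<lambda>i. verts (B i)"]) blast
  have "finite (verts (B i))" if "i < t" for i using B(4)[OF that] by (simp add: simple_graph_def)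
  then show "model_order t B = card (\<Union>i<t. verts (B i))"
    unfolding model_order_def using dis by (intro card_UN_disjoint[symmetric]) auto
qed

text \<open>A path whose two ends are joined to all other vertices. It has the
  \<open>3 N - 6\<close> edges of a triangulation, so its average degree comes arbitrarily close to
  6.\<close>

definition dense_pairs :: "nat \<Rightarrow> (nat \<times> nat) set" where
  "dense_pairs N = {(i, j). i < j \<and> j < N \<and> (j = Suc i \<or> i = 0 \<or> Suc j = N)}"

text \<open>The fan from 0 is drawn above the line; the path and the fan from the last vertex do not
  interleave below it.\<close>

lemma dense_pairs_planar: "planar (pairs_graph N (dense_pairs N))"
  by (rule planar_two_pages[where up = "\<lambda>a b. a = 0"]) (auto simp: dense_pairs_def)

lemma card_dense_pairs:
  assumes "N \<ge> 3"
  shows "card (dense_pairs N) \<ge> 3 * N - 6"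
proof -
  let ?A = "(\<lambda>i. (i, Suc i)) ` {..<N - 1}" and ?B = "Pair (0::nat) ` {2..<N}" and ?C = "(\<lambda>i. (i, N - 1)) ` {1..<N - 2}"
  have "card ((?A \<union> ?B) \<union> ?C) = card (?A \<union> ?B) + card ?C"
    using assms by (intro card_Un_disjoint) auto
  also have "card (?A \<union> ?B) = card ?A + card ?B" by (intro card_Un_disjoint) auto
  also have "card ?A = N - 1" by (subst card_image) (auto simp: inj_on_def)
  also have "card ?B = N - 2" by (subst card_image) (auto simp: inj_on_def)
  also have "card ?C = N - 3" by (subst card_image) (auto simp: inj_on_def)
  finally have "card ((?A \<union> ?B) \<union> ?C) = 3 * N - 6" using assms by simp
  moreover have sub: "(?A \<union> ?B) \<union> ?C \<subseteq> dense_pairs N" using assms by (auto simp: dense_pairs_def)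
  moreover have fin: "finite (dense_pairs N)" by (rule finite_pairs[of _ N]) (auto simp: dense_pairs_def)
  ultimately show ?thesis using card_mono[OF fin sub] by simp
qed

text \<open>
  The square of a path, which has no \<open>K\<^sub>4\<close>-model, together with four nested chords whose ends are
  far apart.
\<close>

definition strip_pairs :: "nat \<Rightarrow> (nat \<times> nat) set" where
  "strip_pairs s = {(i, j). i < j \<and> j < 36 * s \<and>
     (j = i + 1 \<or> j = i + 2 \<or> (i + j = 36 * s \<and> 4 * s dvd i))}"

lemma strip_pairs_less: "strip_pairs s \<subseteq> {(a, b). a < b \<and> b < 36 * s}"
  by (auto simp: strip_pairs_def)

text \<open>The chords join \<open>4 * s * k\<close> and \<open>4 * s * (9 - k)\<close> for
  \<open>k\<close> from 1 to 4. That their ends are even serves the drawing, and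
  \<open>i + 4 \<le> j\<close> separates them from the short edges.\<close>

lemma strip_chord:
  assumes "(i, j) \<in> strip_pairs s" "i + j = 36 * s" "4 * s dvd i"
  shows "i + 4 \<le> j" "even i" "even j" "4 * s dvd j"
proof -
  obtain k where k: "i = 4 * s * k" using assms(3) by (auto simp: dvd_def)
  have lt: "i < j" using assms(1) by (auto simp: strip_pairs_def)
  have j: "j = 4 * s * (9 - k)"
    using assms(2) k by (simp add: diff_mult_distrib2)
  have "k \<le> 4"
  proof (rule ccontr)
    assume "\<not> k \<le> 4"
    then have "4 * s * (9 - k) \<le> 4 * s * k" by (intro mult_le_mono2) auto
    then show False using lt j k by simp
  qed
  then have "4 * s * (k + 1) \<le> j" unfolding j by (intro mult_le_mono2) auto
  moreover have "s \<ge> 1" using lt assms(2) by (cases s) auto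
  ultimately show "i + 4 \<le> j" using k by simp
  show "even i" "even j" "4 * s dvd j" using k j by simp_all
qed

text \<open>Edges of length two are drawn above or below according to the parity of their start, so
  consecutive ones do not cross. Chords are nested and above; as their ends are even, an edge that
  jumps over such an end starts at an odd vertex and is below.\<close>

lemma strip_planar: "planar (pairs_graph (36 * s) (strip_pairs s))"
proof (rule planar_two_pages[OF strip_pairs_less, where up = "\<lambda>a b. \<not> (b = a + 2 \<and> odd a)"])
  fix a b c d assume ab: "(a, b) \<in> strip_pairs s" and cd: "(c, d) \<in> strip_pairs s" and lt: "a < c" "c < b" "b < d"
  have ch1: "a + 4 \<le> b \<and> even a \<and> even b" if "a + b = 36 * s" "4 * s dvd a" using strip_chord[OF ab that] by auto
  have ch2: "c + 4 \<le> d \<and> even c \<and> even d" if "c + d = 36 * s" "4 * s dvd c" using strip_chord[OF cd that] by auto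
  consider "b = a + 2" | "a + b = 36 * s" "4 * s dvd a" using ab lt by (auto simp: strip_pairs_def)
  then show "(\<not> (b = a + 2 \<and> odd a)) \<noteq> (\<not> (d = c + 2 \<and> odd c))"
  proof cases
    case 1
    then have c: "c = a + 1" using lt by simp
    consider "d = c + 2" | "c + d = 36 * s" "4 * s dvd c" using cd lt c 1 by (auto simp: strip_pairs_def)
    then show ?thesis by cases (use 1 c ch2 in auto)
  next
    case 2
    consider "d = c + 2" | "c + d = 36 * s" "4 * s dvd c" using cd lt by (auto simp: strip_pairs_def)
    then show ?thesis
    proof cases
      case 1
      then have "b = c + 1" using lt by simp
      then show ?thesis using 1 ch1[OF 2] by auto
    qed (use 2 lt in auto)
  qed
qed

text \<open>The square of the path has \<open>72 * s - 3\<close> edges, so four is the least number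
  of chords that gives more than twice as many edges as vertices.\<close>

lemma card_strip_pairs:
  assumes "s \<ge> 1"
  shows "card (strip_pairs s) \<ge> 72 * s + 1"
proof -
  let ?A = "(\<lambda>i. (i, i + 1)) ` {..<36 * s - 1}" and ?B = "(\<lambda>i. (i, i + 2)) ` {..<36 * s - 2}"
    and ?C = "(\<lambda>k. (4 * s * k, 4 * s * (9 - k))) ` {1..4}"
  have C: "4 * s * k + 4 \<le> 4 * s * (9 - k)" if "k \<in> {1..4}" for k
  proof -
    have "4 * s * (k + 1) \<le> 4 * s * (9 - k)" using that by (intro mult_le_mono2) auto
    then show ?thesis using assms by simp
  qed
  have "card ((?A \<union> ?B) \<union> ?C) = card (?A \<union> ?B) + card ?C"
    using C by (intro card_Un_disjoint) fastforce+
  also have "card (?A \<union> ?B) = card ?A + card ?B" by (intro card_Un_disjoint) auto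
  also have "card ?A = 36 * s - 1" by (subst card_image) (auto simp: inj_on_def)
  also have "card ?B = 36 * s - 2" by (subst card_image) (auto simp: inj_on_def)
  also have "card ?C = 4" using assms by (subst card_image) (auto simp: inj_on_def)
  finally have "card ((?A \<union> ?B) \<union> ?C) = 72 * s + 1" using assms by simp
  moreover have sub: "(?A \<union> ?B) \<union> ?C \<subseteq> strip_pairs s"
  proof -
    have "(4 * s * k, 4 * s * (9 - k)) \<in> strip_pairs s" if k: "k \<in> {1..4}" for k
    proof -
      have "4 * s * k + 4 * s * (9 - k) = 4 * s * (k + (9 - k))" by (rule add_mult_distrib2[symmetric])
      then have "4 * s * k + 4 * s * (9 - k) = 36 * s" using k by simp
      moreover have "4 * s * k < 4 * s * (9 - k)" using C[OF k] by linarith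
      moreover have "4 * s * k > 0" using k assms by simp
      ultimately show ?thesis unfolding strip_pairs_def by simp
    qed
    then have "?C \<subseteq> strip_pairs s" by blast
    moreover have "?A \<union> ?B \<subseteq> strip_pairs s" by (auto simp: strip_pairs_def)
    ultimately show ?thesis by blast
  qed
  moreover have fin: "finite (strip_pairs s)" by (rule finite_pairs[OF strip_pairs_less])
  ultimately show ?thesis using card_mono[OF fin sub] by simp
qed

lemma strip_nbrs:
  assumes "u \<in> nbrs (edges (pairs_graph (36 * s) (strip_pairs s))) x"
  shows "u = x + 1 \<or> x = u + 1 \<or> u = x + 2 \<or> x = u + 2 \<or> (u + x = 36 * s \<and> 4 * s dvd x)"
proof -
  have "{x, u} \<in> edges (pairs_graph (36 * s) (strip_pairs s))" using assms by (simp add: nbrs_def)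
  then have "(x, u) \<in> strip_pairs s \<or> (u, x) \<in> strip_pairs s"
    using pairs_graph_edge[of "strip_pairs s"] strip_pairs_less by blast
  then show ?thesis
  proof
    assume "(u, x) \<in> strip_pairs s"
    moreover have "4 * s dvd x" if "u + x = 36 * s" "4 * s dvd u"
      using strip_chord(4)[OF calculation that] .
    ultimately show ?thesis by (auto simp: strip_pairs_def)
  qed (auto simp: strip_pairs_def)
qed

lemma strip_edge:
  "j < 36 * s \<Longrightarrow> j = i + 1 \<Longrightarrow> {i, j} \<in> edges (pairs_graph (36 * s) (strip_pairs s))"
  unfolding pairs_graph_def strip_pairs_def by (auto intro!: image_eqI[of _ _ "(i, j)"])

text \<open>
  A set of fewer than \<open>s\<close> vertices misses two consecutive vertices close below its maximum, and a
  vertex next to such a gap has at most two neighbours in the set.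
\<close>

lemma strip_eliminate:
  assumes s: "s \<ge> 1" and U: "U \<subseteq> {..<36 * s}" "U \<noteq> {}" "card U < s"
  shows "\<exists>x\<in>U. \<exists>y z. nbrs (edges (pairs_graph (36 * s) (strip_pairs s))) x \<inter> U \<subseteq> {y, z} \<and>
    (y = z \<or> {y, z} \<in> edges (pairs_graph (36 * s) (strip_pairs s)))"
proof -
  let ?E = "edges (pairs_graph (36 * s) (strip_pairs s))"
  have fin: "finite U" using U(1) finite_subset by blast
  define x where "x = Max U"
  have x: "x \<in> U" "\<And>u. u \<in> U \<Longrightarrow> u \<le> x" using fin U(2) by (auto simp: x_def)
  show ?thesis
  \<comment> \<open>Only positive multiples of \<open>4 * s\<close> are ends of chords: the partner
    of 0 would be \<open>36 * s\<close>, which is not a vertex.\<close>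
  proof (cases "4 * s dvd x \<and> x > 0")
    case False
    then have "nbrs ?E x \<inter> U \<subseteq> {x - 1, x - 2}"
    proof (intro subsetI)
      fix u assume u: "u \<in> nbrs ?E x \<inter> U"
      then have "u \<le> x" "u < 36 * s" using x(2) U(1) by auto
      then show "u \<in> {x - 1, x - 2}" using strip_nbrs[of u s x] u False by auto
    qed
    moreover have "x - 1 = x - 2 \<or> {x - 1, x - 2} \<in> ?E"
    proof (cases "x \<ge> 2")
      case True
      then have "{x - 2, x - 1} \<in> ?E" using U(1) x(1) by (intro strip_edge) auto
      then show ?thesis by (simp add: insert_commute)
    qed auto
    ultimately show ?thesis using x(1) by blast
  next
    case True
    then have x4: "4 * s \<le> x" by (simp add: dvd_imp_le)
    \<comment> \<open>These are \<open>s\<close> disjoint pairs of consecutive vertices, and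
      \<open>U\<close> has too few vertices to meet all of them.\<close>
    have "\<exists>j<s. x - 4 * s + 1 + 2 * j \<notin> U \<and> x - 4 * s + 2 + 2 * j \<notin> U"
    proof (rule ccontr)
      assume n: "\<not> ?thesis"
      define g where "g j = (if x - 4 * s + 1 + 2 * j \<in> U then x - 4 * s + 1 + 2 * j else x - 4 * s + 2 + 2 * j)" for j
      have "g ` {..<s} \<subseteq> U" using n by (auto simp: g_def)
      moreover have "inj_on g {..<s}"
      proof (rule inj_onI)
        fix i j assume "g i = g j"
        then show "i = j" unfolding g_def by (auto split: if_splits)
      qed
      ultimately have "s \<le> card U" using card_inj_on_le[of g "{..<s}" U] fin by simp
      then show False using U(3) by simp
    qed
    then obtain j where j: "j < s" "x - 4 * s + 1 + 2 * j \<notin> U" "x - 4 * s + 2 + 2 * j \<notin> U" by auto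
    define p where "p = x - 4 * s + 1 + 2 * j"
    have p: "p \<notin> U" "p + 1 \<notin> U" "x - 4 * s < p" "p + 1 < x" using j x4 by (auto simp: p_def)
    \<comment> \<open>The least vertex \<open>y\<close> of \<open>U\<close> above the gap has no
      short edge downwards within \<open>U\<close>. If \<open>y \<noteq> x\<close>, it is too close
      to the chord end \<open>x\<close> to be one itself.\<close>
    define Y where "Y = {w \<in> U. p + 1 < w}"
    define y where "y = Min Y"
    have Y: "finite Y" "x \<in> Y" using fin x p by (auto simp: Y_def)
    have y: "y \<in> Y" "\<And>w. w \<in> Y \<Longrightarrow> y \<le> w" using Y by (auto simp: y_def intro: Min_in)
    have yU: "y \<in> U" "p + 1 < y" using y(1) by (auto simp: Y_def)
    have below: "y \<noteq> u + 1" "y \<noteq> u + 2" if u: "u \<in> U" for u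
    proof -
      have "u \<noteq> p" "u \<noteq> p + 1" using p u by auto
      moreover have "\<not> (p + 1 < u \<and> u < y)" using y(2)[of u] u by (auto simp: Y_def)
      ultimately show "y \<noteq> u + 1" "y \<noteq> u + 2" using yU by auto
    qed
    show ?thesis
    proof (cases "y = x")
      case True
      have "nbrs ?E x \<inter> U \<subseteq> {36 * s - x}"
      proof
        fix u assume u: "u \<in> nbrs ?E x \<inter> U"
        then show "u \<in> {36 * s - x}" using strip_nbrs[of u s x] below[of u] x(2)[of u] True by auto
      qed
      then show ?thesis using x(1) by blast
    next
      case False
      then have yx: "y < x" using x(2)[OF yU(1)] by simp
      have nd: "\<not> 4 * s dvd y"
      proof
        assume "4 * s dvd y"
        moreover have "4 * s dvd x" using \<open>4 * s dvd x \<and> x > 0\<close> by simp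
        ultimately have "4 * s dvd x - y" using yx by (simp add: dvd_diff_nat)
        then have "4 * s \<le> x - y" using yx by (simp add: dvd_imp_le)
        then show False using yU p by linarith
      qed
      have sub: "nbrs ?E y \<inter> U \<subseteq> {y + 1, y + 2} \<inter> U"
      proof
        fix u assume u: "u \<in> nbrs ?E y \<inter> U"
        then show "u \<in> {y + 1, y + 2} \<inter> U" using strip_nbrs[of u s y] below[of u] nd by auto
      qed
      show ?thesis
      proof (cases "y + 2 \<le> x")
        case True
        then have "{y + 1, y + 2} \<in> ?E" using U(1) x(1) by (intro strip_edge) auto
        then show ?thesis using sub yU(1) by blast
      next
        case False
        then have "y + 2 \<notin> U" using x(2) by blast
        then have "nbrs ?E y \<inter> U \<subseteq> {y + 1, y + 1}" using sub by auto
        then show ?thesis using yU(1) by blast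
      qed
    qed
  qed
qed

lemma no_loops: "P \<subseteq> {(a, b). a < b} \<Longrightarrow> x \<notin> nbrs (edges (pairs_graph N P)) x"
  using pairs_graph_edge[of P x x N] by (auto simp: nbrs_def)

lemma strip_model_large:
  assumes s: "s \<ge> 1" and M: "complete_model 4 (pairs_graph (36 * s) (strip_pairs s)) B"
  shows "model_order 4 B \<ge> s"
proof (rule ccontr)
  let ?G = "pairs_graph (36 * s) (strip_pairs s)" and ?W = "\<Union>i<4. verts (B i)"
  assume n: "\<not> ?thesis"
  note W = model_of_complete_model[OF M simple_pairs_graph[OF strip_pairs_less]]
  have sub: "?W \<subseteq> {..<36 * s}" using M by (auto simp: complete_model_def subgraph_def pairs_graph_def)
  then have fin: "finite ?W" using finite_subset by blast
  have "\<not> has_model 4 (edges ?G) ?W"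
  proof (rule no_model_by_elimination[OF fin])
    show "x \<notin> nbrs (edges ?G) x" for x using strip_pairs_less by (intro no_loops) blast
    fix U assume U: "U \<subseteq> ?W" "U \<noteq> {}"
    have "card U < s" using card_mono[OF fin U(1)] n W(2) by simp
    then show "\<exists>x\<in>U. \<exists>y z. nbrs (edges ?G) x \<inter> U \<subseteq> {y, z} \<and> (y = z \<or> {y, z} \<in> edges ?G)"
      using strip_eliminate[OF s _ U(2)] U(1) sub by blast
  qed
  then show False using W(1) by simp
qed

lemma model_order_ge:
  assumes "complete_model t G B" "simple_graph G"
  shows "model_order t B \<ge> t"
proof -
  have "card (verts (B i)) \<ge> 1" if "i < t" for i
  proof -
    have "connected_graph (B i)" "simple_graph (B i)"
      using assms that by (auto simp: complete_model_def subgraph_def)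
    then show ?thesis by (auto simp: connected_graph_def simple_graph_def Suc_le_eq card_gt_0_iff)
  qed
  then have "(\<Sum>i<t. 1) \<le> (\<Sum>i<t. card (verts (B i)))" by (intro sum_mono) auto
  then show ?thesis by (simp add: model_order_def)
qed

lemma lower_bound:
  fixes \<epsilon> :: real
  assumes "0 < \<epsilon>" "\<epsilon> < 2"
  shows "\<exists>G::nat ugraph. simple_graph G \<and> planar G \<and> average_degree G \<ge> 4 + \<epsilon> \<and>
    (\<forall>B. complete_model 4 G B \<longrightarrow> real (model_order 4 B) \<ge> (1 / 36) / \<epsilon>)"
proof (cases "18 * \<epsilon> \<le> 1")
  case True
  \<comment> \<open>The largest \<open>s\<close> for which \<open>4 + 1 / (18 * s)\<close>, the
    average degree obtained, reaches \<open>4 + \<epsilon>\<close>. Rounding down loses at most a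
    factor 2, whence the constant \<open>1 / 36\<close>.\<close>
  define s where "s = nat \<lfloor>1 / (18 * \<epsilon>)\<rfloor>"
  have ge1: "1 / (18 * \<epsilon>) \<ge> 1" using assms True by (simp add: field_simps)
  then have s1: "s \<ge> 1" unfolding s_def by linarith
  have s: "real s \<le> 1 / (18 * \<epsilon>)" "1 / (18 * \<epsilon>) < real s + 1" using ge1 unfolding s_def by linarith+
  let ?G = "pairs_graph (36 * s) (strip_pairs s)"
  have "2 * real (72 * s + 1) \<le> 2 * real (card (strip_pairs s))" using card_strip_pairs[OF s1] by simp
  then have "2 * real (72 * s + 1) / real (36 * s) \<le> average_degree ?G"
    unfolding average_degree_pairs[OF strip_pairs_less] by (rule divide_right_mono) simp
  moreover have "2 * real (72 * s + 1) / real (36 * s) = 4 + 1 / (18 * real s)" using s1 by (simp add: field_simps)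
  moreover have "\<epsilon> \<le> 1 / (18 * real s)" using s(1) s1 assms by (simp add: field_simps)
  ultimately have "average_degree ?G \<ge> 4 + \<epsilon>" by linarith
  moreover have "(1 / 36) / \<epsilon> \<le> real s"
  proof -
    have "1 / (18 * \<epsilon>) < 2 * real s" using s(2) s1 by simp
    then show ?thesis using assms by (simp add: field_simps)
  qed
  then have "real (model_order 4 B) \<ge> (1 / 36) / \<epsilon>" if "complete_model 4 ?G B" for B
    using strip_model_large[OF s1 that] by linarith
  ultimately show ?thesis using strip_planar simple_pairs_graph[OF strip_pairs_less] by blast
next
  case False
  \<comment> \<open>The average degree \<open>6 - 12 / N\<close> reaches
    \<open>4 + \<epsilon>\<close> as soon as \<open>N \<ge> 12 / (2 - \<epsilon>)\<close>.\<close>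
  define N where "N = nat \<lceil>12 / (2 - \<epsilon>)\<rceil> + 3"
  have N: "N \<ge> 3" "real N \<ge> 12 / (2 - \<epsilon>)" unfolding N_def by linarith+
  have sub: "dense_pairs N \<subseteq> {(a, b). a < b \<and> b < N}" by (auto simp: dense_pairs_def)
  let ?G = "pairs_graph N (dense_pairs N)"
  have "2 * real (3 * N - 6) \<le> 2 * real (card (dense_pairs N))" using card_dense_pairs[OF N(1)] by simp
  then have "2 * real (3 * N - 6) / real N \<le> average_degree ?G"
    unfolding average_degree_pairs[OF sub] by (rule divide_right_mono) simp
  moreover have "2 * real (3 * N - 6) / real N = 6 - 12 / real N"
    using N(1) by (simp add: of_nat_diff field_simps)
  moreover have "12 / real N \<le> 2 - \<epsilon>" using N assms by (simp add: field_simps)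
  ultimately have "average_degree ?G \<ge> 4 + \<epsilon>" by linarith
  moreover have "(1 / 36) / \<epsilon> \<le> 4" using False assms by (simp add: field_simps)
  then have "real (model_order 4 B) \<ge> (1 / 36) / \<epsilon>" if "complete_model 4 ?G B" for B
    using model_order_ge[OF that simple_pairs_graph[OF sub]] by linarith
  ultimately show ?thesis using dense_pairs_planar simple_pairs_graph[OF sub] by blast
qed

section \<open>Minimal dense subgraphs\<close>

definition induced :: "'a set set \<Rightarrow> 'a set \<Rightarrow> 'a set set" where
  "induced E W = {e \<in> E. e \<subseteq> W}"

text \<open>
  Unlike the average degree, this bound is inherited by one side of every separation along a
  clique with at most two vertices.
\<close>

definition dense_on :: "real \<Rightarrow> 'a set set \<Rightarrow> 'a set \<Rightarrow> bool" where
  "dense_on \<epsilon> E W \<longleftrightarrow> card W \<ge> 3 \<and>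
     real (card (induced E W)) \<ge> (2 + \<epsilon> / 2) * (real (card W) - 2) + 1"

lemma card_two_subsets:
  assumes "finite U" "\<And>e. e \<in> A \<Longrightarrow> e \<subseteq> U \<and> card e = 2"
  shows "card A \<le> card U choose 2"
proof -
  have "card A \<le> card {B. B \<subseteq> U \<and> card B = 2}"
    using assms by (intro card_mono) auto
  then show ?thesis by (simp add: n_subsets[OF assms(1)])
qed

lemma plane_drawing_subgraph:
  assumes "plane_drawing \<lparr>verts = V, edges = E\<rparr> pos \<gamma>" "W \<subseteq> V" "F \<subseteq> E"
  shows "plane_drawing \<lparr>verts = W, edges = F\<rparr> pos \<gamma>"
proof -
  have "inj_on pos W" using assms by (auto simp: plane_drawing_def intro: inj_on_subset)
  moreover have "(path_image (\<gamma> e) - pos ` e) \<inter> pos ` W = {}" if "e \<in> F" for e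
  proof -
    have "(path_image (\<gamma> e) - pos ` e) \<inter> pos ` V = {}"
      using assms(1) subsetD[OF assms(3) that] unfolding plane_drawing_def ugraph.simps by simp
    then show ?thesis using assms(2) by blast
  qed
  ultimately show ?thesis
    using assms(1) subsetD[OF assms(3)] unfolding plane_drawing_def ugraph.simps by simp
qed

lemma complete_model_of_model:
  assumes "has_model t (edges G) W" "W \<subseteq> verts G" "simple_graph G"
  shows "\<exists>B. complete_model t G B \<and> model_order t B \<le> card W"
proof -
  obtain S where S: "\<forall>i<t. conn (edges G) (S i) \<and> S i \<subseteq> W"
    "\<forall>i<t. \<forall>j<t. i \<noteq> j \<longrightarrow> S i \<inter> S j = {} \<and> (\<exists>x\<in>S i. \<exists>y\<in>S j. {x, y} \<in> edges G)"
    using assms(1) unfolding has_model_def by blast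
  define B where "B i = \<lparr>verts = S i, edges = induced (edges G) (S i)\<rparr>" for i
  have finW: "finite W" using assms finite_subset by (auto simp: simple_graph_def)
  have finS: "finite (S i)" if "i < t" for i using S(1) that finW finite_subset by blast
  have "subgraph (B i) G" if i: "i < t" for i
    using assms(2,3) S(1) finS[OF i] i by (auto simp: subgraph_def simple_graph_def B_def induced_def)
  moreover have "connected_graph (B i)" if i: "i < t" for i
  proof -
    have "adj_in (edges G) (S i) \<subseteq> {(x, y). {x, y} \<in> edges (B i)}"
      by (auto simp: adj_in_def B_def induced_def)
    then show ?thesis using S(1) i rtrancl_mono
      unfolding connected_graph_def conn_def B_def ugraph.simps by blast
  qed
  ultimately have "complete_model t G B"
    using S(2) by (simp add: complete_model_def B_def)
  moreover have "model_order t B = card (\<Union>i<t. S i)"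
    unfolding model_order_def B_def ugraph.simps
    using S(2) finS by (intro card_UN_disjoint[symmetric]) auto
  moreover have "card (\<Union>i<t. S i) \<le> card W"
    using S(1) finW by (intro card_mono) auto
  ultimately show ?thesis by auto
qed

locale minimal_dense =
  fixes V :: "'a set" and E :: "'a set set" and \<epsilon> :: real and W :: "'a set"
  assumes finV: "finite V" and simp: "\<And>e. e \<in> E \<Longrightarrow> e \<subseteq> V \<and> card e = 2"
    and eps: "0 < \<epsilon>" "\<epsilon> < 2"
    and W: "W \<subseteq> V" "dense_on \<epsilon> E W"
    and minimal: "\<And>U. U \<subseteq> W \<Longrightarrow> U \<noteq> W \<Longrightarrow> \<not> dense_on \<epsilon> E U"
begin

abbreviation "F \<equiv> induced E W"

section \<open>Consequences of minimality\<close>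

lemma finW: "finite W" using W finV finite_subset by blast

lemma F: "e \<in> F \<Longrightarrow> e \<subseteq> W \<and> card e = 2 \<and> e \<in> E"
  using simp by (auto simp: induced_def)

lemma finI: "U \<subseteq> W \<Longrightarrow> finite (induced E U)"
  by (rule finite_subset[of _ "Pow W"]) (auto simp: induced_def finW)

lemma nbrs_W: "nbrs F v \<subseteq> W - {v}"
proof
  fix u assume "u \<in> nbrs F v"
  then have "{v, u} \<in> F" by (simp add: nbrs_def)
  then show "u \<in> W - {v}" using F[of "{v, u}"] by (auto simp: card_2_iff doubleton_eq_iff)
qed

lemma card_induced_choose: "U \<subseteq> W \<Longrightarrow> card (induced E U) \<le> card U choose 2"
  using finW finite_subset simp by (intro card_two_subsets) (auto simp: induced_def)

text \<open>On three vertices the required number of edges is \<open>3 + \<epsilon> / 2\<close>,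
  which exceeds 3.\<close>

lemma card_W: "card W \<ge> 4"
proof (rule ccontr)
  assume "\<not> card W \<ge> 4"
  then have 3: "card W = 3" using W by (simp add: dense_on_def)
  then have "card F \<le> 3" using card_induced_choose[of W] by (simp add: choose_two)
  then show False using W eps 3 by (simp add: dense_on_def)
qed

text \<open>Deleting a vertex of degree at most 2 costs at most two edges but lowers the bound by
  \<open>2 + \<epsilon> / 2\<close>.\<close>

lemma min_degree:
  assumes v: "v \<in> W"
  shows "card (nbrs F v) \<ge> 3"
proof (rule ccontr)
  assume n: "\<not> ?thesis"
  have "F \<subseteq> induced E (W - {v}) \<union> (\<lambda>u. {v, u}) ` nbrs F v"
  proof
    fix e assume e: "e \<in> F"
    show "e \<in> induced E (W - {v}) \<union> (\<lambda>u. {v, u}) ` nbrs F v"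
    proof (cases "v \<in> e")
      case True
      then obtain u where "e = {v, u}" using F[OF e] by (auto simp: card_2_iff)
      then show ?thesis using e by (auto simp: nbrs_def)
    next
      case False
      then show ?thesis using e by (auto simp: induced_def)
    qed
  qed
  moreover have fin: "finite (nbrs F v)" using nbrs_W finW finite_subset by (meson finite_Diff)
  ultimately have "card F \<le> card (induced E (W - {v}) \<union> (\<lambda>u. {v, u}) ` nbrs F v)"
    using finI[of "W - {v}"] by (intro card_mono) auto
  also have "\<dots> \<le> card (induced E (W - {v})) + card ((\<lambda>u. {v, u}) ` nbrs F v)" by (rule card_Un_le)
  also have "card ((\<lambda>u. {v, u}) ` nbrs F v) \<le> 2" using card_image_le[OF fin, of "\<lambda>u. {v, u}"] n by linarith
  finally have "real (card F) \<le> real (card (induced E (W - {v}))) + 2" by simp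
  moreover have c: "real (card (W - {v})) = real (card W) - 1" using v finW card_W by (simp add: of_nat_diff)
  ultimately have "real (card (induced E (W - {v}))) \<ge> (2 + \<epsilon> / 2) * (real (card (W - {v})) - 2) + 1"
    using W(2) eps unfolding dense_on_def c by (simp add: algebra_simps)
  moreover have "card (W - {v}) \<ge> 3" using card_W v finW by simp
  ultimately have "dense_on \<epsilon> E (W - {v})" by (simp add: dense_on_def)
  then show False using minimal[of "W - {v}"] v by blast
qed

text \<open>Both sides are too sparse by minimality; adding the two bounds limits the edges of
  \<open>W\<close>. For \<open>card X \<le> 1\<close> the sum loses a multiple of
  \<open>2 + \<epsilon> / 2\<close>, which outweighs the second \<open>+ 1\<close>. If
  \<open>X\<close> is an edge, it is counted on both sides, and this offsets the second
  \<open>+ 1\<close> exactly; two nonadjacent vertices would not suffice.\<close>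

lemma no_separation:
  assumes sep: "W1 \<union> W2 = W" "W1 \<inter> W2 = X" "W1 \<noteq> W" "W2 \<noteq> W" "\<And>e. e \<in> F \<Longrightarrow> e \<subseteq> W1 \<or> e \<subseteq> W2"
    and X: "card X \<le> 1 \<or> (card X = 2 \<and> X \<in> F)" and c: "card W1 \<ge> 3" "card W2 \<ge> 3"
  shows False
proof -
  have sub: "W1 \<subseteq> W" "W2 \<subseteq> W" using sep by auto
  have fin: "finite W1" "finite W2" using sub finW finite_subset by blast+
  have "\<not> dense_on \<epsilon> E W1" "\<not> dense_on \<epsilon> E W2" using minimal sub sep by blast+
  then have lt: "real (card (induced E W1)) < (2 + \<epsilon> / 2) * (real (card W1) - 2) + 1"
    "real (card (induced E W2)) < (2 + \<epsilon> / 2) * (real (card W2) - 2) + 1"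
    using c by (auto simp: dense_on_def)
  have "card W1 + card W2 = card W + card X" using card_Un_Int[OF fin] sep by simp
  then have cW: "real (card W1) + real (card W2) = real (card W) + real (card X)" by linarith
  have "F = induced E W1 \<union> induced E W2" using sep(5) sub by (auto simp: induced_def)
  moreover have "induced E W1 \<inter> induced E W2 = induced E X" using sep(2) by (auto simp: induced_def)
  ultimately have "card (induced E W1) + card (induced E W2) = card F + card (induced E X)"
    using card_Un_Int[OF finI[OF sub(1)] finI[OF sub(2)]] by simp
  then have cF: "real (card (induced E W1)) + real (card (induced E W2)) = real (card F) + real (card (induced E X))"
    by linarith
  have d: "real (card F) \<ge> (2 + \<epsilon> / 2) * (real (card W) - 2) + 1" using W by (simp add: dense_on_def)
  have sum: "real (card F) + real (card (induced E X)) < (2 + \<epsilon> / 2) * (real (card W) + real (card X) - 4) + 2"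
    using lt cF cW[symmetric] by (simp add: algebra_simps)
  from X show False
  proof
    assume "card X \<le> 1"
    then have "(2 + \<epsilon> / 2) * (real (card W) + real (card X) - 4) \<le> (2 + \<epsilon> / 2) * (real (card W) - 3)"
      using eps by (intro mult_left_mono) auto
    then show False using sum d eps by (simp add: algebra_simps)
  next
    assume X2: "card X = 2 \<and> X \<in> F"
    then have "X \<in> induced E X" by (auto simp: induced_def)
    then have "card (induced E X) \<ge> 1" using finI[of X] sub sep
      by (metis One_nat_def Suc_leI card_gt_0_iff empty_iff le_infI1)
    then show False using sum d X2 by simp
  qed
qed

text \<open>A component \<open>K\<close> of \<open>W - X\<close> gives the separation into
  \<open>K \<union> X\<close> and \<open>W - K\<close>. Both parts have at least three vertices,
  because each contains all neighbours of one of its vertices.\<close>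

lemma connected_minus:
  assumes X: "X \<subseteq> W" "card X \<le> 1 \<or> (card X = 2 \<and> X \<in> F)"
  shows "conn F (W - X)"
proof (rule ccontr)
  assume n: "\<not> ?thesis"
  have "finite X" using X finW finite_subset by blast
  then have "card (W - X) \<ge> 2" using X card_W by (auto simp: card_Diff_subset)
  then have "W - X \<noteq> {}" by (metis card.empty not_numeral_le_zero)
  then obtain u w where uw: "u \<in> W - X" "w \<in> W - X" "(u, w) \<notin> (adj_in F (W - X))\<^sup>*"
    using n unfolding conn_def by blast
  define K where "K = {y. (u, y) \<in> (adj_in F (W - X))\<^sup>*}"
  have K: "K \<subseteq> W - X" "u \<in> K" "w \<notin> K"
    using adj_in_rtrancl_in[OF _ uw(1)] uw by (auto simp: K_def)
  have step: "b \<in> K" if "a \<in> K" "b \<in> W - X" "{a, b} \<in> F" for a b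
  proof -
    have "(a, b) \<in> adj_in F (W - X)" using that K by (auto simp: adj_in_def)
    then show ?thesis using that(1) unfolding K_def by (auto intro: rtrancl_into_rtrancl)
  qed
  have edge: "e \<subseteq> K \<union> X \<or> e \<subseteq> W - K" if e: "e \<in> F" for e
  proof -
    obtain a b where ab: "e = {a, b}" using F[OF e] by (auto simp: card_2_iff)
    have "a \<in> W" "b \<in> W" "{a, b} \<in> F" "{b, a} \<in> F" using F[OF e] e ab by (auto simp: insert_commute)
    then show ?thesis using step[of a b] step[of b a] ab by blast
  qed
  have big: "card Y \<ge> 3" if "Y \<subseteq> W" "a \<in> W" "nbrs F a \<subseteq> Y" for a Y
    using card_mono[of Y "nbrs F a"] that finW finite_subset min_degree[OF that(2)] by fastforce
  show False
  proof (rule no_separation[OF _ _ _ _ edge X(2)])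
    show "K \<union> X \<union> (W - K) = W" "(K \<union> X) \<inter> (W - K) = X" "K \<union> X \<noteq> W" "W - K \<noteq> W"
      using K X(1) uw by auto
    have "nbrs F u \<subseteq> K \<union> X"
    proof
      fix b assume "b \<in> nbrs F u"
      then show "b \<in> K \<union> X" using step[OF K(2), of b] nbrs_W[of u] by (auto simp: nbrs_def)
    qed
    then show "card (K \<union> X) \<ge> 3" using big[of "K \<union> X" u] K X(1) uw by auto
    have "nbrs F w \<subseteq> W - K"
    proof
      fix b assume "b \<in> nbrs F w"
      then show "b \<in> W - K" using step[of b w] K(3) uw nbrs_W[of w] by (auto simp: nbrs_def insert_commute)
    qed
    then show "card (W - K) \<ge> 3" using big[of "W - K" w] uw by auto
  qed
qed

text \<open>Two neighbours of \<open>v\<close> are joined by a path that avoids \<open>v\<close>.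
  The cycle is the start of the ear decomposition.\<close>

lemma cycle_exists: "\<exists>C. is_cycle C \<and> C \<subseteq> F"
proof -
  obtain v where v: "v \<in> W" using card_W by fastforce
  have "\<exists>a b. a \<in> nbrs F v \<and> b \<in> nbrs F v \<and> a \<noteq> b"
  proof (rule ccontr)
    assume "\<not> ?thesis"
    then have "card (nbrs F v) \<le> 1"
      by (metis One_nat_def card.infinite card_le_Suc0_iff_eq zero_le_one)
    then show False using min_degree[OF v] by simp
  qed
  then obtain a b where ab: "a \<in> nbrs F v" "b \<in> nbrs F v" "a \<noteq> b" by blast
  have "conn F (W - {v})" using connected_minus[of "{v}"] v by simp
  moreover have "a \<in> W - {v}" "b \<in> W - {v}" using ab nbrs_W by blast+
  ultimately obtain p where p: "distinct p" "p \<noteq> []" "hd p = a" "last p = b" "set p \<subseteq> W - {v}" "path_edges p \<subseteq> F"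
    using conn_obtain_path by metis
  have "length p \<ge> 2" using p ab(3) by (cases p) (auto simp: Suc_le_eq)
  then have "is_cycle (cyc_edges (v # p))" using p by (intro is_cycleI) auto
  moreover have "cyc_edges (v # p) \<subseteq> F" using p ab by (auto simp: cyc_edges_Cons nbrs_def)
  ultimately show ?thesis by blast
qed

lemma small_model_planar:
  assumes draw: "plane_drawing \<lparr>verts = V, edges = E\<rparr> pos \<gamma>"
  shows "\<exists>U\<subseteq>W. has_model 4 E U \<and> int (card U) \<le> \<lceil>8 / \<epsilon>\<rceil> + 2"
proof -
  have FE: "F \<subseteq> E" by (auto simp: induced_def)
  have draw': "plane_drawing \<lparr>verts = W, edges = F\<rparr> pos \<gamma>"
    by (rule plane_drawing_subgraph[OF draw W(1) FE])
  interpret plane_graph W F pos \<gamma>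
    using finW F draw' by unfold_locales auto
  have con0: "conn F W" using connected_minus[of "{}"] by simp
  have con1: "conn F (W - {v})" if "v \<in> W" for v using connected_minus[of "{v}"] that by simp
  have con2: "conn F (W - {x, y})" if "{x, y} \<in> F" for x y
    using connected_minus[of "{x, y}"] F[OF that] that by simp
  obtain C where C: "is_cycle C" "C \<subseteq> F" using cycle_exists by blast
  obtain n bd D where faces: "faces_of F n bd D" using faces_exist[OF con0 con1 C] by blast
  have UF: "\<Union>F = W"
  proof
    show "W \<subseteq> \<Union>F"
    proof
      fix v assume "v \<in> W"
      then have "nbrs F v \<noteq> {}" using min_degree by fastforce
      then show "v \<in> \<Union>F" by (auto simp: nbrs_def)
    qed
  qed (use F in blast)
  interpret face_system W F n bd
  proof
    show "finite W" by (rule finW)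
    show "e \<subseteq> W \<and> card e = 2" if "e \<in> F" for e using F[OF that] by simp
    show "is_cycle (bd i)" "bd i \<subseteq> F" if "i < n" for i
      using faces that by (simp_all add: faces_of_def)
    show "card {i. i < n \<and> e \<in> bd i} = 2" if "e \<in> F" for e
      using faces that by (simp add: faces_of_def)
    show "\<exists>A\<subseteq>{..<n}. \<forall>e\<in>F. e \<in> C' \<longleftrightarrow> card {i\<in>A. e \<in> bd i} = 1" if "is_cycle C'" "C' \<subseteq> F" for C'
      using faces_generate[OF faces that] .
    show "n + card W = card F + 2" using faces UF by (simp add: faces_of_def)
    show "conn F (W - {v})" if "v \<in> W" for v by (rule con1[OF that])
    show "conn F (W - {x, y})" if "{x, y} \<in> F" for x y by (rule con2[OF that])
    show "3 \<le> card (nbrs F v)" if "v \<in> W" for v by (rule min_degree[OF that])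
  qed
  have "real (card F) > (2 + \<epsilon> / 2) * (real (card W) - 3)"
  proof -
    have "(2 + \<epsilon> / 2) * (real (card W) - 3) \<le> (2 + \<epsilon> / 2) * (real (card W) - 2)"
      using eps by (intro mult_left_mono) auto
    then show ?thesis using W(2) unfolding dense_on_def by linarith
  qed
  moreover have "W \<noteq> {}" using card_W by auto
  ultimately obtain v where v: "v \<in> W" "has_model 4 F (star v)" "int (card (star v)) \<le> \<lceil>8 / \<epsilon>\<rceil> + 2"
    using small_model[OF eps] by blast
  have "star v \<subseteq> W" using vs_V by (auto simp: star_def faces_at_def)
  moreover have "has_model 4 E (star v)"
  proof -
    have "conn E S" if "conn F S" for S
      using that rtrancl_mono[OF adj_in_mono[OF order_refl FE, of S]] unfolding conn_def by blast
    moreover obtain S :: "nat \<Rightarrow> 'a set" where "\<forall>i<4. conn F (S i) \<and> S i \<subseteq> star v"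
      "\<forall>i<4. \<forall>j<4. i \<noteq> j \<longrightarrow> S i \<inter> S j = {} \<and> (\<exists>x\<in>S i. \<exists>y\<in>S j. {x, y} \<in> F)"
      using v(2) unfolding has_model_def by auto
    ultimately show ?thesis using FE unfolding has_model_def
      by (intro exI[of _ S]) (meson subsetD)
  qed
  ultimately show ?thesis using v(3) by blast
qed

end

lemma upper_bound:
  assumes eps: "0 < \<epsilon>" "\<epsilon> < 2" and G: "simple_graph G" "planar G" "average_degree G \<ge> 4 + \<epsilon>"
  shows "\<exists>B. complete_model 4 G B \<and> int (model_order 4 B) \<le> \<lceil>8 / \<epsilon>\<rceil> + \<lceil>2 / \<epsilon>\<rceil>"
proof -
  let ?V = "verts G" and ?E = "edges G"
  have finV: "finite ?V" and simp: "\<And>e. e \<in> ?E \<Longrightarrow> e \<subseteq> ?V \<and> card e = 2"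
    using G by (auto simp: simple_graph_def)
  obtain pos \<gamma> where draw: "plane_drawing G pos \<gamma>" using G by (auto simp: planar_def)
  then have draw': "plane_drawing \<lparr>verts = ?V, edges = ?E\<rparr> pos \<gamma>"
    by (simp add: plane_drawing_def)
  have n0: "card ?V > 0"
  proof (rule ccontr)
    assume "\<not> ?thesis"
    then show False using G(3) eps by (simp add: average_degree_def)
  qed
  have m: "real (card ?E) \<ge> (2 + \<epsilon> / 2) * real (card ?V)"
    using G(3) n0 by (simp add: average_degree_def field_simps)
  have ind: "induced ?E ?V = ?E" using simp by (auto simp: induced_def)
  have "card ?E \<le> card ?V choose 2" by (rule card_two_subsets[OF finV simp])
  moreover have "real (card ?E) \<ge> 2 * real (card ?V)"
    using m eps mult_right_mono[of 2 "2 + \<epsilon> / 2" "real (card ?V)"] by linarith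
  then have "2 * card ?V \<le> card ?E" by linarith
  \<comment> \<open>One or two vertices do not span twice as many edges as there are
    vertices.\<close>
  ultimately have "card ?V \<ge> 3"
    using n0 by (cases "card ?V = 1 \<or> card ?V = 2") (auto simp: choose_two)
  moreover have "(2 + \<epsilon> / 2) * (real (card ?V) - 2) + 1 \<le> (2 + \<epsilon> / 2) * real (card ?V)"
    using eps by (simp add: algebra_simps)
  ultimately have "dense_on \<epsilon> ?E ?V" using m unfolding dense_on_def ind by linarith
  then obtain W where W: "W \<subseteq> ?V \<and> dense_on \<epsilon> ?E W"
    and least: "\<And>U. U \<subseteq> ?V \<and> dense_on \<epsilon> ?E U \<Longrightarrow> card W \<le> card U"
    using ex_has_least_nat[of "\<lambda>U. U \<subseteq> ?V \<and> dense_on \<epsilon> ?E U" ?V card] by blast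
  have "\<not> dense_on \<epsilon> ?E U" if "U \<subseteq> W" "U \<noteq> W" for U
  proof
    assume "dense_on \<epsilon> ?E U"
    then have "card W \<le> card U" using least that W by blast
    moreover have "finite W" using W finV finite_subset by blast
    ultimately show False using that psubset_card_mono[of W U] by auto
  qed
  then interpret minimal_dense ?V ?E \<epsilon> W
    using finV simp eps W by unfold_locales auto
  obtain U where U: "U \<subseteq> W" "has_model 4 ?E U" "int (card U) \<le> \<lceil>8 / \<epsilon>\<rceil> + 2"
    using small_model_planar[OF draw'] by blast
  obtain B where B: "complete_model 4 G B" "model_order 4 B \<le> card U"
    using complete_model_of_model[OF U(2) _ G(1)] U(1) W by blast
  have "\<lceil>2 / \<epsilon>\<rceil> \<ge> 2"
  proof -
    have "2 / \<epsilon> > 1" using eps by (simp add: field_simps)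
    then show ?thesis by linarith
  qed
  then have "int (model_order 4 B) \<le> \<lceil>8 / \<epsilon>\<rceil> + \<lceil>2 / \<epsilon>\<rceil>" using B(2) U(3) by linarith
  then show ?thesis using B(1) by blast
qed

theorem theorem5p8:
  shows "(\<forall>\<epsilon>::real. 0 < \<epsilon> \<and> \<epsilon> < 2 \<longrightarrow>
            (\<forall>G::'a ugraph. simple_graph G \<and> planar G \<and> average_degree G \<ge> 4 + \<epsilon> \<longrightarrow>
               (\<exists>B. complete_model 4 G B \<and>
                    int (model_order 4 B) \<le> \<lceil>8 / \<epsilon>\<rceil> + \<lceil>2 / \<epsilon>\<rceil>)))
         \<and> (\<exists>c::real. c > 0 \<and>
              (\<forall>\<epsilon>::real. 0 < \<epsilon> \<and> \<epsilon> < 2 \<longrightarrow>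
                 (\<exists>G::nat ugraph. simple_graph G \<and> planar G \<and> average_degree G \<ge> 4 + \<epsilon> \<and>
                    (\<forall>B. complete_model 4 G B \<longrightarrow> real (model_order 4 B) \<ge> c / \<epsilon>))))"
proof (intro conjI allI impI)
  fix \<epsilon> :: real and G :: "'a ugraph"
  assume "0 < \<epsilon> \<and> \<epsilon> < 2" "simple_graph G \<and> planar G \<and> average_degree G \<ge> 4 + \<epsilon>"
  then show "\<exists>B. complete_model 4 G B \<and> int (model_order 4 B) \<le> \<lceil>8 / \<epsilon>\<rceil> + \<lceil>2 / \<epsilon>\<rceil>"
    using upper_bound by blast
next
  show "\<exists>c::real. c > 0 \<and>
    (\<forall>\<epsilon>::real. 0 < \<epsilon> \<and> \<epsilon> < 2 \<longrightarrow>
       (\<exists>G::nat ugraph. simple_graph G \<and> planar G \<and> average_degree G \<ge> 4 + \<epsilon> \<and>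
          (\<forall>B. complete_model 4 G B \<longrightarrow> real (model_order 4 B) \<ge> c / \<epsilon>)))"
    using lower_bound by (intro exI[of _ "1 / 36"]) auto
qed

end
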